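(* Let $G$ be a real Lie group acting continuously on a locally compact second countable metrizable space $X$, and let $E$ be a countable set with a coding map $E\to G$, $e\mapsto g_e$. Suppose a Markov chain on $E$ is irreducible and positive recurrent and denote by $\pi$ its stationary distribution. Let $x_0\in X$, $e\in E$, and let $m$ be a Borel probability measure on $X$ invariant under $g_w$ for every admissible word $w\in E^*$ starting with $e$. If the trajectory $(b_{n-1}\cdots b_0x_0)_n$ equidistributes towards $m$ for $\mu_e^{\otimes\mathbb{N}}$-a.e. $b=(b_k)_{k\ge0}\in G^{\mathbb{N}}$, then $(g_{\omega|_n}x_0,T^n\omega)_n$ equidistributes in $X\times\Omega$ towards $m\otimes\mathbb{P}_\pi$ for $\mathbb{P}_e$-a.e. $\omega\in\Omega$.
   Context: Markov chain notation: $p_{e',e}$ is the probability of going from state $e$ to state $e'$. $\Omega=E^{\mathbb{N}}$ (indices from $0$, product of discrete topologies), $T$ is the shift on $\Omega$. $\mathbb{P}_e$ is the Markov measure on $\Omega$ started at $\omega_0=e$, with expectation $\mathbb{E}_e$, and $\mathbb{P}_\lambda=\sum_e\lambda(\{e\})\mathbb{P}_e$ for a probability distribution $\lambda$ on $E$. $\tau_e(\omega)=\inf\{n\ge1:\omega_n=e\}$. Irreducible: $\mathbb{P}_e[\tau_{e'}<\infty]>0$ for all $e,e'$. Positive recurrent: $\mathbb{E}_e[\tau_e]<\infty$ for all $e$. $E^*$ is the set of finite words over $E$, written right to left: for $w=e_{n-1}\ldots e_0$, $g_w=g_{e_{n-1}}\cdots g_{e_0}$; $\omega|_n=\omega_{n-1}\ldots\omega_0$.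 A non-empty word $w=e_{n-1}\ldots e_0$ is admissible if $p_{e_k,e_{k-1}}>0$ for $1\le k\le n-1$; it starts with $e$ if $e_0=e$. Renewal measure: $\mu_e$ is the law on $G$ of $g_{\omega|_{\tau_e}}=g_{\omega_{\tau_e-1}}\cdots g_{\omega_0}$ under $\mathbb{P}_e$. A sequence $(y_n)_{n\ge 0}$ in a Polish space $Y$ equidistributes towards a probability measure $\eta$ if $\frac1n\sum_{k=0}^{n-1}f(y_k)\to\int f\,d\eta$ for every bounded continuous $f$ on $Y$. *)

theory Defs
  imports "HOL-Probability.Probability"
begin

section \<open>Lie groups\<close>

class group_mult = monoid_mult + inverse +
  assumes group_left_inverse: "inverse a * a = 1"
    and group_divide: "a / b = a * inverse b"

text \<open>
  Iterated directional derivatives. The sets \<open>S\<close> are always open subsets of finite-dimensional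
  spaces below, where this is the usual notion of a function of class \<open>C\<^sup>k\<close>.
\<close>

primrec Ck_on :: "nat \<Rightarrow> 'a set \<Rightarrow> ('a::real_normed_vector \<Rightarrow> 'b::real_normed_vector) \<Rightarrow> bool" where
  "Ck_on 0 S f \<longleftrightarrow> continuous_on S f"
| "Ck_on (Suc k) S f \<longleftrightarrow>
     (\<exists>f'. (\<forall>x\<in>S. (f has_derivative f' x) (at x)) \<and> (\<forall>v. Ck_on k S (\<lambda>x. f' x v)))"

definition smooth_on :: "'a set \<Rightarrow> ('a::real_normed_vector \<Rightarrow> 'b::real_normed_vector) \<Rightarrow> bool" where
  "smooth_on S f \<longleftrightarrow> (\<forall>k. Ck_on k S f)"

text \<open>A chart is a pair of its domain and its coordinate map.\<close>

type_synonym ('g, 'v) chart = "'g set \<times> ('g \<Rightarrow> 'v)"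

definition smooth_atlas ::
    "('g::topological_space, 'v::real_normed_vector) chart set \<Rightarrow> bool" where
  "smooth_atlas A \<longleftrightarrow>
     (\<Union>(U, \<phi>)\<in>A. U) = UNIV \<and>
     (\<forall>(U, \<phi>)\<in>A. open U \<and> open (\<phi> ` U) \<and> (\<exists>\<phi>'. homeomorphism U (\<phi> ` U) \<phi> \<phi>')) \<and>
     (\<forall>(U, \<phi>)\<in>A. \<forall>(V, \<psi>)\<in>A. smooth_on (\<phi> ` (U \<inter> V)) (\<psi> \<circ> inv_into U \<phi>))"

definition smooth_map ::
    "('g::topological_space, 'v::real_normed_vector) chart set \<Rightarrow>
     ('h::topological_space, 'w::real_normed_vector) chart set \<Rightarrow> ('g \<Rightarrow> 'h) \<Rightarrow> bool" where
  "smooth_map A B f \<longleftrightarrow>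
     continuous_on UNIV f \<and>
     (\<forall>(U, \<phi>)\<in>A. \<forall>(V, \<psi>)\<in>B. smooth_on (\<phi> ` (U \<inter> f -` V)) (\<psi> \<circ> f \<circ> inv_into U \<phi>))"

definition prod_charts ::
    "('g, 'v) chart set \<Rightarrow> ('h, 'w) chart set \<Rightarrow> ('g \<times> 'h, 'v \<times> 'w) chart set" where
  "prod_charts A B = (\<lambda>((U, \<phi>), (V, \<psi>)). (U \<times> V, map_prod \<phi> \<psi>)) ` (A \<times> B)"

text \<open>
  The model space is a type of class \<^class>\<open>real_normed_vector\<close> of finite dimension, rather than of
  class \<^class>\<open>euclidean_space\<close>, because the latter excludes dimension \<open>0\<close>, that is, the discrete
  groups.
\<close>

locale lie_group =
  fixes A :: "('g::{group_mult, t2_space, second_countable_topology},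
               'v::real_normed_vector) chart set"
  assumes finite_dimensional: "\<exists>B::'v set. finite B \<and> span B = UNIV"
    and atlas: "smooth_atlas A"
    and smooth_mult: "smooth_map (prod_charts A A) A (\<lambda>(x, y). x * y)"
    and smooth_inverse: "smooth_map A A inverse"

definition continuous_action ::
    "('g::{group_mult, topological_space} \<Rightarrow> 'x::topological_space \<Rightarrow> 'x) \<Rightarrow> bool" where
  "continuous_action act \<longleftrightarrow>
     (\<forall>x. act 1 x = x) \<and> (\<forall>g h x. act (g * h) x = act g (act h x)) \<and>
     continuous_on UNIV (\<lambda>(g, x). act g x)"


section \<open>Equidistribution\<close>

definition equidistributes :: "(nat \<Rightarrow> 'y::topological_space) \<Rightarrow> 'y measure \<Rightarrow> bool" where
  "equidistributes y \<eta> \<longleftrightarrow>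
     (\<forall>f::'y \<Rightarrow> real. continuous_on UNIV f \<and> bounded (range f) \<longrightarrow>
        (\<lambda>n. (\<Sum>k<n. f (y k)) / real n) \<longlonglongrightarrow> (\<integral>x. f x \<partial>\<eta>))"


section \<open>Markov chains on a countable set\<close>

text \<open>The topology on \<open>nat \<Rightarrow> 'e\<close> is then the product of the discrete topologies.\<close>

class countable_discrete = countable + discrete_topology

lemma countable_discrete_subbasis:
  "\<exists>B::'a::countable_discrete set set. countable B \<and> open = generate_topology B"
proof -
  define B where "B = range (\<lambda>x::'a. {x})"
  have "generate_topology B S" for S :: "'a set"
  proof -
    have "generate_topology B (\<Union>x\<in>S. {x})"
      unfolding B_def by (intro generate_topology_Union generate_topology.Basis) auto
    then show ?thesis by simp
  qed
  then have "open = generate_topology B"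
    by (auto simp: fun_eq_iff discrete_topology_class.open_discrete)
  then show "\<exists>B::'a set set. countable B \<and> open = generate_topology B"
    by (intro exI[of _ B]) (auto simp: B_def)
qed

instance countable_discrete \<subseteq> second_countable_topology
  by standard (rule countable_discrete_subbasis)

text \<open>
  A chain is given by its kernel \<open>K\<close>: the law of the next state is \<open>K e\<close> when the current state
  is \<open>e\<close>.
\<close>

definition trans_prob :: "('e \<Rightarrow> 'e pmf) \<Rightarrow> 'e \<Rightarrow> 'e \<Rightarrow> real" where
  "trans_prob K e' e = pmf (K e) e'"

text \<open>
  The law of the \<open>n\<close>-th coordinate given the coordinates before \<open>n\<close>, for the chain started at \<open>e\<close>.
\<close>

definition markov_step :: "('e \<Rightarrow> 'e pmf) \<Rightarrow> 'e \<Rightarrow> nat \<Rightarrow> (nat \<Rightarrow> 'e) \<Rightarrow> 'e measure" where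
  "markov_step K e n \<omega> = measure_pmf (if n = 0 then return_pmf e else K (\<omega> (n - 1)))"

text \<open>
  The Markov measure is the Ionescu-Tulcea measure of these kernels; see \<open>emeasure_markov_cylinder\<close>
  for its values on cylinders.
\<close>

definition markov :: "('e::countable \<Rightarrow> 'e pmf) \<Rightarrow> 'e \<Rightarrow> (nat \<Rightarrow> 'e) measure" where
  "markov K e =
     projective_family.lim UNIV (Ionescu_Tulcea.CI (markov_step K e) (\<lambda>_. count_space UNIV))
       (\<lambda>_. count_space UNIV)"

definition markov_init :: "('e::countable \<Rightarrow> 'e pmf) \<Rightarrow> 'e pmf \<Rightarrow> (nat \<Rightarrow> 'e) measure" where
  "markov_init K \<nu> = measure_pmf \<nu> \<bind> markov K"

definition stationary :: "('e \<Rightarrow> 'e pmf) \<Rightarrow> 'e pmf \<Rightarrow> bool" where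
  "stationary K \<pi> \<longleftrightarrow> bind_pmf \<pi> K = \<pi>"

definition return_time :: "'e \<Rightarrow> (nat \<Rightarrow> 'e) \<Rightarrow> enat" where
  "return_time e \<omega> = Inf {enat n | n. 1 \<le> n \<and> \<omega> n = e}"

definition irreducible_chain :: "('e::countable \<Rightarrow> 'e pmf) \<Rightarrow> bool" where
  "irreducible_chain K \<longleftrightarrow> (\<forall>e e'. \<P>(\<omega> in markov K e. return_time e' \<omega> < \<infinity>) > 0)"

definition positive_recurrent :: "('e::countable \<Rightarrow> 'e pmf) \<Rightarrow> bool" where
  "positive_recurrent K \<longleftrightarrow>
     (\<forall>e. (\<integral>\<^sup>+\<omega>. ennreal_of_enat (return_time e \<omega>) \<partial>markov K e) < \<infinity>)"

definition shift_map :: "(nat \<Rightarrow> 'e) \<Rightarrow> nat \<Rightarrow> 'e" where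
  "shift_map \<omega> = (\<lambda>n. \<omega> (Suc n))"


section \<open>Words and the renewal measure\<close>

text \<open>
  Words are written from right to left: the list \<open>[e\<^sub>n\<^sub>-\<^sub>1, \<dots>, e\<^sub>0]\<close> stands for the word
  \<open>e\<^sub>n\<^sub>-\<^sub>1 \<dots> e\<^sub>0\<close>, so that \<open>e\<^sub>k\<close> is \<open>rev w ! k\<close>.
\<close>

definition prefix_word :: "(nat \<Rightarrow> 'e) \<Rightarrow> nat \<Rightarrow> 'e list" where
  "prefix_word \<omega> n = map \<omega> (rev [0..<n])"

definition word_prod :: "('e \<Rightarrow> 'g::monoid_mult) \<Rightarrow> 'e list \<Rightarrow> 'g" where
  "word_prod g w = prod_list (map g w)"

definition admissible :: "('e \<Rightarrow> 'e pmf) \<Rightarrow> 'e list \<Rightarrow> bool" where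
  "admissible K w \<longleftrightarrow> w \<noteq> [] \<and>
     (\<forall>k. 1 \<le> k \<and> k < length w \<longrightarrow> trans_prob K (rev w ! k) (rev w ! (k - 1)) > 0)"

definition starts_with :: "'e list \<Rightarrow> 'e \<Rightarrow> bool" where
  "starts_with w e \<longleftrightarrow> w \<noteq> [] \<and> rev w ! 0 = e"

definition renewal_measure ::
    "('e::countable \<Rightarrow> 'e pmf) \<Rightarrow> ('e \<Rightarrow> 'g::{monoid_mult, topological_space}) \<Rightarrow> 'e \<Rightarrow> 'g measure" where
  "renewal_measure K g e =
     distr (markov K e) borel (\<lambda>\<omega>. word_prod g (prefix_word \<omega> (the_enat (return_time e \<omega>))))"


section \<open>The Markov measure on cylinders\<close>

lemma markov_step_0: "markov_step K e 0 \<omega> = measure_pmf (return_pmf e)"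
  by (simp add: markov_step_def)

lemma Ionescu_Tulcea_markov:
  fixes K :: "'e::countable \<Rightarrow> 'e pmf"
  shows "Ionescu_Tulcea (markov_step K e) (\<lambda>_. count_space UNIV)"
proof (rule Ionescu_Tulcea.intro)
  fix i
  show "markov_step K e i \<in> measurable (PiM {0..<i} (\<lambda>_. count_space UNIV))
          (subprob_algebra (count_space UNIV))"
  proof (cases i)
    case 0
    then show ?thesis
      by (auto simp: markov_step_def[abs_def] space_subprob_algebra
        intro!: measurable_const measure_pmf.subprob_space_axioms prob_space_imp_subprob_space
          measure_pmf.prob_space_axioms)
  next
    case (Suc j)
    have "(\<lambda>\<omega>. \<omega> j) \<in> measurable (PiM {0..<i} (\<lambda>_. count_space (UNIV::'e set))) (count_space UNIV)"
      using Suc by (intro measurable_component_singleton) auto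
    moreover have "(\<lambda>x. measure_pmf (K x)) \<in> measurable (count_space UNIV)
        (subprob_algebra (count_space UNIV))"
      by (auto simp: space_subprob_algebra intro!: prob_space_imp_subprob_space
          measure_pmf.prob_space_axioms)
    ultimately have "(\<lambda>\<omega>. measure_pmf (K (\<omega> j))) \<in> measurable (PiM {0..<i} (\<lambda>_. count_space UNIV))
        (subprob_algebra (count_space UNIV))"
      by (rule measurable_compose)
    with Suc show ?thesis
      by (simp add: markov_step_def[abs_def])
  qed
next
  show "prob_space (markov_step K e i x)" for i x
    unfolding markov_step_def by (rule measure_pmf.prob_space_axioms)
qed

lemma sets_markov: "sets (markov K e) = sets (PiM UNIV (\<lambda>_. count_space UNIV))"
proof -
  interpret Ionescu_Tulcea "markov_step K e" "\<lambda>_. count_space UNIV"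
    by (rule Ionescu_Tulcea_markov)
  show ?thesis unfolding markov_def by simp
qed

lemma space_markov: "space (markov K e) = UNIV"
  using sets_eq_imp_space_eq[OF sets_markov[of K e]] by (simp add: space_PiM PiE_def)

lemma emeasure_markov_cylinder:
  fixes K :: "'e::countable \<Rightarrow> 'e pmf"
  shows "emeasure (markov K e) {\<omega>. \<forall>k\<le>n. \<omega> k = a k} =
    ennreal (of_bool (a 0 = e) * (\<Prod>k<n. trans_prob K (a (Suc k)) (a k)))"
proof -
  interpret IT: Ionescu_Tulcea "markov_step K e" "\<lambda>_. count_space UNIV"
    by (rule Ionescu_Tulcea_markov)
  let ?M = "\<lambda>_::nat. count_space (UNIV::'e set)"
  let ?X = "\<lambda>n. {restrict a {0..<n}}"
  have X: "?X n \<in> sets (PiM {0..<n} ?M)" for n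
  proof -
    have "?X n = (\<Pi>\<^sub>E i\<in>{0..<n}. {a i})"
      by (subst PiE_singleton[of "restrict a {0..<n}" "{0..<n}", symmetric])
         (auto intro!: PiE_cong)
    then show ?thesis by (simp add: sets_PiM_I_finite)
  qed
  have E: "emeasure (IT.C 0 (Suc n) (\<lambda>_. undefined)) (?X (Suc n)) =
      emeasure (IT.C 0 n (\<lambda>_. undefined)) (?X n) *
      emeasure (markov_step K e n (restrict a {0..<n})) {a n}" for n
  proof -
    have u: "(\<lambda>_. undefined) \<in> space (PiM {0..<0} ?M)" by (simp add: space_PiM)
    have "emeasure (IT.C 0 (Suc n) (\<lambda>_. undefined)) (?X (Suc n)) =
      (\<integral>\<^sup>+\<omega>. emeasure (IT.eP n \<omega>) (?X (Suc n)) \<partial>IT.C 0 n (\<lambda>_. undefined))"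
      using u X[of "Suc n"] IT.measurable_eP[of n]
      by (simp add: emeasure_bind[where N="PiM {0..<Suc n} ?M"] IT.space_C space_PiM_empty_iff
          measurable_cong_sets[OF IT.sets_C[OF u] refl])
    also have "\<dots> = (\<integral>\<^sup>+\<omega>. emeasure (markov_step K e n (restrict a {0..<n})) {a n} *
        indicator (?X n) \<omega> \<partial>IT.C 0 n (\<lambda>_. undefined))"
    proof (rule nn_integral_cong)
      fix \<omega> assume "\<omega> \<in> space (IT.C 0 n (\<lambda>_. undefined))"
      then have w: "\<omega> \<in> space (PiM {0..<n} ?M)" by (simp add: IT.space_C[OF u])
      have "fun_upd \<omega> n -` ?X (Suc n) = (if \<omega> = restrict a {0..<n} then {a n} else {})"
      proof -
        have "\<omega> = restrict a {0..<n} \<and> x = a n" if h: "fun_upd \<omega> n x = restrict a {0..<Suc n}" for x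
        proof
          show "x = a n" using fun_cong[OF h, of n] by simp
          show "\<omega> = restrict a {0..<n}"
          proof
            fix i show "\<omega> i = restrict a {0..<n} i"
              using fun_cong[OF h, of i] w
              by (cases "i = n") (auto simp: space_PiM PiE_def extensional_def restrict_def split: if_splits)
          qed
        qed
        moreover have "fun_upd (restrict a {0..<n}) n (a n) = restrict a {0..<Suc n}"
          by (auto simp: fun_eq_iff)
        ultimately show ?thesis by (auto simp del: fun_upd_apply)
      qed
      then show "emeasure (IT.eP n \<omega>) (?X (Suc n)) =
          emeasure (markov_step K e n (restrict a {0..<n})) {a n} * indicator (?X n) \<omega>"
        using IT.emeasure_eP[OF w X] by (auto split: split_indicator)
    qed
    also have "\<dots> = emeasure (IT.C 0 n (\<lambda>_. undefined)) (?X n) *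
      emeasure (markov_step K e n (restrict a {0..<n})) {a n}"
      using X[of n] by (subst nn_integral_cmult_indicator) (auto simp: IT.sets_C[OF u] mult.commute)
    finally show ?thesis .
  qed
  have C: "emeasure (IT.C 0 (Suc n) (\<lambda>_. undefined)) (?X (Suc n)) =
    ennreal (of_bool (a 0 = e) * (\<Prod>k<n. trans_prob K (a (Suc k)) (a k)))" for n
  proof (induction n)
    case 0
    have "emeasure (IT.C 0 0 (\<lambda>_. undefined)) (?X 0) = 1"
      using X[of 0] by (simp add: restrict_def)
    then show ?case
      unfolding E[of 0] by (simp add: markov_step_0 emeasure_pmf_single)
  next
    case (Suc n)
    show ?case
      unfolding E[of "Suc n"] Suc.IH
      by (simp add: markov_step_def emeasure_pmf_single trans_prob_def ennreal_mult[symmetric]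
          prod_nonneg mult.assoc)
  qed
  have emb: "{\<omega>. \<forall>k\<le>n. \<omega> k = a k} = IT.PF.emb UNIV {0..<Suc n} (?X (Suc n))"
    by (auto simp: prod_emb_def space_PiM fun_eq_iff restrict_def less_Suc_eq_le) metis
  have "emeasure (markov K e) {\<omega>. \<forall>k\<le>n. \<omega> k = a k} = emeasure (IT.CI {0..<Suc n}) (?X (Suc n))"
    unfolding markov_def emb by (rule IT.lim[OF _ X]) simp
  also have "\<dots> = emeasure (IT.C 0 (Suc n) (\<lambda>_. undefined)) (IT.PF.emb {0..<Suc n} {0..<Suc n} (?X (Suc n)))"
    by (rule IT.emeasure_CI[OF _ X]) simp
  also have "IT.PF.emb {0..<Suc n} {0..<Suc n} (?X (Suc n)) = ?X (Suc n)"
    by (rule prod_emb_id) (auto simp: PiE_def)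
  finally show ?thesis unfolding C .
qed

end

theory Submission
  imports Defs
begin

text \<open>
  Cut a path of the chain started at \<open>e\<close> at its visits to \<open>e\<close>. The excursions are independent and
  identically distributed words, and the path is their concatenation. Let \<open>z\<^sub>j\<close> be the point
  reached from \<open>x\<^sub>0\<close> after \<open>j\<close> excursions: this is the random walk of the renewal measure, which
  equidistributes towards \<open>m\<close>. Let \<open>f \<ge> 0\<close> be continuous, bounded, and dependent on finitely many
  letters only. The sum of \<open>f\<close> over the first \<open>L\<close> steps of the \<open>j\<close>-th excursion has conditional
  expectation \<open>F(z\<^sub>j)\<close> given the past, with \<open>F\<close> bounded and continuous, so by a law of large numbers
  for bounded variables with correlations of finite range its averages converge to \<open>\<integral>F dm\<close>. By
  the invariance of \<open>m\<close> and Kac's formula, \<open>\<integral>F dm\<close> tends as \<open>L \<rightarrow> \<infinity>\<close> to the expected return time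
  times the integral of \<open>f\<close> against \<open>m \<otimes> P\<^sub>\<pi>\<close>. Since the mean excursion length is asymptotically at
  most the expected return time, this bounds the lower limit of the averages of \<open>f\<close> along the orbit
  from below. Lower bounds suffice: every nonnegative continuous function is an increasing limit
  of maxima of countably many such \<open>f\<close>, and a bounded function can be replaced by its negative
  plus a constant.
\<close>

text \<open>Two obstacles shape the argument. The return time is only known to be integrable, so the
  sum of \<open>f\<close> over a whole excursion need not have a second moment, which the law of
  large numbers used here requires. Cutting at \<open>L\<close> makes it bounded but loses mass, so
  every estimate is one-sided; the loss is recovered by letting \<open>L\<close> grow, and Kac's
  formula guarantees that nothing is missing in the limit. Accordingly the mean excursion length
  only has to be bounded from above, for which truncation and a maximal inequality suffice.
  Secondly, \<open>f\<close> reads letters beyond the end of the current excursion, so the sums over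
  different excursions are dependent. Since each excursion has at least one letter, a function of
  finitely many letters reads boundedly many excursions, and the dependence has finite range. The
  identity in law between the chain and the concatenation of independent excursions takes the place
  of the strong Markov property; it is obtained from the weights of cylinders alone.\<close>

section \<open>Laws of large numbers\<close>

text \<open>At most 2k terms lie between the largest square k^2 \<le> n and n; they contribute at
  most 2kB, negligible against k^2. This passes from the squares, along which second moments are
  summable, to all n.\<close>

lemma square_subsequence_average_tendsto_0:
  fixes d :: "nat \<Rightarrow> real"
  assumes bound: "\<And>j. \<bar>d j\<bar> \<le> B"
    and lim: "(\<lambda>k. (\<Sum>j<k\<^sup>2. d j) / real (k\<^sup>2)) \<longlonglongrightarrow> 0"
  shows "(\<lambda>n. (\<Sum>j<n. d j) / real n) \<longlonglongrightarrow> 0"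
proof -
  define r where "r n = floor_sqrt n" for n :: nat
  have r: "(r n)\<^sup>2 \<le> n" "n \<le> (r n)\<^sup>2 + 2 * r n" for n
    using floor_sqrt_power2_le[of n] Suc_floor_sqrt_power2_gt[of n]
    by (auto simp: r_def power2_eq_square)
  have r_top: "filterlim r at_top sequentially"
  proof (rule filterlim_at_top[THEN iffD2], rule allI)
    fix k
    show "eventually (\<lambda>n. k \<le> r n) sequentially"
      using eventually_ge_at_top[of "k\<^sup>2"]
      by eventually_elim (auto simp: r_def le_floor_sqrt_iff)
  qed
  have B: "0 \<le> B" using bound[of 0] by simp
  define u where "u k = \<bar>(\<Sum>j<k\<^sup>2. d j) / real (k\<^sup>2)\<bar> + 2 * B * inverse (real k)" for k
  have "(\<lambda>k. u k) \<longlonglongrightarrow> \<bar>0\<bar> + 2 * B * 0"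
    unfolding u_def by (intro tendsto_intros lim lim_inverse_n)
  then have u: "(\<lambda>n. u (r n)) \<longlonglongrightarrow> 0"
    using filterlim_compose[OF _ r_top] by auto
  show ?thesis
  proof (rule tendsto_rabs_zero_cancel, rule tendsto_sandwich[OF _ _ tendsto_const u])
    show "\<forall>\<^sub>F n in sequentially. \<bar>(\<Sum>j<n. d j) / real n\<bar> \<le> u (r n)"
      using eventually_gt_at_top[of 0]
    proof eventually_elim
      case (elim n)
      define k where "k = r n"
      have k: "k\<^sup>2 \<le> n" "n \<le> k\<^sup>2 + 2 * k" "0 < k"
        using r[of n] elim by (auto simp: k_def intro!: Nat.gr0I)
      have "(\<Sum>j<n. d j) = (\<Sum>j<k\<^sup>2. d j) + (\<Sum>j\<in>{k\<^sup>2..<n}. d j)"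
        using sum.atLeastLessThan_concat[of 0 "k\<^sup>2" n d] k by (simp add: atLeast0LessThan)
      moreover have "\<bar>\<Sum>j\<in>{k\<^sup>2..<n}. d j\<bar> \<le> (\<Sum>j\<in>{k\<^sup>2..<n}. B)"
        by (rule order_trans[OF sum_abs sum_mono]) (rule bound)
      moreover have "(\<Sum>j\<in>{k\<^sup>2..<n}. B) \<le> 2 * real k * B"
      proof -
        have "real (n - k\<^sup>2) \<le> real (2 * k)" using k by linarith
        then have "real (n - k\<^sup>2) * B \<le> real (2 * k) * B" by (intro mult_right_mono B)
        then show ?thesis by simp
      qed
      ultimately have *: "\<bar>\<Sum>j<n. d j\<bar> \<le> \<bar>\<Sum>j<k\<^sup>2. d j\<bar> + 2 * real k * B" by linarith
      have "\<bar>(\<Sum>j<n. d j) / real n\<bar> = \<bar>\<Sum>j<n. d j\<bar> / real n" by simp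
      also have "\<dots> \<le> (\<bar>\<Sum>j<k\<^sup>2. d j\<bar> + 2 * real k * B) / real (k\<^sup>2)"
      proof (rule frac_le[OF _ *])
        show "0 \<le> \<bar>\<Sum>j<k\<^sup>2. d j\<bar> + 2 * real k * B" using B by simp
        show "0 < real (k\<^sup>2)" using k by simp
        show "real (k\<^sup>2) \<le> real n" using k(1) by (rule of_nat_mono)
      qed
      also have "\<dots> = u k"
        using k by (simp add: u_def field_simps power2_eq_square)
      finally show ?case by (simp add: k_def)
    qed
  qed simp
qed

text \<open>Garsia's recursion for the maximum over \<open>k \<le> n\<close> of the sums of \<open>Y \<circ> T\<^sup>i\<close> over \<open>i < k\<close>.\<close>

primrec max_partial_sum :: "('b \<Rightarrow> 'b) \<Rightarrow> ('b \<Rightarrow> real) \<Rightarrow> nat \<Rightarrow> 'b \<Rightarrow> real" where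
  "max_partial_sum T Y 0 x = 0"
| "max_partial_sum T Y (Suc n) x = max 0 (Y x + max_partial_sum T Y n (T x))"

lemma max_partial_sum_nonneg: "0 \<le> max_partial_sum T Y n x"
  by (cases n) auto

lemma max_partial_sum_Suc: "max_partial_sum T Y n x \<le> max_partial_sum T Y (Suc n) x"
proof (induction n arbitrary: x)
  case (Suc n)
  then show ?case
    unfolding max_partial_sum.simps(2)[of T Y "Suc n"] max_partial_sum.simps(2)[of T Y n x]
    by (intro max.mono add_left_mono order_refl)
qed simp

lemma partial_sum_le_max_partial_sum:
  "k \<le> n \<Longrightarrow> (\<Sum>i<k. Y ((T ^^ i) x)) \<le> max_partial_sum T Y n x"
proof (induction n arbitrary: k x)
  case (Suc n)
  show ?case
  proof (cases k)
    case (Suc l)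
    have "(\<Sum>i<k. Y ((T ^^ i) x)) = Y x + (\<Sum>i<l. Y ((T ^^ i) (T x)))"
      unfolding Suc by (subst sum.lessThan_Suc_shift) (simp add: funpow_swap1)
    also have "\<dots> \<le> Y x + max_partial_sum T Y n (T x)"
      using Suc.IH[of l "T x"] Suc.prems Suc by simp
    finally show ?thesis by simp
  qed simp
qed simp

context prob_space
begin

text \<open>A given \<open>D i\<close> is correlated with at most 2R of the \<open>D j\<close>, so
  the second moment of the n-th partial sum is O(n). Along n = (k+1)^2 the squared averages have
  expectations of order 1/(k+1)^2; hence they are almost surely summable and tend to 0.\<close>

lemma finite_range_law_of_large_numbers:
  fixes D :: "nat \<Rightarrow> 'a \<Rightarrow> real"
  assumes meas[measurable]: "\<And>j. D j \<in> borel_measurable M"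
    and bound: "\<And>j \<omega>. \<bar>D j \<omega>\<bar> \<le> B"
    and uncorrelated: "\<And>i j. i + R \<le> j \<Longrightarrow> expectation (\<lambda>\<omega>. D i \<omega> * D j \<omega>) = 0"
  shows "AE \<omega> in M. (\<lambda>n. (\<Sum>j<n. D j \<omega>) / real n) \<longlonglongrightarrow> 0"
proof -
  have B: "0 \<le> B" using bound[of 0 undefined] by simp
  have int_prod[simp]: "integrable M (\<lambda>\<omega>. D i \<omega> * D j \<omega>)" for i j
    by (rule integrable_const_bound[of _ "B * B"])
       (auto simp: abs_mult intro!: AE_I2 mult_mono bound B)
  have E_le: "expectation (\<lambda>\<omega>. D i \<omega> * D j \<omega>) \<le> (if j < i + R \<and> i < j + R then B * B else 0)" for i j
  proof (cases "j < i + R \<and> i < j + R")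
    case True
    have "expectation (\<lambda>\<omega>. D i \<omega> * D j \<omega>) \<le> expectation (\<lambda>\<omega>. B * B)"
    proof (intro integral_mono)
      fix \<omega>
      have "D i \<omega> * D j \<omega> \<le> \<bar>D i \<omega>\<bar> * \<bar>D j \<omega>\<bar>"
        by (metis abs_ge_self abs_mult)
      also have "\<dots> \<le> B * B" by (intro mult_mono bound B) auto
      finally show "D i \<omega> * D j \<omega> \<le> B * B" .
    qed simp_all
    with True show ?thesis by (simp add: prob_space)
  next
    case False
    then have "i + R \<le> j \<or> j + R \<le> i" by linarith
    then show ?thesis
      using uncorrelated[of i j] uncorrelated[of j i] False by (auto simp: mult.commute)
  qed
  have second_moment: "expectation (\<lambda>\<omega>. (\<Sum>j<n. D j \<omega>)\<^sup>2) \<le> real n * (2 * real R * (B * B))" for n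
  proof -
    have "expectation (\<lambda>\<omega>. (\<Sum>j<n. D j \<omega>)\<^sup>2) = (\<Sum>i<n. \<Sum>j<n. expectation (\<lambda>\<omega>. D i \<omega> * D j \<omega>))"
      by (simp add: power2_eq_square sum_product)
    also have "\<dots> \<le> (\<Sum>i<n. \<Sum>j<n. if j < i + R \<and> i < j + R then B * B else 0)"
      by (intro sum_mono E_le)
    also have "\<dots> \<le> (\<Sum>i<n. 2 * real R * (B * B))"
    proof (intro sum_mono)
      fix i
      have "(\<Sum>j<n. if j < i + R \<and> i < j + R then B * B else 0)
          = (\<Sum>j\<in>{j\<in>{..<n}. j < i + R \<and> i < j + R}. B * B)"
        by (subst sum.inter_filter) auto
      also have "\<dots> = real (card {j\<in>{..<n}. j < i + R \<and> i < j + R}) * (B * B)" by simp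
      also have "\<dots> \<le> real (2 * R) * (B * B)"
      proof (intro mult_right_mono of_nat_mono)
        have "card {j\<in>{..<n}. j < i + R \<and> i < j + R} \<le> card {i - R..<i + R}"
          by (intro card_mono) auto
        then show "card {j\<in>{..<n}. j < i + R \<and> i < j + R} \<le> 2 * R" by simp
      qed (use B in simp)
      finally show "(\<Sum>j<n. if j < i + R \<and> i < j + R then B * B else 0) \<le> 2 * real R * (B * B)"
        by simp
    qed
    finally show ?thesis by simp
  qed
  define a where "a k \<omega> = ((\<Sum>j<(Suc k)\<^sup>2. D j \<omega>) / real ((Suc k)\<^sup>2))\<^sup>2" for k \<omega>
  have [measurable]: "a k \<in> borel_measurable M" for k unfolding a_def by measurable
  have a_nonneg: "0 \<le> a k \<omega>" for k \<omega> by (simp add: a_def)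
  define c where "c = 2 * real R * (B * B)"
  have Ea: "(\<integral>\<^sup>+\<omega>. ennreal (a k \<omega>) \<partial>M) \<le> ennreal (c * (1 / (real (Suc k))\<^sup>2))" for k
  proof -
    let ?n = "(Suc k)\<^sup>2"
    have "integrable M (\<lambda>\<omega>. (\<Sum>j<n. D j \<omega>)\<^sup>2)" for n
      by (simp add: power2_eq_square sum_product)
    then have int: "integrable M (\<lambda>\<omega>. (\<Sum>j<?n. D j \<omega>)\<^sup>2)" .
    have a_eq: "a k = (\<lambda>\<omega>. (\<Sum>j<?n. D j \<omega>)\<^sup>2 / (real ?n)\<^sup>2)"
      by (auto simp: a_def power_divide)
    have "(\<integral>\<^sup>+\<omega>. ennreal (a k \<omega>) \<partial>M) = ennreal (expectation (a k))"
      using int by (intro nn_integral_eq_integral) (auto simp: a_eq)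
    also have "expectation (a k) \<le> real ?n * c / (real ?n)\<^sup>2"
      unfolding a_eq c_def using second_moment[of ?n] by (simp add: divide_right_mono)
    also have "\<dots> = c * (1 / (real (Suc k))\<^sup>2)"
      unfolding of_nat_power by (simp add: power2_eq_square del: of_nat_Suc)
    finally show ?thesis by (simp add: ennreal_leI)
  qed
  have c: "0 \<le> c" using B by (simp add: c_def)
  have "(\<integral>\<^sup>+\<omega>. (\<Sum>k. ennreal (a k \<omega>)) \<partial>M) = (\<Sum>k. \<integral>\<^sup>+\<omega>. ennreal (a k \<omega>) \<partial>M)"
    by (rule nn_integral_suminf) measurable
  also have "\<dots> \<le> (\<Sum>k. ennreal (c * (1 / (real (Suc k))\<^sup>2)))"
    by (intro suminf_le Ea) auto
  also have "\<dots> = ennreal (\<Sum>k. c * (1 / (real (Suc k))\<^sup>2))"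
  proof (rule suminf_ennreal2)
    show "summable (\<lambda>k. c * (1 / (real (Suc k))\<^sup>2))"
      using inverse_power_summable[of 2, where 'a=real]
      by (intro summable_mult) (subst summable_Suc_iff, simp add: inverse_eq_divide)
  qed (use c in simp)
  finally have "(\<integral>\<^sup>+\<omega>. (\<Sum>k. ennreal (a k \<omega>)) \<partial>M) \<noteq> \<infinity>"
    by (metis ennreal_less_top infinity_ennreal_def leD order_less_le neq_top_trans)
  then have "AE \<omega> in M. (\<Sum>k. ennreal (a k \<omega>)) \<noteq> \<infinity>"
    by (intro nn_integral_PInf_AE) auto
  then show ?thesis
  proof eventually_elim
    case (elim \<omega>)
    have "summable (\<lambda>k. a k \<omega>)"
      using elim a_nonneg by (intro summable_suminf_not_top) auto
    then have "(\<lambda>k. a k \<omega>) \<longlonglongrightarrow> 0" by (rule summable_LIMSEQ_zero)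
    then have "(\<lambda>k. sqrt (a k \<omega>)) \<longlonglongrightarrow> sqrt 0" by (intro tendsto_intros)
    then have "(\<lambda>k. \<bar>(\<Sum>j<(Suc k)\<^sup>2. D j \<omega>) / real ((Suc k)\<^sup>2)\<bar>) \<longlonglongrightarrow> 0"
      by (simp add: a_def del: of_nat_Suc)
    then have "(\<lambda>k. (\<Sum>j<(Suc k)\<^sup>2. D j \<omega>) / real ((Suc k)\<^sup>2)) \<longlonglongrightarrow> 0"
      by (rule tendsto_rabs_zero_cancel)
    then have "(\<lambda>k. (\<Sum>j<k\<^sup>2. D j \<omega>) / real (k\<^sup>2)) \<longlonglongrightarrow> 0"
      by (rule LIMSEQ_imp_Suc)
    with bound show ?case by (rule square_subsequence_average_tendsto_0)
  qed
qed

text \<open>Garsia's proof. Let P be the maximal partial sum of \<open>Y = Z - c\<close>. Where P >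
  0, the maximum is attained after at least one step, so P - P \<circ> T \<le> Y; elsewhere P = 0
  and P - P \<circ> T \<le> 0 \<le> Z. Invariance makes the integral of P - P \<circ> T vanish,
  which bounds the probability of P > 0.\<close>

lemma maximal_ergodic_inequality:
  assumes T[measurable]: "T \<in> M \<rightarrow>\<^sub>M M" and inv: "distr M M T = M"
    and Z: "integrable M Z" "\<And>x. 0 \<le> Z x" and c: "0 < c"
  shows "prob {x\<in>space M. \<exists>n\<ge>1. c * real n < (\<Sum>i<n. Z ((T ^^ i) x))} \<le> expectation Z / c"
proof -
  have [measurable]: "Z \<in> borel_measurable M" using Z(1) by simp
  define Y where "Y x = Z x - c" for x
  have Y_int: "integrable M Y" unfolding Y_def using Z(1) by simp
  have [measurable]: "Y \<in> borel_measurable M" unfolding Y_def by measurable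
  let ?P = "max_partial_sum T Y"
  have P_int: "integrable M (?P n)" for n
  proof (induction n)
    case (Suc n)
    have "integrable (distr M M T) (?P n)" using Suc by (simp add: inv)
    then have "integrable M (\<lambda>x. ?P n (T x))"
      using integrable_distr_eq[of T M M "?P n"] Suc by simp
    with Y_int show ?case by simp
  qed simp
  have [measurable]: "?P n \<in> borel_measurable M" for n using P_int by simp
  have PT: "expectation (\<lambda>x. ?P n (T x)) = expectation (?P n)" for n
  proof -
    have "expectation (?P n) = integral\<^sup>L (distr M M T) (?P n)" by (simp add: inv)
    also have "\<dots> = expectation (\<lambda>x. ?P n (T x))" by (rule integral_distr) auto
    finally show ?thesis ..
  qed
  have PT_int: "integrable M (\<lambda>x. ?P n (T x))" for n
    using P_int[of n] integrable_distr_eq[of T M M "?P n"] by (simp add: inv)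
  define A where "A n = {x\<in>space M. 0 < ?P n x}" for n
  have [measurable]: "A n \<in> sets M" for n unfolding A_def by measurable
  have A_prob: "prob (A n) \<le> expectation Z / c" for n
  proof -
    have "0 = expectation (\<lambda>x. ?P n x - ?P n (T x))"
      using P_int PT_int by (simp add: PT)
    also have "\<dots> \<le> expectation (\<lambda>x. Z x - c * indicator (A n) x)"
    proof (rule integral_mono)
      show "integrable M (\<lambda>x. ?P n x - ?P n (T x))" using P_int PT_int by simp
      show "integrable M (\<lambda>x. Z x - c * indicator (A n) x)"
        using Z(1) by (intro Bochner_Integration.integrable_diff integrable_mult_right) (auto simp: emeasure_eq_measure)
      fix x assume x: "x \<in> space M"
      show "?P n x - ?P n (T x) \<le> Z x - c * indicator (A n) x"
      proof (cases "x \<in> A n")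
        case True
        then obtain k where k: "n = Suc k" by (cases n) (auto simp: A_def)
        have "?P n x = Y x + ?P k (T x)" using True by (auto simp: A_def k max_def split: if_splits)
        also have "\<dots> \<le> Y x + ?P n (T x)" unfolding k using max_partial_sum_Suc by simp
        finally show ?thesis using True by (simp add: Y_def)
      next
        case False
        then have "?P n x \<le> 0" using x by (auto simp: A_def)
        then show ?thesis
          using False Z(2)[of x] max_partial_sum_nonneg[of T Y n "T x"] by simp
      qed
    qed
    also have "\<dots> = expectation Z - c * prob (A n)"
      using Z(1) by (subst Bochner_Integration.integral_diff) (auto simp: emeasure_eq_measure)
    finally show ?thesis using c by (simp add: field_simps)
  qed
  have inc: "incseq A"
    using max_partial_sum_Suc[of T Y]
    by (intro incseq_SucI) (fastforce simp: A_def simp del: max_partial_sum.simps intro: less_le_trans)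
  have "prob {x\<in>space M. \<exists>n\<ge>1. c * real n < (\<Sum>i<n. Z ((T ^^ i) x))} \<le> prob (\<Union>n. A n)"
  proof (rule finite_measure_mono)
    show "{x\<in>space M. \<exists>n\<ge>1. c * real n < (\<Sum>i<n. Z ((T ^^ i) x))} \<subseteq> (\<Union>n. A n)"
    proof safe
      fix x n assume x: "x \<in> space M" and n: "c * real n < (\<Sum>i<n. Z ((T ^^ i) x))"
      have "0 < (\<Sum>i<n. Y ((T ^^ i) x))" using n by (simp add: Y_def sum_subtractf mult.commute)
      also have "\<dots> \<le> ?P n x" by (rule partial_sum_le_max_partial_sum) simp
      finally show "x \<in> (\<Union>n. A n)" using x by (auto simp: A_def)
    qed
  qed measurable
  also have "\<dots> \<le> expectation Z / c"
    by (rule LIMSEQ_le_const2[OF finite_Lim_measure_incseq[OF _ inc]]) (auto intro: A_prob)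
  finally show ?thesis .
qed

end


section \<open>Averages of independent sequences\<close>

context sequence_space
begin

text \<open>A substitute for conditioning on the first j coordinates: \<open>comb_seq j U V\<close>
  follows \<open>U\<close> before time j and an independent copy \<open>V\<close> from then on, and
  it has the law \<open>S\<close> again. Fubini then integrates over the future first.\<close>

lemma integral_eq_0_if_future_integral_eq_0:
  fixes D :: "(nat \<Rightarrow> 'a) \<Rightarrow> real"
  assumes D[measurable]: "D \<in> borel_measurable S" and bound: "\<And>W. \<bar>D W\<bar> \<le> B"
    and future: "\<And>U. U \<in> space S \<Longrightarrow> (\<integral>V. D (comb_seq j U V) \<partial>S) = 0"
  shows "(\<integral>W. D W \<partial>S) = 0"
proof -
  interpret SS: pair_prob_space S S ..
  have comb[measurable]: "(\<lambda>(U, V). comb_seq j U V) \<in> S \<Otimes>\<^sub>M S \<rightarrow>\<^sub>M S"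
    by (rule measurable_comb_seq)
  have int: "integrable (S \<Otimes>\<^sub>M S) (\<lambda>(U, V). D (comb_seq j U V))"
    using measurable_compose[OF comb D]
    by (intro SS.P.integrable_const_bound[of _ B]) (auto simp: split_beta' bound)
  have "(\<integral>W. D W \<partial>S) = (\<integral>W. D W \<partial>distr (S \<Otimes>\<^sub>M S) S (\<lambda>(U, V). comb_seq j U V))"
    by (simp add: PiM_comb_seq)
  also have "\<dots> = (\<integral>p. D (case p of (U, V) \<Rightarrow> comb_seq j U V) \<partial>(S \<Otimes>\<^sub>M S))"
    by (rule integral_distr) auto
  also have "\<dots> = (\<integral>(U, V). D (comb_seq j U V) \<partial>(S \<Otimes>\<^sub>M S))"
    by (simp add: split_beta')
  also have "\<dots> = (\<integral>U. (\<integral>V. D (comb_seq j U V) \<partial>S) \<partial>S)"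
    by (rule SS.integral_fst'[symmetric, OF int, unfolded prod.case])
  also have "\<dots> = (\<integral>U. 0 \<partial>S)"
    by (rule Bochner_Integration.integral_cong) (auto simp: future)
  finally show ?thesis by simp
qed

lemma integral_coordinate:
  fixes f :: "'a \<Rightarrow> real"
  assumes [measurable]: "f \<in> borel_measurable M"
  shows "(\<integral>W. f (W i) \<partial>S) = (\<integral>x. f x \<partial>M)"
proof -
  have "(\<integral>x. f x \<partial>M) = (\<integral>x. f x \<partial>distr S M (\<lambda>W. W i))"
    by (subst PiM_component) auto
  also have "\<dots> = (\<integral>W. f (W i) \<partial>S)" by (rule integral_distr) auto
  finally show ?thesis ..
qed

lemma integrable_coordinate:
  fixes f :: "'a \<Rightarrow> real"
  assumes f: "integrable M f"
  shows "integrable S (\<lambda>W. f (W i))"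
proof -
  have [measurable]: "f \<in> borel_measurable M" using f by simp
  have "integrable (distr S M (\<lambda>W. W i)) f"
    using f by (subst PiM_component) auto
  then show ?thesis by (subst (asm) integrable_distr_eq) auto
qed

lemma shift_invariant: "distr S S (\<lambda>W k. W (Suc k)) = S"
  using distr_PiM_reindex[of UNIV "\<lambda>_. M" Suc UNIV] by (simp add: restrict_UNIV M.prob_space_axioms)

lemma bounded_law_of_large_numbers:
  fixes f :: "'a \<Rightarrow> real"
  assumes [measurable]: "f \<in> borel_measurable M" and bound: "\<And>x. \<bar>f x\<bar> \<le> B"
  shows "AE W in S. (\<lambda>n. (\<Sum>j<n. f (W j)) / real n) \<longlonglongrightarrow> (\<integral>x. f x \<partial>M)"
proof -
  define c where "c = (\<integral>x. f x \<partial>M)"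
  have int: "integrable M f"
    by (rule M.integrable_const_bound[of _ B]) (auto simp: bound)
  have b: "\<bar>f x - c\<bar> \<le> B + \<bar>c\<bar>" for x using bound[of x] by linarith
  have "AE W in S. (\<lambda>n. (\<Sum>j<n. f (W j) - c) / real n) \<longlonglongrightarrow> 0"
  \<comment> \<open>Independence is the case of range 1.\<close>
  proof (rule P.finite_range_law_of_large_numbers[where B="B + \<bar>c\<bar>" and R=1])
    fix i j :: nat assume ij: "i + 1 \<le> j"
    show "(\<integral>W. (f (W i) - c) * (f (W j) - c) \<partial>S) = 0"
    proof (rule integral_eq_0_if_future_integral_eq_0[where j=j and B="(B + \<bar>c\<bar>) * (B + \<bar>c\<bar>)"])
      show "\<bar>(f (W i) - c) * (f (W j) - c)\<bar> \<le> (B + \<bar>c\<bar>) * (B + \<bar>c\<bar>)" for W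
        using b[of undefined] unfolding abs_mult by (intro mult_mono b) auto
      fix U
      have "(\<integral>V. (f (comb_seq j U V i) - c) * (f (comb_seq j U V j) - c) \<partial>S)
          = (\<integral>V. (f (U i) - c) * (f (V 0) - c) \<partial>S)"
        using ij comb_seq_add[of j U _ 0] by (simp add: comb_seq_less)
      also have "\<dots> = (f (U i) - c) * (\<integral>V. f (V 0) - c \<partial>S)" by simp
      also have "(\<integral>V. f (V 0) - c \<partial>S) = 0"
        using integrable_coordinate[OF int, of 0] integral_coordinate[of f 0]
        by (simp add: c_def P.prob_space)
      finally show "(\<integral>V. (f (comb_seq j U V i) - c) * (f (comb_seq j U V j) - c) \<partial>S) = 0" by simp
    qed measurable
  qed (auto simp: b)
  then show ?thesis
  proof eventually_elim
    case (elim W)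
    then have "(\<lambda>n. (\<Sum>j<n. f (W j) - c) / real n + c) \<longlonglongrightarrow> 0 + c" by (intro tendsto_intros)
    moreover have "\<forall>\<^sub>F n in sequentially. (\<Sum>j<n. f (W j) - c) / real n + c = (\<Sum>j<n. f (W j)) / real n"
      using eventually_gt_at_top[of 0]
      by eventually_elim (simp add: sum_subtractf field_simps)
    ultimately show ?case by (simp add: tendsto_cong c_def)
  qed
qed

text \<open>
  The averages of the truncated variables converge, and the maximal inequality bounds the
  averages of the excess.
\<close>

lemma average_eventually_le:
  fixes Z :: "'a \<Rightarrow> real"
  assumes Z: "integrable M Z" "\<And>x. 0 \<le> Z x" and c: "(\<integral>x. Z x \<partial>M) < c"
  shows "AE W in S. \<forall>\<^sub>F n in sequentially. (\<Sum>j<n. Z (W j)) \<le> c * real n"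
proof -
  have [measurable]: "Z \<in> borel_measurable M" using Z(1) by simp
  \<comment> \<open>Half of the gap: the truncated averages are eventually below
    \<open>c - \<delta>\<close>, and the excess over the truncation may use up the other
    half.\<close>
  define \<delta> where "\<delta> = (c - (\<integral>x. Z x \<partial>M)) / 2"
  have \<delta>: "0 < \<delta>" using c by (simp add: \<delta>_def)
  define bad where "bad = {W\<in>space S. \<not> (\<forall>\<^sub>F n in sequentially. (\<Sum>j<n. Z (W j)) \<le> c * real n)}"
  have [measurable]: "bad \<in> sets S" unfolding bad_def eventually_sequentially by measurable
  define X where "X L x = max 0 (Z x - real L)" for L :: nat and x
  have [measurable]: "X L \<in> borel_measurable M" for L unfolding X_def by measurable
  have X_int: "integrable M (X L)" for L
    by (rule Bochner_Integration.integrable_bound[OF Z(1)]) (use Z(2) in \<open>auto simp: X_def\<close>)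
  \<comment> \<open>The event \<open>bad\<close> does not depend on the truncation level
    \<open>L\<close>, whereas the right side vanishes as \<open>L\<close> grows.\<close>
  have prob_bad: "P.prob bad \<le> (\<integral>x. X L x \<partial>M) / \<delta>" for L
  proof -
    define high where "high = {W\<in>space S. \<exists>n\<ge>1. \<delta> * real n < (\<Sum>i<n. X L (((\<lambda>W k. W (Suc k)) ^^ i) W 0))}"
    have "P.prob high \<le> (\<integral>W. X L (W 0) \<partial>S) / \<delta>"
      unfolding high_def
    proof (rule P.maximal_ergodic_inequality[OF _ shift_invariant _ _ \<delta>])
      show "(\<lambda>W k. W (Suc k)) \<in> S \<rightarrow>\<^sub>M S" by (rule measurable_PiM_single') (auto simp: space_PiM)
      show "integrable S (\<lambda>W. X L (W 0))" by (rule integrable_coordinate[OF X_int])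
    qed (auto simp: X_def)
    then have high: "P.prob high \<le> (\<integral>x. X L x \<partial>M) / \<delta>" by (simp add: integral_coordinate)
    have shift: "((\<lambda>W k. W (Suc k)) ^^ i) W = (\<lambda>k. W (i + k))" for i and W :: "nat \<Rightarrow> 'a"
      by (induction i arbitrary: W) (auto simp: fun_eq_iff)
    have [measurable]: "high \<in> sets S" unfolding high_def shift by measurable
    have "AE W in S. (\<lambda>n. (\<Sum>j<n. min (Z (W j)) (real L)) / real n) \<longlonglongrightarrow> (\<integral>x. min (Z x) (real L) \<partial>M)"
      using Z(2) by (intro bounded_law_of_large_numbers[where B="real L"]) auto
    then have "AE W in S. W \<in> bad \<longrightarrow> W \<in> high"
    proof eventually_elim
      case (elim W)
      show ?case
      proof (rule ccontr)
        assume "\<not> (W \<in> bad \<longrightarrow> W \<in> high)"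
        then have W: "W \<in> space S" "W \<in> bad" "W \<notin> high" by (auto simp: bad_def)
        have "(\<integral>x. min (Z x) (real L) \<partial>M) \<le> (\<integral>x. Z x \<partial>M)"
          using Z by (intro integral_mono Bochner_Integration.integrable_bound[OF Z(1), of "\<lambda>x. min (Z x) (real L)"]) auto
        also have "\<dots> < c - \<delta>" using \<delta> by (simp add: \<delta>_def field_simps)
        finally have "\<forall>\<^sub>F n in sequentially. (\<Sum>j<n. min (Z (W j)) (real L)) / real n < c - \<delta>"
          using elim by (intro order_tendstoD)
        then have "\<forall>\<^sub>F n in sequentially. (\<Sum>j<n. Z (W j)) \<le> c * real n"
          using eventually_gt_at_top[of 0]
        proof eventually_elim
          case (elim n)
          have "(\<Sum>j<n. Z (W j)) = (\<Sum>j<n. min (Z (W j)) (real L)) + (\<Sum>j<n. X L (W j))"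
            unfolding sum.distrib[symmetric] by (intro sum.cong) (auto simp: X_def)
          also have "\<dots> \<le> (c - \<delta>) * real n + \<delta> * real n"
          proof (rule add_mono)
            show "(\<Sum>j<n. min (Z (W j)) (real L)) \<le> (c - \<delta>) * real n"
              using elim by (simp add: field_simps)
            show "(\<Sum>j<n. X L (W j)) \<le> \<delta> * real n"
              using W elim by (force simp: high_def shift not_less)
          qed
          finally show ?case by (simp add: algebra_simps)
        qed
        with W show False by (simp add: bad_def)
      qed
    qed
    then have "P.prob bad \<le> P.prob high"
      by (intro P.finite_measure_mono_AE) auto
    with high show ?thesis by simp
  qed
  have "(\<lambda>L. (\<integral>x. X L x \<partial>M) / \<delta>) \<longlonglongrightarrow> (\<integral>x. 0 \<partial>M) / \<delta>"
  proof (intro tendsto_intros integral_dominated_convergence[where w=Z])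
    show "AE x in M. (\<lambda>L. X L x) \<longlonglongrightarrow> 0"
    proof (rule AE_I2)
      fix x
      obtain N :: nat where "Z x \<le> real N" using real_arch_simple by blast
      then have "\<forall>\<^sub>F L in sequentially. X L x = 0"
        by (intro eventually_sequentiallyI[of N]) (auto simp: X_def)
      then show "(\<lambda>L. X L x) \<longlonglongrightarrow> 0" by (rule tendsto_eventually)
    qed
  qed (use Z \<delta> in \<open>auto simp: X_def\<close>)
  then have "P.prob bad \<le> 0"
    using prob_bad by (intro LIMSEQ_le_const[of _ 0]) auto
  then have "P.prob bad = 0" by (simp add: measure_le_0_iff)
  then have "AE W in S. W \<notin> bad"
    by (intro AE_I'[of bad]) (auto simp: P.emeasure_eq_measure null_sets_def)
  then show ?thesis
    using AE_space[of S] by eventually_elim (auto simp: bad_def)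
qed

end

section \<open>Markov measures\<close>

abbreviation path_space :: "(nat \<Rightarrow> 'a) measure" where
  "path_space \<equiv> PiM UNIV (\<lambda>_. count_space UNIV)"

lemma space_path_space [simp]: "space path_space = UNIV"
  by (simp add: space_PiM)

lemma measurable_path_coordinate [measurable]: "(\<lambda>\<omega>. \<omega> i) \<in> path_space \<rightarrow>\<^sub>M count_space UNIV"
  by (rule measurable_component_singleton) simp

lemma measurable_path_spaceI:
  assumes "\<And>n. (\<lambda>x. f x n) \<in> M \<rightarrow>\<^sub>M count_space UNIV"
  shows "f \<in> M \<rightarrow>\<^sub>M path_space"
  using assms by (intro measurable_PiM_single') auto

lemma measurable_prefix [measurable]:
  "(\<lambda>\<omega>::nat \<Rightarrow> 'a::countable. map \<omega> [0..<n]) \<in> path_space \<rightarrow>\<^sub>M count_space UNIV"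
proof (induction n)
  case (Suc n)
  note [measurable] = Suc
  have "(\<lambda>\<omega>. (map \<omega> [0..<n], \<omega> n)) \<in> path_space \<rightarrow>\<^sub>M count_space (UNIV :: ('a list \<times> 'a) set)"
    using measurable_Pair[OF Suc measurable_path_coordinate[of n]]
    by (simp add: pair_measure_countable)
  from measurable_compose[OF this, of "\<lambda>(xs, x). xs @ [x]" "count_space UNIV"]
  show ?case by simp
qed simp

lemma sets_prefix_cylinder [measurable]:
  "{\<omega>. map \<omega> [0..<n] = (xs :: 'a::countable list)} \<in> sets path_space"
  using measurable_sets[OF measurable_prefix, of "{xs}" n] by (simp add: vimage_def)

text \<open>For each n the prefixes of length n partition the space into countably many cylinders.
  An inequality on all of them between measures of the same total mass is an equality, as is seen by
  applying it to a set and to its complement. One-sided estimates thus identify a measure.\<close>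

lemma measure_eqI_prefix_le:
  fixes M N :: "(nat \<Rightarrow> 'a::countable) measure"
  assumes M: "prob_space M" "sets M = sets path_space"
    and N: "prob_space N" "sets N = sets path_space"
    and le: "\<And>xs. emeasure M {\<omega>. map \<omega> [0..<length xs] = xs} \<le> emeasure N {\<omega>. map \<omega> [0..<length xs] = xs}"
  shows "M = N"
proof -
  interpret M: prob_space M by fact
  interpret N: prob_space N by fact
  have [measurable_cong]: "sets M = sets path_space" "sets N = sets path_space" by fact+
  have sp: "space M = UNIV" "space N = UNIV"
    using sets_eq_imp_space_eq[OF M(2)] sets_eq_imp_space_eq[OF N(2)] by simp_all
  have eq: "distr M (count_space UNIV) (\<lambda>\<omega>. map \<omega> [0..<n]) = distr N (count_space UNIV) (\<lambda>\<omega>. map \<omega> [0..<n])"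
    (is "?M = ?N") for n
  proof -
    interpret MM: prob_space ?M by (rule M.prob_space_distr) measurable
    interpret NN: prob_space ?N by (rule N.prob_space_distr) measurable
    have single: "emeasure ?M {xs} \<le> emeasure ?N {xs}" for xs
    proof (cases "length xs = n")
      case True
      then show ?thesis using le[of xs] by (simp add: emeasure_distr sp vimage_def)
    next
      case False
      then have "(\<lambda>\<omega>. map \<omega> [0..<n]) -` {xs} = {}" by auto
      then show ?thesis by (simp add: emeasure_distr sp)
    qed
    have mono: "emeasure ?M A \<le> emeasure ?N A" for A
    proof -
      have "emeasure ?M A = (\<integral>\<^sup>+x. emeasure ?M {x} \<partial>count_space A)"
        by (rule emeasure_countable_singleton) auto
      also have "\<dots> \<le> (\<integral>\<^sup>+x. emeasure ?N {x} \<partial>count_space A)"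
        by (intro nn_integral_mono single)
      also have "\<dots> = emeasure ?N A"
        by (rule emeasure_countable_singleton[symmetric]) auto
      finally show ?thesis .
    qed
    show ?thesis
    proof (rule measure_eqI)
      fix A assume "A \<in> sets ?M"
      have "MM.prob A \<le> NN.prob A" "MM.prob (UNIV - A) \<le> NN.prob (UNIV - A)"
        using mono[of A] mono[of "UNIV - A"]
        by (auto simp: MM.emeasure_eq_measure NN.emeasure_eq_measure)
      then have "MM.prob A = NN.prob A"
        using MM.prob_compl[of A] NN.prob_compl[of A] by simp
      then show "emeasure ?M A = emeasure ?N A"
        by (simp add: MM.emeasure_eq_measure NN.emeasure_eq_measure)
    qed simp
  qed
  show ?thesis
  proof (rule measure_eqI_PiM_infinite[OF M(2) N(2)])
    fix A :: "nat \<Rightarrow> 'a set" and J :: "nat set" assume J: "finite J"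
    let ?X = "prod_emb UNIV (\<lambda>_. count_space UNIV) J (Pi\<^sub>E J A)"
    obtain n where n: "\<And>j. j \<in> J \<Longrightarrow> j < n"
      using finite_nat_bounded[OF J] by auto
    have X: "?X = (\<lambda>\<omega>. map \<omega> [0..<n]) -` {xs. \<forall>j\<in>J. xs ! j \<in> A j}"
      using n by (auto simp: prod_emb_def PiE_iff)
    have "emeasure (distr M (count_space UNIV) (\<lambda>\<omega>. map \<omega> [0..<n])) {xs. \<forall>j\<in>J. xs ! j \<in> A j} =
        emeasure (distr N (count_space UNIV) (\<lambda>\<omega>. map \<omega> [0..<n])) {xs. \<forall>j\<in>J. xs ! j \<in> A j}"
      by (simp add: eq)
    then show "emeasure M ?X = emeasure N ?X"
      unfolding X by (subst (asm) (1 2) emeasure_distr) (auto simp: sp)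
  qed unfold_locales
qed

text \<open>For a nonempty word, the probability that the chain started in the first letter reads
  it. The recursion on lists, rather than a product over indices, suits concatenations.\<close>

fun path_weight :: "('e \<Rightarrow> 'e pmf) \<Rightarrow> 'e list \<Rightarrow> real" where
  "path_weight K (x # y # ys) = pmf (K x) y * path_weight K (y # ys)"
| "path_weight K _ = 1"

lemma path_weight_nonneg [simp]: "0 \<le> path_weight K xs"
  by (induction K xs rule: path_weight.induct) auto

lemma path_weight_eq_prod:
  "path_weight K xs = (\<Prod>k<length xs - 1. trans_prob K (xs ! Suc k) (xs ! k))"
proof (induction K xs rule: path_weight.induct)
  case (1 K x y ys)
  then show ?case by (simp add: prod.lessThan_Suc_shift trans_prob_def del: prod.lessThan_Suc)
qed auto

text \<open>The letter \<open>x\<close> occurs in both factors: the transition into it belongs to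
  the left one and the transition out of it to the right one.\<close>

lemma path_weight_append:
  "path_weight K (xs @ x # ys) = path_weight K (xs @ [x]) * path_weight K (x # ys)"
proof (induction xs)
  case (Cons z xs)
  then show ?case by (cases xs) auto
qed simp

text \<open>Read off from the projection to the empty index set, which preserves the total
  mass.\<close>

lemma prob_space_markov: "prob_space (markov (K :: 'e::countable \<Rightarrow> 'e pmf) e)"
proof -
  interpret Ionescu_Tulcea "markov_step K e" "\<lambda>_. count_space UNIV"
    by (rule Ionescu_Tulcea_markov)
  have "prob_space (CI {})" by (rule PF.prob_space_P) auto
  then have "prob_space (distr PF.lim (PiM {} (\<lambda>_. count_space UNIV)) (\<lambda>x. restrict x {}))"
    by (simp add: distr_lim)
  then show ?thesis
    unfolding markov_def by (rule prob_space_distrD[rotated]) (simp add: measurable_cong_sets[OF PF.sets_lim refl])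
qed

lemma emeasure_markov_UNIV: "emeasure (markov (K :: 'e::countable \<Rightarrow> 'e pmf) e) UNIV = 1"
  using prob_space.emeasure_space_1[OF prob_space_markov[of K e]] by (simp add: space_markov)

lemma sets_markov_cong [measurable_cong]: "sets (markov K e) = sets path_space"
  by (rule sets_markov)

lemma emeasure_markov_prefix:
  fixes K :: "'e::countable \<Rightarrow> 'e pmf"
  shows "emeasure (markov K e) {\<omega>. map \<omega> [0..<length xs] = xs} =
    ennreal (if xs = [] then 1 else of_bool (hd xs = e) * path_weight K xs)"
proof (cases "xs = []")
  case True
  then show ?thesis by (simp add: emeasure_markov_UNIV)
next
  case False
  have "map \<omega> [0..<length xs] = xs \<longleftrightarrow> (\<forall>k<length xs. \<omega> k = xs ! k)" for \<omega>
    by (subst list_eq_iff_nth_eq) simp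
  then have "{\<omega>. map \<omega> [0..<length xs] = xs} = {\<omega>. \<forall>k<length xs. \<omega> k = xs ! k}"
    by (rule Collect_cong)
  also have "\<dots> = {\<omega>. \<forall>k\<le>length xs - 1. \<omega> k = xs ! k}"
    using False by (cases xs) (auto simp: less_Suc_eq_le)
  finally show ?thesis
    unfolding path_weight_eq_prod using False
    by (simp only: emeasure_markov_cylinder if_False hd_conv_nth not_False_eq_True)
qed

text \<open>Cylinders of weight zero are null, and there are countably many of them. Positivity of
  the weights is what later makes the words read along a path admissible.\<close>

lemma AE_markov_path_weight_pos:
  fixes K :: "'e::countable \<Rightarrow> 'e pmf"
  shows "AE \<omega> in markov K e. \<omega> 0 = e \<and> (\<forall>n. 0 < path_weight K (map \<omega> [0..<n]))"
proof -
  have "AE \<omega> in markov K e. \<forall>xs. map \<omega> [0..<length xs] = xs \<longrightarrow>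
      xs = [] \<or> hd xs = e \<and> 0 < path_weight K xs"
  proof (rule AE_all_countable[THEN iffD2], rule allI)
    fix xs :: "'e list"
    show "AE \<omega> in markov K e. map \<omega> [0..<length xs] = xs \<longrightarrow> xs = [] \<or> hd xs = e \<and> 0 < path_weight K xs"
    proof (cases "xs = [] \<or> hd xs = e \<and> 0 < path_weight K xs")
      case False
      then have "emeasure (markov K e) {\<omega>. map \<omega> [0..<length xs] = xs} = 0"
        unfolding emeasure_markov_prefix using path_weight_nonneg[of K xs] by auto
      then show ?thesis
        by (intro AE_I[of _ _ "{\<omega>. map \<omega> [0..<length xs] = xs}"])
           (auto simp: sets_markov sets_prefix_cylinder)
    qed simp
  qed
  then show ?thesis
  proof eventually_elim
    case (elim \<omega>)
    have "map \<omega> [0..<n] = [] \<or> hd (map \<omega> [0..<n]) = e \<and> 0 < path_weight K (map \<omega> [0..<n])" for n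
      using elim by (metis length_map length_upt minus_nat.diff_0)
    note * = this
    show ?case
    proof (intro conjI allI)
      show "\<omega> 0 = e" using *[of 1] by simp
      show "0 < path_weight K (map \<omega> [0..<n])" for n
        using *[of n] by (cases n) auto
    qed
  qed
qed

lemma AE_markov_0: "AE \<omega> in markov (K :: 'e::countable \<Rightarrow> 'e pmf) e. \<omega> 0 = e"
  using AE_markov_path_weight_pos[where K=K and e=e] by eventually_elim simp

lemma trans_prob_pos_if_path_weight_pos:
  "0 < path_weight K xs \<Longrightarrow> Suc k < length xs \<Longrightarrow> 0 < pmf (K (xs ! k)) (xs ! Suc k)"
proof (induction K xs arbitrary: k rule: path_weight.induct)
  case (1 K x y ys)
  have "0 < pmf (K x) y" "0 < path_weight K (y # ys)"
    using 1(2) path_weight_nonneg[of K "y # ys"] pmf_nonneg[of "K x" y]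
    by (auto simp: zero_less_mult_iff order_less_le)
  with 1 show ?case by (cases k) auto
qed auto

lemma measurable_case_nat_path [measurable]: "case_nat e \<in> path_space \<rightarrow>\<^sub>M path_space"
proof (rule measurable_path_spaceI)
  show "(\<lambda>\<omega>. case_nat e \<omega> n) \<in> path_space \<rightarrow>\<^sub>M count_space UNIV" for n
    by (cases n) auto
qed

lemma markov_kernel: "markov (K :: 'e::countable \<Rightarrow> 'e pmf) \<in> measure_pmf p \<rightarrow>\<^sub>M subprob_algebra path_space"
  by (auto simp: measurable_def space_subprob_algebra sets_markov
      intro: prob_space_imp_subprob_space prob_space_markov)

lemma nn_integral_markov_bind:
  fixes K :: "'e::countable \<Rightarrow> 'e pmf"
  assumes "f \<in> borel_measurable path_space"
  shows "(\<integral>\<^sup>+\<omega>. f \<omega> \<partial>(measure_pmf p \<bind> markov K)) = (\<integral>\<^sup>+s. (\<integral>\<^sup>+\<omega>. f \<omega> \<partial>markov K s) \<partial>measure_pmf p)"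
  by (rule nn_integral_bind[OF assms markov_kernel])

lemma sets_markov_bind: "sets (measure_pmf p \<bind> markov K) = sets path_space"
  by (rule sets_bind) (auto simp: sets_markov)

lemma prob_space_markov_bind: "prob_space (measure_pmf p \<bind> markov (K :: 'e::countable \<Rightarrow> 'e pmf))"
  by (rule measure_pmf.prob_space_bind[OF _ markov_kernel]) (auto intro: prob_space_markov)

text \<open>The Markov property at time 1. The construction of \<open>markov\<close> adds letters at
  the end of a path, whereas this splits off the first letter, the form needed for first-step
  analysis.\<close>

lemma markov_step_decomposition:
  fixes K :: "'e::countable \<Rightarrow> 'e pmf"
  shows "markov K e = distr (measure_pmf (K e) \<bind> markov K) path_space (case_nat e)"
proof (rule measure_eqI_prefix_le)
  interpret B: prob_space "measure_pmf (K e) \<bind> markov K" by (rule prob_space_markov_bind)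
  have [measurable_cong]: "sets (measure_pmf (K e) \<bind> markov K) = sets path_space"
    by (rule sets_markov_bind)
  have sp: "space (measure_pmf (K e) \<bind> markov K) = UNIV"
    using sets_eq_imp_space_eq[OF sets_markov_bind[of "K e" K]] by simp
  show "prob_space (distr (measure_pmf (K e) \<bind> markov K) path_space (case_nat e))"
    by (rule B.prob_space_distr) measurable
  fix xs :: "'e list"
  have D: "emeasure (distr (measure_pmf (K e) \<bind> markov K) path_space (case_nat e)) {\<omega>. map \<omega> [0..<length xs] = xs}
      = emeasure (measure_pmf (K e) \<bind> markov K) {\<omega>. map (case_nat e \<omega>) [0..<length xs] = xs}"
    by (subst emeasure_distr) (auto simp: sp vimage_def)
  show "emeasure (markov K e) {\<omega>. map \<omega> [0..<length xs] = xs}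
      \<le> emeasure (distr (measure_pmf (K e) \<bind> markov K) path_space (case_nat e)) {\<omega>. map \<omega> [0..<length xs] = xs}"
  proof (cases xs)
    case Nil
    then show ?thesis unfolding D emeasure_markov_prefix
      using B.emeasure_space_1 by (simp add: sp)
  next
    case (Cons x ys)
    have map_eq: "map (case_nat e \<omega>) [0..<length xs] = e # map \<omega> [0..<length ys]" for \<omega>
      unfolding Cons by (rule nth_equalityI) (auto simp: nth_Cons split: nat.split simp del: upt_Suc)
    show ?thesis
    proof (cases "x = e")
      case True
      have "emeasure (measure_pmf (K e) \<bind> markov K) {\<omega>. map (case_nat e \<omega>) [0..<length xs] = xs} =
        (\<integral>\<^sup>+s. emeasure (markov K s) {\<omega>. map \<omega> [0..<length ys] = ys} \<partial>measure_pmf (K e))"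
        unfolding map_eq using True Cons by (subst emeasure_bind[OF _ markov_kernel]) auto
      also have "\<dots> = ennreal (path_weight K xs)"
      proof (cases ys)
        case Nil
        then show ?thesis using Cons by (simp add: emeasure_markov_UNIV)
      next
        case (Cons y zs)
        have "(\<integral>\<^sup>+s. emeasure (markov K s) {\<omega>. map \<omega> [0..<length ys] = ys} \<partial>measure_pmf (K e))
          = (\<integral>\<^sup>+s. ennreal (path_weight K ys) * indicator {y} s \<partial>measure_pmf (K e))"
          unfolding emeasure_markov_prefix using Cons
          by (intro nn_integral_cong) (auto split: split_indicator)
        also have "\<dots> = ennreal (path_weight K xs)"
          using Cons \<open>xs = x # ys\<close> True
          by (subst nn_integral_cmult_indicator)
             (auto simp: emeasure_pmf_single ennreal_mult[symmetric] mult.commute)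
        finally show ?thesis .
      qed
      finally show ?thesis unfolding D emeasure_markov_prefix using Cons True by simp
    next
      case False
      \<comment> \<open>The left side is 0, and only an inequality is asked for.\<close>
      then show ?thesis unfolding emeasure_markov_prefix using Cons by simp
    qed
  qed
qed (auto simp: sets_markov prob_space_markov)

lemma nn_integral_markov_step:
  fixes K :: "'e::countable \<Rightarrow> 'e pmf"
  assumes [measurable]: "f \<in> borel_measurable path_space"
  shows "(\<integral>\<^sup>+\<omega>. f \<omega> \<partial>markov K e) = (\<integral>\<^sup>+s. (\<integral>\<^sup>+\<omega>. f (case_nat e \<omega>) \<partial>markov K s) \<partial>measure_pmf (K e))"
proof -
  have [measurable_cong]: "sets (measure_pmf (K e) \<bind> markov K) = sets path_space"
    by (rule sets_markov_bind)
  show ?thesis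
    by (subst markov_step_decomposition, subst nn_integral_distr) (auto simp: nn_integral_markov_bind)
qed

section \<open>Return times and Kac's formula\<close>

lemma less_return_time_iff: "enat i < return_time e \<omega> \<longleftrightarrow> (\<forall>k\<in>{1..i}. \<omega> k \<noteq> e)"
  unfolding return_time_def Suc_ile_eq[symmetric] le_Inf_iff by force

lemma return_time_eq_enat_iff:
  "return_time e \<omega> = enat n \<longleftrightarrow> 1 \<le> n \<and> \<omega> n = e \<and> (\<forall>k\<in>{1..<n}. \<omega> k \<noteq> e)"
proof -
  have "return_time e \<omega> = enat n \<longleftrightarrow> \<not> enat n < return_time e \<omega> \<and> (\<forall>i<n. enat i < return_time e \<omega>)"
  proof
    assume "\<not> enat n < return_time e \<omega> \<and> (\<forall>i<n. enat i < return_time e \<omega>)"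
    then show "return_time e \<omega> = enat n"
      by (cases "return_time e \<omega>") (auto simp: not_less, meson nat_less_le)
  qed auto
  also have "\<dots> \<longleftrightarrow> 1 \<le> n \<and> \<omega> n = e \<and> (\<forall>k\<in>{1..<n}. \<omega> k \<noteq> e)"
  proof
    assume *: "\<not> enat n < return_time e \<omega> \<and> (\<forall>i<n. enat i < return_time e \<omega>)"
    then obtain k where k: "1 \<le> k" "k \<le> n" "\<omega> k = e" by (auto simp: less_return_time_iff)
    have "\<omega> j \<noteq> e" if "1 \<le> j" "j < n" for j
      using * that less_return_time_iff[of j e \<omega>] by auto
    with k show "1 \<le> n \<and> \<omega> n = e \<and> (\<forall>k\<in>{1..<n}. \<omega> k \<noteq> e)"
      by (metis atLeastLessThan_iff le_trans order_le_less)
  qed (auto simp: less_return_time_iff)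
  finally show ?thesis .
qed

lemma return_time_eq_infinity_iff: "return_time e \<omega> = \<infinity> \<longleftrightarrow> (\<forall>k\<ge>1. \<omega> k \<noteq> e)"
proof -
  have "return_time e \<omega> = \<infinity> \<longleftrightarrow> (\<forall>i. enat i < return_time e \<omega>)"
    by (cases "return_time e \<omega>") auto
  also have "\<dots> \<longleftrightarrow> (\<forall>k\<ge>1. \<omega> k \<noteq> e)" by (force simp: less_return_time_iff)
  finally show ?thesis .
qed

lemma measurable_return_time [measurable]:
  "return_time (e :: 'e::countable) \<in> path_space \<rightarrow>\<^sub>M count_space UNIV"
proof -
  have "return_time e -` {t} \<in> sets path_space" for t
  proof (cases t)
    case (enat n)
    have "Measurable.pred path_space (\<lambda>\<omega>. 1 \<le> n \<and> \<omega> n = e \<and> (\<forall>k\<in>{1..<n}. \<omega> k \<noteq> e))"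
      by measurable
    then show ?thesis by (simp add: enat vimage_def return_time_eq_enat_iff pred_def)
  next
    case infinity
    have "Measurable.pred path_space (\<lambda>\<omega>. \<forall>k\<ge>1. \<omega> k \<noteq> e)" by measurable
    then show ?thesis by (simp add: infinity vimage_def return_time_eq_infinity_iff pred_def)
  qed
  then show ?thesis by (simp add: measurable_count_space_eq_countable)
qed

lemma shift_map_funpow: "(shift_map ^^ i) \<omega> = (\<lambda>n. \<omega> (i + n))"
  by (induction i arbitrary: \<omega>) (auto simp: shift_map_def funpow_swap1 fun_eq_iff)

lemma measurable_shift_map [measurable]: "shift_map ^^ i \<in> path_space \<rightarrow>\<^sub>M path_space"
  by (rule measurable_path_spaceI) (simp add: shift_map_funpow)

section \<open>Taboo expectations\<close>

definition avoids :: "'e \<Rightarrow> nat \<Rightarrow> (nat \<Rightarrow> 'e) set" where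
  "avoids e i = {\<omega>. \<forall>k\<in>{1..i}. \<omega> k \<noteq> e}"

lemma sets_avoids [measurable]: "avoids (e :: 'e::countable) i \<in> sets path_space"
proof -
  have "Measurable.pred path_space (\<lambda>\<omega>. \<forall>k\<in>{1..i}. \<omega> k \<noteq> e)"
    by measurable
  then show ?thesis by (simp add: avoids_def pred_def)
qed

text \<open>The expectation of \<open>h\<close> at time \<open>i\<close> on the event that the
  return time exceeds \<open>i\<close>. Summed over \<open>i\<close> with \<open>s = e\<close>, it
  is the expected sum of \<open>h\<close> along the shifts of the path during one excursion.\<close>

definition taboo_integral ::
    "('e::countable \<Rightarrow> 'e pmf) \<Rightarrow> 'e \<Rightarrow> ((nat \<Rightarrow> 'e) \<Rightarrow> ennreal) \<Rightarrow> nat \<Rightarrow> 'e \<Rightarrow> ennreal" where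
  "taboo_integral K e h i s = (\<integral>\<^sup>+\<omega>. indicator (avoids e i) \<omega> * h ((shift_map ^^ i) \<omega>) \<partial>markov K s)"

lemma taboo_integral_0: "taboo_integral K e h 0 s = (\<integral>\<^sup>+\<omega>. h \<omega> \<partial>markov K s)"
  by (simp add: taboo_integral_def avoids_def)

text \<open>First-step analysis. Time 1 of the path is time 0 of the path after the step, a time
  that \<open>avoids\<close> does not test; hence the factor
  \<open>indicator (- {e}) s'\<close>.\<close>

lemma taboo_integral_Suc:
  assumes [measurable]: "h \<in> borel_measurable path_space"
  shows "taboo_integral K e h (Suc i) s =
    (\<integral>\<^sup>+s'. indicator (- {e}) s' * taboo_integral K e h i s' \<partial>measure_pmf (K s))"
proof -
  have "taboo_integral K e h (Suc i) s =
    (\<integral>\<^sup>+s'. (\<integral>\<^sup>+\<omega>. indicator (avoids e (Suc i)) (case_nat s \<omega>) * h ((shift_map ^^ Suc i) (case_nat s \<omega>)) \<partial>markov K s') \<partial>measure_pmf (K s))"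
    unfolding taboo_integral_def by (rule nn_integral_markov_step) measurable
  also have "\<dots> = (\<integral>\<^sup>+s'. indicator (- {e}) s' * taboo_integral K e h i s' \<partial>measure_pmf (K s))"
  proof (rule nn_integral_cong)
    fix s'
    have "(\<integral>\<^sup>+\<omega>. indicator (avoids e (Suc i)) (case_nat s \<omega>) * h ((shift_map ^^ Suc i) (case_nat s \<omega>)) \<partial>markov K s')
      = (\<integral>\<^sup>+\<omega>. indicator (- {e}) s' * (indicator (avoids e i) \<omega> * h ((shift_map ^^ i) \<omega>)) \<partial>markov K s')"
    proof (rule nn_integral_cong_AE)
      show "AE \<omega> in markov K s'. indicator (avoids e (Suc i)) (case_nat s \<omega>) * h ((shift_map ^^ Suc i) (case_nat s \<omega>))
        = indicator (- {e}) s' * (indicator (avoids e i) \<omega> * h ((shift_map ^^ i) \<omega>))"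
        using AE_markov_0[where K=K and e=s']
      proof eventually_elim
        case (elim \<omega>)
        have "(\<forall>k\<in>{1..Suc i}. case_nat s \<omega> k \<noteq> e) \<longleftrightarrow> (\<forall>k\<in>{0..i}. \<omega> k \<noteq> e)"
          unfolding image_Suc_atLeastAtMost[symmetric] One_nat_def by (simp del: image_Suc_atLeastAtMost)
        also have "\<dots> \<longleftrightarrow> s' \<noteq> e \<and> (\<forall>k\<in>{1..i}. \<omega> k \<noteq> e)"
          using elim by (auto simp: Ball_def) (metis One_nat_def Suc_leI not_gr_zero)
        finally have "case_nat s \<omega> \<in> avoids e (Suc i) \<longleftrightarrow> s' \<noteq> e \<and> \<omega> \<in> avoids e i"
          by (simp add: avoids_def)
        then show ?case
          by (auto simp: shift_map_funpow split: split_indicator simp del: funpow.simps)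
      qed
    qed
    also have "\<dots> = indicator (- {e}) s' * taboo_integral K e h i s'"
      unfolding taboo_integral_def by (rule nn_integral_cmult) measurable
    finally show "(\<integral>\<^sup>+\<omega>. indicator (avoids e (Suc i)) (case_nat s \<omega>) * h ((shift_map ^^ Suc i) (case_nat s \<omega>)) \<partial>markov K s')
      = indicator (- {e}) s' * taboo_integral K e h i s'" .
  qed
  finally show ?thesis .
qed

text \<open>By stationarity \<open>h\<close> may be evaluated at time \<open>n\<close>. The terms
  then sort the paths by their last visit to \<open>e\<close> at the times 1 to n: the summand
  \<open>i\<close> belongs to a last visit at time n - i, the final term to paths without such a
  visit. The induction splits the remainder by whether it starts in \<open>e\<close>, and replaces
  \<open>\<pi>\<close> by \<open>bind_pmf \<pi> K\<close> on the part that does not.\<close>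

lemma stationary_taboo_decomposition:
  assumes [measurable]: "h \<in> borel_measurable path_space" and "stationary K \<pi>"
  shows "(\<integral>\<^sup>+s. taboo_integral K e h 0 s \<partial>measure_pmf \<pi>) =
    ennreal (pmf \<pi> e) * (\<Sum>i<n. taboo_integral K e h i e) + (\<integral>\<^sup>+s. taboo_integral K e h n s \<partial>measure_pmf \<pi>)"
proof (induction n)
  case (Suc n)
  let ?t = "taboo_integral K e h n"
  have "(\<integral>\<^sup>+s. ?t s \<partial>measure_pmf \<pi>)
      = (\<integral>\<^sup>+s. ?t e * indicator {e} s + indicator (- {e}) s * ?t s \<partial>measure_pmf \<pi>)"
    by (intro nn_integral_cong) (auto split: split_indicator)
  also have "\<dots> = (\<integral>\<^sup>+s. ?t e * indicator {e} s \<partial>measure_pmf \<pi>) + (\<integral>\<^sup>+s. indicator (- {e}) s * ?t s \<partial>measure_pmf \<pi>)"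
    by (rule nn_integral_add) auto
  also have "(\<integral>\<^sup>+s. ?t e * indicator {e} s \<partial>measure_pmf \<pi>) = ennreal (pmf \<pi> e) * ?t e"
    by (subst nn_integral_cmult_indicator) (auto simp: emeasure_pmf_single mult.commute)
  also have "(\<integral>\<^sup>+s. indicator (- {e}) s * ?t s \<partial>measure_pmf \<pi>) = (\<integral>\<^sup>+s. indicator (- {e}) s * ?t s \<partial>measure_pmf (bind_pmf \<pi> K))"
    using assms(2) by (simp add: stationary_def)
  also have "\<dots> = (\<integral>\<^sup>+s. taboo_integral K e h (Suc n) s \<partial>measure_pmf \<pi>)"
    by (simp add: taboo_integral_Suc)
  finally show ?case using Suc.IH by (simp add: distrib_left add.assoc)
qed simp

lemma AE_return_time_finite_self:
  fixes K :: "'e::countable \<Rightarrow> 'e pmf"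
  assumes "positive_recurrent K"
  shows "AE \<omega> in markov K e. return_time e \<omega> < \<infinity>"
proof -
  have "AE \<omega> in markov K e. ennreal_of_enat (return_time e \<omega>) \<noteq> \<infinity>"
    using assms unfolding positive_recurrent_def
    by (intro nn_integral_PInf_AE) (auto simp: less_top)
  then show ?thesis
  proof eventually_elim
    case (elim \<omega>)
    then show ?case by (cases "return_time e \<omega>") auto
  qed
qed

text \<open>Let \<open>v s\<close> be the probability of never reaching \<open>e\<close> from
  \<open>s\<close>. It vanishes at \<open>e\<close> by recurrence, and first-step analysis shows
  that its zeros are closed under transitions of positive probability. If \<open>v s\<close> were
  not 0, the chain started at \<open>e\<close> would therefore never reach \<open>s\<close>, against
  irreducibility.\<close>

lemma AE_return_time_finite:
  fixes K :: "'e::countable \<Rightarrow> 'e pmf"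
  assumes irr: "irreducible_chain K" and rec: "positive_recurrent K"
  shows "AE \<omega> in markov K s. return_time e \<omega> < \<infinity>"
proof -
  define never where "never = {\<omega>. return_time e \<omega> = \<infinity>}"
  have [measurable]: "never \<in> sets path_space"
    using measurable_sets[OF measurable_return_time, of "{\<infinity>}" e] by (simp add: never_def vimage_def)
  define v where "v s = emeasure (markov K s) never" for s
  have v_iff: "v s = 0 \<longleftrightarrow> (AE \<omega> in markov K s. return_time e \<omega> < \<infinity>)" for s
    unfolding v_def by (subst AE_iff_measurable[OF _ refl])
      (auto simp: sets_markov space_markov never_def[symmetric])
  have never_case_nat: "case_nat s \<omega> \<in> never \<longleftrightarrow> \<omega> 0 \<noteq> e \<and> \<omega> \<in> never" for s \<omega>
  proof -
    have "case_nat s \<omega> \<in> never \<longleftrightarrow> (\<forall>k\<ge>1. case_nat s \<omega> k \<noteq> e)"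
      by (simp add: never_def return_time_eq_infinity_iff)
    also have "\<dots> \<longleftrightarrow> (\<forall>k. \<omega> k \<noteq> e)" by (auto split: nat.split)
    also have "\<dots> \<longleftrightarrow> \<omega> 0 \<noteq> e \<and> \<omega> \<in> never"
      by (auto simp: never_def return_time_eq_infinity_iff) (metis One_nat_def Suc_leI not_gr_zero)
    finally show ?thesis .
  qed
  have v_step: "v s = (\<integral>\<^sup>+s'. indicator (- {e}) s' * v s' \<partial>measure_pmf (K s))" for s
  proof -
    have "v s = (\<integral>\<^sup>+\<omega>. indicator never \<omega> \<partial>markov K s)" by (simp add: v_def)
    also have "\<dots> = (\<integral>\<^sup>+s'. (\<integral>\<^sup>+\<omega>. indicator never (case_nat s \<omega>) \<partial>markov K s') \<partial>measure_pmf (K s))"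
      by (rule nn_integral_markov_step) measurable
    also have "\<dots> = (\<integral>\<^sup>+s'. indicator (- {e}) s' * v s' \<partial>measure_pmf (K s))"
    proof (rule nn_integral_cong)
      fix s'
      have "(\<integral>\<^sup>+\<omega>. indicator never (case_nat s \<omega>) \<partial>markov K s') = (\<integral>\<^sup>+\<omega>. indicator (- {e}) s' * indicator never \<omega> \<partial>markov K s')"
      proof (rule nn_integral_cong_AE)
        show "AE \<omega> in markov K s'. indicator never (case_nat s \<omega>) = (indicator (- {e}) s' * indicator never \<omega> :: ennreal)"
          using AE_markov_0[where K=K and e=s']
          by eventually_elim (auto simp: never_case_nat split: split_indicator)
      qed
      also have "\<dots> = indicator (- {e}) s' * v s'"
        unfolding v_def by (subst nn_integral_cmult) auto
      finally show "(\<integral>\<^sup>+\<omega>. indicator never (case_nat s \<omega>) \<partial>markov K s') = indicator (- {e}) s' * v s'" .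
    qed
    finally show ?thesis .
  qed
  have v_e: "v e = 0" using AE_return_time_finite_self[OF rec] by (simp add: v_iff)
  have closed: "v s' = 0" if "v s = 0" "0 < pmf (K s) s'" for s s'
  proof -
    have "AE x in measure_pmf (K s). indicator (- {e}) x * v x = 0"
      by (rule nn_integral_0_iff_AE[THEN iffD1, OF _ trans[OF v_step[symmetric] that(1)]]) simp
    then have "indicator (- {e}) s' * v s' = 0"
      using that(2) by (subst (asm) AE_measure_pmf_iff) (auto simp: set_pmf_iff)
    then show ?thesis using v_e by (cases "s' = e") auto
  qed
  have "v s = 0"
  proof (rule ccontr)
    assume s: "v s \<noteq> 0"
    have "AE \<omega> in markov K e. return_time s \<omega> = \<infinity>"
      using AE_markov_path_weight_pos[where K=K and e=e]
    proof eventually_elim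
      case (elim \<omega>)
      have "v (\<omega> n) = 0" for n
      proof (induction n)
        case (Suc n)
        have "0 < pmf (K (\<omega> n)) (\<omega> (Suc n))"
          using trans_prob_pos_if_path_weight_pos[of K "map \<omega> [0..<Suc (Suc n)]" n] elim
          by (auto simp del: upt_Suc)
        with Suc show ?case by (rule closed)
      qed (use elim v_e in simp)
      then show ?case using s by (auto simp: return_time_eq_infinity_iff)
    qed
    then have "AE \<omega> in markov K e. \<not> return_time s \<omega> < \<infinity>"
      by eventually_elim simp
    then have "\<P>(\<omega> in markov K e. return_time s \<omega> < \<infinity>) = 0"
      using prob_space.prob_Collect_eq_0[OF prob_space_markov, of K e "\<lambda>\<omega>. return_time s \<omega> < \<infinity>"]
        measurable_sets[OF measurable_return_time, of "{..<\<infinity>}" s]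
      by (simp add: sets_markov space_markov vimage_def)
    moreover have "0 < \<P>(\<omega> in markov K e. return_time s \<omega> < \<infinity>)"
      using irr unfolding irreducible_chain_def by blast
    ultimately show False by linarith
  qed
  then show ?thesis by (simp add: v_iff)
qed

text \<open>
  Kac's formula. The remainder of the decomposition at time \<open>n\<close> is at most \<open>C\<close> times the
  probability of not having visited \<open>e\<close> up to time \<open>n\<close>.
\<close>

lemma markov_init_eq_taboo_sum:
  assumes [measurable]: "h \<in> borel_measurable path_space" and h: "\<And>\<omega>. h \<omega> \<le> ennreal C"
    and irr: "irreducible_chain K" and rec: "positive_recurrent K" and stat: "stationary K \<pi>"
  shows "(\<integral>\<^sup>+\<omega>. h \<omega> \<partial>markov_init K \<pi>) = ennreal (pmf \<pi> e) * (\<Sum>i. taboo_integral K e h i e)"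
proof -
  have lim_avoid: "(\<lambda>n. emeasure (markov K s) (avoids e n)) \<longlonglongrightarrow> 0" for s
  proof -
    interpret prob_space "markov K s" by (rule prob_space_markov)
    have "(\<lambda>n. emeasure (markov K s) (avoids e n)) \<longlonglongrightarrow> emeasure (markov K s) (\<Inter>n. avoids e n)"
    proof (rule Lim_emeasure_decseq)
      show "decseq (avoids e)" by (force simp: decseq_def avoids_def)
      show "range (avoids e) \<subseteq> sets (markov K s)" by (auto simp: sets_markov)
      show "emeasure (markov K s) (avoids e n) \<noteq> \<infinity>" for n by simp
    qed
    also have "(\<Inter>n. avoids e n) = {\<omega>\<in>space (markov K s). \<not> return_time e \<omega> < \<infinity>}"
    proof (rule set_eqI)
      fix \<omega>
      have "\<omega> \<in> (\<Inter>n. avoids e n) \<longleftrightarrow> (\<forall>n. enat n < return_time e \<omega>)"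
        by (simp add: avoids_def less_return_time_iff)
      also have "\<dots> \<longleftrightarrow> \<not> return_time e \<omega> < \<infinity>"
        by (cases "return_time e \<omega>") auto
      finally show "\<omega> \<in> (\<Inter>n. avoids e n) \<longleftrightarrow> \<omega> \<in> {\<omega>\<in>space (markov K s). \<not> return_time e \<omega> < \<infinity>}"
        by (simp add: space_markov)
    qed
    also have "emeasure (markov K s) \<dots> = 0"
    proof (rule AE_iff_measurable[THEN iffD1, OF _ refl])
      show "AE \<omega> in markov K s. return_time e \<omega> < \<infinity>" by (rule AE_return_time_finite[OF irr rec])
    qed measurable
    finally show ?thesis .
  qed
  have "(\<lambda>n. \<integral>\<^sup>+s. taboo_integral K e h n s \<partial>measure_pmf \<pi>) \<longlonglongrightarrow> (\<integral>\<^sup>+s. 0 \<partial>measure_pmf \<pi>)"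
  proof (rule nn_integral_dominated_convergence[where w="\<lambda>_. ennreal C"])
    have le: "taboo_integral K e h n s \<le> ennreal C * emeasure (markov K s) (avoids e n)" for n s
    proof -
      have "taboo_integral K e h n s \<le> (\<integral>\<^sup>+\<omega>. ennreal C * indicator (avoids e n) \<omega> \<partial>markov K s)"
        unfolding taboo_integral_def by (intro nn_integral_mono) (auto split: split_indicator simp: h)
      also have "\<dots> = ennreal C * emeasure (markov K s) (avoids e n)"
        by (rule nn_integral_cmult_indicator) (simp add: sets_markov)
      finally show ?thesis .
    qed
    show "AE s in measure_pmf \<pi>. (\<lambda>n. taboo_integral K e h n s) \<longlonglongrightarrow> 0"
    proof (rule AE_I2)
      fix s
      have lim: "(\<lambda>n. ennreal C * emeasure (markov K s) (avoids e n)) \<longlonglongrightarrow> 0"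
        using ennreal_tendsto_cmult[OF _ lim_avoid[of s], of "ennreal C"] by simp
      show "(\<lambda>n. taboo_integral K e h n s) \<longlonglongrightarrow> 0"
        by (rule tendsto_sandwich[OF _ _ tendsto_const lim]) (auto simp: le)
    qed
    show "AE s in measure_pmf \<pi>. taboo_integral K e h n s \<le> ennreal C" for n
    proof (rule AE_I2)
      fix s
      interpret prob_space "markov K s" by (rule prob_space_markov)
      have "ennreal C * emeasure (markov K s) (avoids e n) \<le> ennreal C * 1"
        by (intro mult_left_mono emeasure_le_1) auto
      with le[of n s] show "taboo_integral K e h n s \<le> ennreal C" by simp
    qed
  qed auto
  moreover have "(\<lambda>n. ennreal (pmf \<pi> e) * (\<Sum>i<n. taboo_integral K e h i e)) \<longlonglongrightarrow>
      ennreal (pmf \<pi> e) * (\<Sum>i. taboo_integral K e h i e)"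
    by (intro ennreal_tendsto_cmult summable_LIMSEQ) auto
  ultimately have "(\<lambda>n. ennreal (pmf \<pi> e) * (\<Sum>i<n. taboo_integral K e h i e) + (\<integral>\<^sup>+s. taboo_integral K e h n s \<partial>measure_pmf \<pi>))
     \<longlonglongrightarrow> ennreal (pmf \<pi> e) * (\<Sum>i. taboo_integral K e h i e) + (\<integral>\<^sup>+s. 0 \<partial>measure_pmf \<pi>)"
    by (intro tendsto_add)
  then have "(\<integral>\<^sup>+s. taboo_integral K e h 0 s \<partial>measure_pmf \<pi>) = ennreal (pmf \<pi> e) * (\<Sum>i. taboo_integral K e h i e)"
    by (simp add: stationary_taboo_decomposition[OF assms(1) stat, symmetric] LIMSEQ_const_iff)
  moreover have "(\<integral>\<^sup>+\<omega>. h \<omega> \<partial>markov_init K \<pi>) = (\<integral>\<^sup>+s. taboo_integral K e h 0 s \<partial>measure_pmf \<pi>)"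
    unfolding markov_init_def taboo_integral_0 by (rule nn_integral_markov_bind) measurable
  ultimately show ?thesis by simp
qed

section \<open>Excursions\<close>

text \<open>
  Excursions are written from left to right, unlike the words of the statement. On paths that
  never return to \<open>e\<close>, \<^const>\<open>the_enat\<close> gives a junk value.
\<close>

definition excursion :: "'e \<Rightarrow> (nat \<Rightarrow> 'e) \<Rightarrow> 'e list" where
  "excursion e \<omega> = map \<omega> [0..<the_enat (return_time e \<omega>)]"

definition excursion_law :: "('e::countable \<Rightarrow> 'e pmf) \<Rightarrow> 'e \<Rightarrow> 'e list measure" where
  "excursion_law K e = distr (markov K e) (count_space UNIV) (excursion e)"

text \<open>The letter \<open>e\<close> that ends an excursion is left to the next word; the event
  of a given excursion \<open>w\<close> is therefore the cylinder of \<open>w @ [e]\<close>.\<close>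

definition excursions :: "'e \<Rightarrow> 'e list set" where
  "excursions e = {e # ys | ys. e \<notin> set ys}"

lemma Nil_notin_excursions: "[] \<notin> excursions e"
  by (simp add: excursions_def)

lemma measurable_excursion [measurable]:
  "excursion (e :: 'e::countable) \<in> path_space \<rightarrow>\<^sub>M count_space UNIV"
  unfolding excursion_def
  by (rule measurable_compose_countable[where f="\<lambda>t \<omega>. map \<omega> [0..<the_enat t]"]) measurable

lemma sets_excursion_law [measurable_cong]: "sets (excursion_law K e) = sets (count_space UNIV)"
  by (simp add: excursion_law_def)

lemma space_excursion_law [simp]: "space (excursion_law K e) = UNIV"
  by (simp add: excursion_law_def)

lemma prob_space_excursion_law: "prob_space (excursion_law K e)"
  unfolding excursion_law_def
  by (rule prob_space.prob_space_distr[OF prob_space_markov]) measurable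

lemma excursion_eq_iff:
  assumes "return_time e \<omega> < \<infinity>" "\<omega> 0 = e" "w \<in> excursions e"
  shows "excursion e \<omega> = w \<longleftrightarrow> map \<omega> [0..<Suc (length w)] = w @ [e]"
proof
  assume *: "excursion e \<omega> = w"
  obtain n where n: "return_time e \<omega> = enat n" using assms(1) by (cases "return_time e \<omega>") auto
  then have "\<omega> n = e" by (simp add: return_time_eq_enat_iff)
  moreover have "map \<omega> [0..<n] = w" using * n by (simp add: excursion_def)
  ultimately show "map \<omega> [0..<Suc (length w)] = w @ [e]" by auto
next
  assume "map \<omega> [0..<Suc (length w)] = w @ [e]"
  then have w: "map \<omega> [0..<length w] = w" and last: "\<omega> (length w) = e" by auto
  obtain ys where ys: "w = e # ys" "e \<notin> set ys" using assms(3) by (auto simp: excursions_def)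
  have nth: "\<omega> k = w ! k" if "k < length w" for k using that arg_cong[OF w, of "\<lambda>l. l ! k"] by simp
  have "\<omega> k \<noteq> e" if "1 \<le> k" "k < length w" for k
  proof -
    have "\<omega> k = ys ! (k - 1)" using nth[OF that(2)] that ys(1) by (cases k) auto
    moreover have "k - 1 < length ys" using that ys(1) by auto
    ultimately show ?thesis using ys(2) nth_mem by metis
  qed
  then have "return_time e \<omega> = enat (length w)"
    using last ys(1) by (auto simp: return_time_eq_enat_iff)
  then show "excursion e \<omega> = w" using w by (simp add: excursion_def)
qed

lemma excursion_in_excursions:
  assumes "return_time e \<omega> < \<infinity>" "\<omega> 0 = e"
  shows "excursion e \<omega> \<in> excursions e"
proof -
  obtain n where n: "return_time e \<omega> = enat n" using assms(1) by (cases "return_time e \<omega>") auto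
  then have "1 \<le> n" "\<forall>k\<in>{1..<n}. \<omega> k \<noteq> e" by (auto simp: return_time_eq_enat_iff)
  moreover have "excursion e \<omega> = \<omega> 0 # map \<omega> [1..<n]"
    using n \<open>1 \<le> n\<close> by (simp add: excursion_def upt_conv_Cons)
  ultimately show ?thesis using assms(2) by (auto simp: excursions_def)
qed

context
  fixes K :: "'e::countable \<Rightarrow> 'e pmf" and e :: 'e
  assumes recurrent: "AE \<omega> in markov K e. return_time e \<omega> < \<infinity>"
begin

text \<open>Nonempty prefixes of excursions are thus admissible words starting with \<open>e\<close>
  once reversed, and this is where the invariance of \<open>m\<close> will apply.\<close>

lemma AE_excursion_law:
  "AE w in excursion_law K e. w \<in> excursions e \<and> (\<forall>i. 0 < path_weight K (take i w))"
proof -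
  have "AE \<omega> in markov K e. excursion e \<omega> \<in> excursions e \<and> (\<forall>i. 0 < path_weight K (take i (excursion e \<omega>)))"
    using recurrent AE_markov_path_weight_pos[where K=K and e=e]
  proof eventually_elim
    case (elim \<omega>)
    have "take i (excursion e \<omega>) = map \<omega> [0..<min i (the_enat (return_time e \<omega>))]" for i
      by (simp add: excursion_def take_map min_def)
    with elim show ?case by (simp add: excursion_in_excursions)
  qed
  then show ?thesis
    unfolding excursion_law_def by (subst AE_distr_iff) auto
qed

lemma emeasure_excursion_law:
  assumes w: "w \<in> excursions e"
  shows "emeasure (excursion_law K e) {w} = ennreal (path_weight K (w @ [e]))"
proof -
  have "emeasure (excursion_law K e) {w} = emeasure (markov K e) {\<omega>\<in>space (markov K e). excursion e \<omega> = w}"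
    unfolding excursion_law_def by (subst emeasure_distr) (auto intro!: arg_cong[where f="emeasure _"])
  also have "\<dots> = emeasure (markov K e) {\<omega>. map \<omega> [0..<length (w @ [e])] = w @ [e]}"
  proof (rule emeasure_eq_AE)
    show "AE \<omega> in markov K e. \<omega> \<in> {\<omega>\<in>space (markov K e). excursion e \<omega> = w} \<longleftrightarrow> \<omega> \<in> {\<omega>. map \<omega> [0..<length (w @ [e])] = w @ [e]}"
      using recurrent AE_markov_0[where K=K and e=e]
      by eventually_elim (simp add: space_markov excursion_eq_iff[OF _ _ w] del: upt_Suc)
    show "{\<omega>. map \<omega> [0..<length (w @ [e])] = w @ [e]} \<in> sets (markov K e)"
      unfolding sets_markov by (rule sets_prefix_cylinder)
  qed measurable
  also have "\<dots> = ennreal (path_weight K (w @ [e]))"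
    unfolding emeasure_markov_prefix using w by (auto simp: excursions_def)
  finally show ?thesis .
qed

end

section \<open>Concatenation of excursions\<close>

lemma path_weight_concat_excursions:
  "set ws \<subseteq> excursions e \<Longrightarrow>
   path_weight K (concat ws @ [e]) = (\<Prod>j<length ws. path_weight K (ws ! j @ [e]))"
proof (induction ws)
  case (Cons w ws)
  have "\<exists>zs. concat ws @ [e] = e # zs"
    using Cons.prems by (cases ws) (auto simp: excursions_def)
  then obtain zs where zs: "concat ws @ [e] = e # zs" ..
  \<comment> \<open>The split is at the letter \<open>e\<close> that ends the excursion
    \<open>w\<close> and begins what follows.\<close>
  have "path_weight K (concat (w # ws) @ [e]) = path_weight K (w @ [e]) * path_weight K (e # zs)"
    using path_weight_append[of K w e zs] zs by simp
  also have "\<dots> = path_weight K (w @ [e]) * (\<Prod>j<length ws. path_weight K (ws ! j @ [e]))"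
    using Cons zs by simp
  finally show ?case by (simp add: prod.lessThan_Suc_shift del: prod.lessThan_Suc)
qed simp

text \<open>The first word is recovered as \<open>e\<close> followed by the letters up to the next
  \<open>e\<close>, which exists because what follows begins with \<open>e\<close>. This makes the
  cylinders over different lists of equally many excursions disjoint.\<close>

lemma concat_excursions_unique:
  "length ws = length ws' \<Longrightarrow> set ws \<subseteq> excursions e \<Longrightarrow> set ws' \<subseteq> excursions e \<Longrightarrow>
   concat ws @ e # u = concat ws' @ e # v \<Longrightarrow> ws = ws'"
proof (induction ws ws' rule: list_induct2)
  case (Cons w ws w' ws')
  obtain y y' where y: "w = e # y" "e \<notin> set y" and y': "w' = e # y'" "e \<notin> set y'"
    using Cons.prems by (auto simp: excursions_def)
  have "\<exists>zs. concat ws @ e # u = e # zs" "\<exists>zs. concat ws' @ e # v = e # zs"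
    using Cons.prems by (cases ws; force simp: excursions_def) (cases ws'; use Cons.prems in \<open>force simp: excursions_def\<close>)
  then obtain z z' where z: "concat ws @ e # u = e # z" and z': "concat ws' @ e # v = e # z'" by blast
  have eq: "y @ e # z = y' @ e # z'" using Cons.prems(3) y y' z z' by simp
  have "takeWhile (\<lambda>x. x \<noteq> e) (y @ e # z) = y" "takeWhile (\<lambda>x. x \<noteq> e) (y' @ e # z') = y'"
    using y(2) y'(2) by (subst takeWhile_append2; force)+
  then have "y = y'" using eq by simp
  then have "concat ws @ e # u = concat ws' @ e # v" using eq z z' by simp
  with Cons \<open>y = y'\<close> y y' show ?case by simp
qed simp

text \<open>If no word is empty, \<open>Suc n\<close> words reach the letter \<open>n\<close>. Thus
  each letter depends on an explicit finite number of words, which gives measurability and later the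
  finite range of dependence.\<close>

definition concat_seq :: "(nat \<Rightarrow> 'a list) \<Rightarrow> nat \<Rightarrow> 'a" where
  "concat_seq W n = concat (map W [0..<Suc n]) ! n"

definition concat_time :: "(nat \<Rightarrow> 'a list) \<Rightarrow> nat \<Rightarrow> nat" where
  "concat_time W n = (\<Sum>j<n. length (W j))"

lemma length_concat_map_upt: "length (concat (map W [0..<n])) = concat_time W n"
  by (induction n) (auto simp: concat_time_def)

lemma concat_time_ge:
  assumes "\<And>j. W j \<noteq> []" shows "n \<le> concat_time W n"
proof -
  have "(\<Sum>j<n. 1) \<le> (\<Sum>j<n. length (W j))"
    using assms by (intro sum_mono) (simp add: Suc_le_eq)
  then show ?thesis by (simp add: concat_time_def)
qed

lemma concat_map_upt_add:
  "concat (map W [0..<m + n]) = concat (map W [0..<m]) @ concat (map (\<lambda>k. W (m + k)) [0..<n])"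
  by (induction n) auto

lemma concat_seq_nth:
  assumes W: "\<And>j. W j \<noteq> []" and k: "k < concat_time W n"
  shows "concat_seq W k = concat (map W [0..<n]) ! k"
proof -
  have k': "k < concat_time W (Suc k)" using concat_time_ge[of W "Suc k"] W by simp
  show ?thesis
  proof (cases "n \<le> Suc k")
    case True
    then obtain d where "Suc k = n + d" by (auto simp: le_iff_add)
    then show ?thesis using k
      by (simp only: concat_seq_def concat_map_upt_add) (simp add: nth_append length_concat_map_upt)
  next
    case False
    then obtain d where d: "n = Suc k + d" by (metis le_iff_add nat_le_linear)
    show ?thesis unfolding d concat_map_upt_add concat_seq_def
      using k' by (simp only: nth_append length_concat_map_upt if_True)
  qed
qed

lemma prefix_concat_seq:
  assumes W: "\<And>j. W j \<noteq> []" and k: "k \<le> concat_time W n"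
  shows "map (concat_seq W) [0..<k] = take k (concat (map W [0..<n]))"
  using k by (intro nth_equalityI) (auto simp: length_concat_map_upt concat_seq_nth[of W _ n] W)

lemma concat_seq_shift:
  assumes W: "\<And>j. W j \<noteq> []"
  shows "concat_seq W (concat_time W n + i) = concat_seq (\<lambda>k. W (n + k)) i"
proof -
  have i: "i < concat_time (\<lambda>k. W (n + k)) (Suc i)"
    using concat_time_ge[of "\<lambda>k. W (n + k)" "Suc i"] W by simp
  have "concat_time W (n + Suc i) = concat_time W n + concat_time (\<lambda>k. W (n + k)) (Suc i)"
    unfolding length_concat_map_upt[symmetric] concat_map_upt_add by simp
  then have "concat_seq W (concat_time W n + i) = concat (map W [0..<n + Suc i]) ! (concat_time W n + i)"
    using i by (intro concat_seq_nth W) simp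
  also have "\<dots> = concat (map (\<lambda>k. W (n + k)) [0..<Suc i]) ! i"
    unfolding concat_map_upt_add by (simp only: nth_append length_concat_map_upt) simp
  finally show ?thesis by (simp only: concat_seq_def)
qed

lemma measurable_concat_seq [measurable]:
  "concat_seq \<in> path_space \<rightarrow>\<^sub>M (path_space :: (nat \<Rightarrow> 'e::countable) measure)"
proof (rule measurable_path_spaceI)
  fix n
  show "(\<lambda>W. concat_seq W n :: 'e) \<in> path_space \<rightarrow>\<^sub>M count_space UNIV"
    unfolding concat_seq_def
    by (rule measurable_compose[OF measurable_prefix[of "Suc n"], of "\<lambda>ws. concat ws ! n"]) simp
qed

lemma prefix_append_exists:
  assumes "map \<omega> [0..<length p] = p" "map \<omega> [0..<length q] = q"
  shows "\<exists>u v. p @ u = q @ v"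
proof -
  have "p @ map \<omega> [length p..<length p + length q] = map \<omega> [0..<length p + length q]"
    using assms(1) upt_add_eq_append[of 0 "length p" "length q"] by (metis add_0 le0 map_append)
  moreover have "q @ map \<omega> [length q..<length q + length p] = map \<omega> [0..<length q + length p]"
    using assms(2) upt_add_eq_append[of 0 "length q" "length p"] by (metis add_0 le0 map_append)
  ultimately show ?thesis by (metis add.commute)
qed

abbreviation excursion_space :: "('e::countable \<Rightarrow> 'e pmf) \<Rightarrow> 'e \<Rightarrow> (nat \<Rightarrow> 'e list) measure" where
  "excursion_space K e \<equiv> PiM UNIV (\<lambda>_. excursion_law K e)"

lemma sequence_space_excursion_law: "sequence_space (excursion_law K e)"
proof -
  interpret prob_space "excursion_law K e" by (rule prob_space_excursion_law)
  show ?thesis by unfold_locales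
qed

lemma sets_excursion_space [measurable_cong]: "sets (excursion_space K e) = sets path_space"
  by (intro sets_PiM_cong) (auto simp: sets_excursion_law)

lemma space_excursion_space [simp]: "space (excursion_space K e) = UNIV"
  by (simp add: space_PiM)

lemma AE_excursion_space:
  fixes K :: "'e::countable \<Rightarrow> 'e pmf"
  assumes "AE \<omega> in markov K e. return_time e \<omega> < \<infinity>"
  shows "AE W in excursion_space K e. \<forall>j. W j \<in> excursions e \<and> (\<forall>i. 0 < path_weight K (take i (W j)))"
  unfolding AE_all_countable
proof
  fix j
  show "AE W in excursion_space K e. W j \<in> excursions e \<and> (\<forall>i. 0 < path_weight K (take i (W j)))"
    using AE_excursion_law[OF assms] prob_space_excursion_law
    by (intro AE_PiM_component[where P="\<lambda>w. w \<in> excursions e \<and> (\<forall>i. 0 < path_weight K (take i w))"]) auto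
qed

text \<open>
  Both measures agree on the cylinders that end with a return to \<open>e\<close>, and the law of the
  concatenation gives each cylinder the total mass of those inside it. Hence it is at most the
  Markov measure on every cylinder, which forces equality as both are probability measures.
\<close>

lemma distr_concat_seq:
  fixes K :: "'e::countable \<Rightarrow> 'e pmf"
  assumes rec: "AE \<omega> in markov K e. return_time e \<omega> < \<infinity>"
  shows "distr (excursion_space K e) path_space concat_seq = markov K e"
proof (rule measure_eqI_prefix_le)
  let ?Q = "excursion_space K e"
  interpret sequence_space "excursion_law K e" by (rule sequence_space_excursion_law)
  show "prob_space (distr ?Q path_space concat_seq)"
    by (rule P.prob_space_distr) measurable
  fix xs :: "'e list"
  let ?n = "length xs"
  \<comment> \<open>As many excursions as letters are enough, since no excursion is empty.\<close>
  define A where "A = {ws. length ws = ?n \<and> set ws \<subseteq> excursions e \<and> take ?n (concat ws) = xs}"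
  let ?C = "\<lambda>ws. {\<omega>. map \<omega> [0..<length (concat ws @ [e])] = concat ws @ [e]}"
  have single: "emeasure ?Q {W. map W [0..<?n] = ws} = emeasure (markov K e) (?C ws)" if "ws \<in> A" for ws
  proof -
    have len: "length ws = ?n" and exc: "set ws \<subseteq> excursions e" using that by (auto simp: A_def)
    have "map W [0..<?n] = ws \<longleftrightarrow> (\<forall>j\<in>{..<?n}. W j \<in> {ws ! j})" for W
      using len by (subst list_eq_iff_nth_eq) auto
    then have "emeasure ?Q {W. map W [0..<?n] = ws} = emeasure ?Q {W\<in>space ?Q. \<forall>j\<in>{..<?n}. W j \<in> {ws ! j}}"
      by simp
    also have "\<dots> = (\<Prod>j<?n. emeasure (excursion_law K e) {ws ! j})"
      by (rule emeasure_PiM_Collect) (auto simp: sets_excursion_law)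
    also have "\<dots> = (\<Prod>j<?n. ennreal (path_weight K (ws ! j @ [e])))"
      using exc len by (intro prod.cong refl emeasure_excursion_law[OF rec]) auto
    also have "\<dots> = ennreal (path_weight K (concat ws @ [e]))"
      using len by (simp add: path_weight_concat_excursions[OF exc] prod_ennreal)
    also have "\<dots> = emeasure (markov K e) (?C ws)"
    proof -
      have "hd (concat ws @ [e]) = e" using exc by (cases ws) (auto simp: excursions_def)
      then show ?thesis unfolding emeasure_markov_prefix by simp
    qed
    finally show ?thesis .
  qed
  have "emeasure (distr ?Q path_space concat_seq) {\<omega>. map \<omega> [0..<?n] = xs}
      = emeasure ?Q {W\<in>space ?Q. map (concat_seq W) [0..<?n] = xs}"
    by (subst emeasure_distr) (auto simp: vimage_def)
  also have "\<dots> = emeasure ?Q ((\<lambda>W. map W [0..<?n]) -` A \<inter> space ?Q)"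
  proof (rule emeasure_eq_AE)
    show "AE W in ?Q. W \<in> {W\<in>space ?Q. map (concat_seq W) [0..<?n] = xs} \<longleftrightarrow> W \<in> (\<lambda>W. map W [0..<?n]) -` A \<inter> space ?Q"
      using AE_excursion_space[OF rec]
    proof eventually_elim
      case (elim W)
      then have ne: "W j \<noteq> []" for j using Nil_notin_excursions[of e] by metis
      have "map (concat_seq W) [0..<?n] = take ?n (concat (map W [0..<?n]))"
        by (intro prefix_concat_seq concat_time_ge ne)
      then show ?case using elim by (auto simp: A_def)
    qed
    show "{W\<in>space ?Q. map (concat_seq W) [0..<?n] = xs} \<in> sets ?Q"
      using measurable_sets[OF measurable_concat_seq sets_prefix_cylinder[of ?n xs]]
      by (simp add: vimage_def sets_excursion_space)
  qed measurable
  also have "\<dots> = emeasure (distr ?Q (count_space UNIV) (\<lambda>W. map W [0..<?n])) A"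
    by (subst emeasure_distr) auto
  also have "\<dots> = (\<integral>\<^sup>+ws. emeasure (distr ?Q (count_space UNIV) (\<lambda>W. map W [0..<?n])) {ws} \<partial>count_space A)"
    by (rule emeasure_countable_singleton) auto
  also have "\<dots> = (\<integral>\<^sup>+ws. emeasure (markov K e) (?C ws) \<partial>count_space A)"
  proof (rule nn_integral_cong)
    fix ws assume "ws \<in> space (count_space A)"
    then have "ws \<in> A" by simp
    have "emeasure (distr ?Q (count_space UNIV) (\<lambda>W. map W [0..<?n])) {ws} = emeasure ?Q {W. map W [0..<?n] = ws}"
      by (subst emeasure_distr) (auto simp: vimage_def)
    with single[OF \<open>ws \<in> A\<close>]
    show "emeasure (distr ?Q (count_space UNIV) (\<lambda>W. map W [0..<?n])) {ws} = emeasure (markov K e) (?C ws)" by simp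
  qed
  also have "\<dots> = emeasure (markov K e) (\<Union>ws\<in>A. ?C ws)"
  proof (rule emeasure_UN_countable[symmetric])
    show "?C ws \<in> sets (markov K e)" for ws unfolding sets_markov by (rule sets_prefix_cylinder)
    show "disjoint_family_on ?C A"
    proof (unfold disjoint_family_on_def, intro ballI impI)
      fix ws ws' assume A: "ws \<in> A" "ws' \<in> A" "ws \<noteq> ws'"
      show "?C ws \<inter> ?C ws' = {}"
      proof (rule ccontr)
        assume "?C ws \<inter> ?C ws' \<noteq> {}"
        then obtain \<omega> where \<omega>: "map \<omega> [0..<length (concat ws @ [e])] = concat ws @ [e]"
          "map \<omega> [0..<length (concat ws' @ [e])] = concat ws' @ [e]" by blast
        obtain u v where "(concat ws @ [e]) @ u = (concat ws' @ [e]) @ v"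
          using prefix_append_exists[OF \<omega>] by blast
        then have "concat ws @ e # u = concat ws' @ e # v" by simp
        with A show False by (auto simp: A_def dest!: concat_excursions_unique[rotated 3])
      qed
    qed
  qed auto
  \<comment> \<open>Paths with fewer than \<open>?n\<close> returns lie outside the union, so only
    an inclusion is available here.\<close>
  also have "\<dots> \<le> emeasure (markov K e) {\<omega>. map \<omega> [0..<?n] = xs}"
  proof (rule emeasure_mono)
    show "(\<Union>ws\<in>A. ?C ws) \<subseteq> {\<omega>. map \<omega> [0..<?n] = xs}"
    proof safe
      fix ws \<omega> assume ws: "ws \<in> A" and \<omega>: "map \<omega> [0..<length (concat ws @ [e])] = concat ws @ [e]"
      have n: "?n \<le> length (concat ws)"
      proof -
        have "?n = length (take ?n (concat ws))" using ws by (simp add: A_def)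
        then show ?thesis by (metis length_take min.cobounded1)
      qed
      have "map \<omega> [0..<?n] = take ?n (map \<omega> [0..<length (concat ws @ [e])])"
        using n by (simp add: take_map del: upt_Suc length_concat)
      also have "\<dots> = xs" using ws n unfolding \<omega> by (simp add: A_def del: length_concat)
      finally show "map \<omega> [0..<?n] = xs" .
    qed
  qed (simp add: sets_markov sets_prefix_cylinder)
  finally show "emeasure (distr ?Q path_space concat_seq) {\<omega>. map \<omega> [0..<?n] = xs}
    \<le> emeasure (markov K e) {\<omega>. map \<omega> [0..<?n] = xs}" .
qed (auto simp: sets_markov prob_space_markov)

section \<open>A countable test for equidistribution\<close>

text \<open>Nonnegativity is part of the notion because sums of such functions will be bounded from
  below by dropping terms.\<close>

definition cylinder_function :: "('x::topological_space \<times> (nat \<Rightarrow> 'e::topological_space) \<Rightarrow> real) \<Rightarrow> bool" where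
  "cylinder_function f \<longleftrightarrow>
     continuous_on UNIV f \<and> bounded (range f) \<and> (\<forall>p. 0 \<le> f p) \<and>
     (\<exists>r. \<forall>x \<omega> \<omega>'. (\<forall>k<r. \<omega> k = \<omega>' k) \<longrightarrow> f (x, \<omega>) = f (x, \<omega>'))"

lemma cylinder_function_continuous: "cylinder_function f \<Longrightarrow> continuous_on UNIV f"
  by (simp add: cylinder_function_def)

lemma cylinder_function_nonneg: "cylinder_function f \<Longrightarrow> 0 \<le> f p"
  unfolding cylinder_function_def by blast

lemma cylinder_function_0: "cylinder_function (\<lambda>_. 0)"
  by (auto simp: cylinder_function_def)

lemma cylinder_function_max:
  assumes f: "cylinder_function f" and g: "cylinder_function g"
  shows "cylinder_function (\<lambda>p. max (f p) (g p))"
proof -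
  obtain r where r: "\<And>x \<omega> \<omega>'. (\<forall>k<r. \<omega> k = \<omega>' k) \<Longrightarrow> f (x, \<omega>) = f (x, \<omega>')"
    using f unfolding cylinder_function_def by blast
  obtain s where s: "\<And>x \<omega> \<omega>'. (\<forall>k<s. \<omega> k = \<omega>' k) \<Longrightarrow> g (x, \<omega>) = g (x, \<omega>')"
    using g unfolding cylinder_function_def by blast
  have "max (f (x, \<omega>)) (g (x, \<omega>)) = max (f (x, \<omega>')) (g (x, \<omega>'))" if "\<forall>k<max r s. \<omega> k = \<omega>' k" for x \<omega> \<omega>'
    using r[of \<omega> \<omega>' x] s[of \<omega> \<omega>' x] that by simp
  moreover have "bounded (range (\<lambda>p. max (f p) (g p)))"
  proof -
    obtain A B where A: "\<And>p. \<bar>f p\<bar> \<le> A" and B: "\<And>p. \<bar>g p\<bar> \<le> B"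
      using f g by (auto simp: cylinder_function_def bounded_iff)
    have "norm (max (f p) (g p)) \<le> max A B" for p
      using A[of p] B[of p] by (auto simp: max_def)
    then show ?thesis by (auto simp: bounded_iff)
  qed
  moreover have "continuous_on UNIV (\<lambda>p. max (f p) (g p))"
    by (intro continuous_on_max cylinder_function_continuous f g)
  moreover have "0 \<le> max (f p) (g p)" for p
    using cylinder_function_nonneg[OF f] by (simp add: le_max_iff_disj)
  ultimately show ?thesis
    unfolding cylinder_function_def by blast
qed

lemma open_contains_cylinder:
  fixes U :: "(nat \<Rightarrow> 'e::topological_space) set"
  assumes "open U" "\<omega> \<in> U"
  shows "\<exists>n. \<forall>\<omega>'. (\<forall>k<n. \<omega>' k = \<omega> k) \<longrightarrow> \<omega>' \<in> U"
proof -
  have "\<exists>X. \<omega> \<in> (\<Pi>\<^sub>E i\<in>UNIV. X i) \<and> (\<forall>i. openin euclidean (X i)) \<and> finite {i. X i \<noteq> topspace euclidean} \<and> (\<Pi>\<^sub>E i\<in>UNIV. X i) \<subseteq> U"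
    by (rule product_topology_open_contains_basis[OF assms(1)[unfolded open_fun_def] assms(2)])
  then obtain X where X: "\<omega> \<in> (\<Pi>\<^sub>E i\<in>UNIV. X i)" "finite {i. X i \<noteq> UNIV}" "(\<Pi>\<^sub>E i\<in>UNIV. X i) \<subseteq> U"
    by auto
  obtain n where n: "\<And>i. X i \<noteq> UNIV \<Longrightarrow> i < n"
    using finite_nat_bounded[OF X(2)] by auto
  have "\<omega>' \<in> U" if "\<forall>k<n. \<omega>' k = \<omega> k" for \<omega>'
  proof -
    have "\<omega>' i \<in> X i" for i
      using n[of i] that X(1) by (cases "X i = UNIV") (auto simp: PiE_iff)
    then show ?thesis using X(3) by auto
  qed
  then show ?thesis by blast
qed

lemma Urysohn_between:
  fixes V U :: "'x::topological_space set"
  assumes "metrizable_space (euclidean :: 'x topology)" "open U" "closure V \<subseteq> U"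
  shows "\<exists>h::'x \<Rightarrow> real. continuous_on UNIV h \<and> (\<forall>x. 0 \<le> h x \<and> h x \<le> 1) \<and> (\<forall>x\<in>V. h x = 1) \<and> (\<forall>x. x \<notin> U \<longrightarrow> h x = 0)"
proof -
  have "normal_space (euclidean :: 'x topology)" using assms(1) by (rule metrizable_imp_normal_space)
  moreover have "closedin euclidean (- U)" "closedin euclidean (closure V)" "disjnt (- U) (closure V)"
    using assms by (auto simp: disjnt_iff)
  ultimately have "\<exists>h::'x \<Rightarrow> real. continuous_map euclidean (top_of_set {0..1}) h \<and> h ` (- U) \<subseteq> {0} \<and> h ` closure V \<subseteq> {1}"
    unfolding normal_space_iff_Urysohn by (elim allE[where x="- U"] allE[where x="closure V"]) simp
  then obtain h :: "'x \<Rightarrow> real" where h: "continuous_map euclidean (top_of_set {0..1}) h"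
    "h ` (- U) \<subseteq> {0}" "h ` closure V \<subseteq> {1}"
    by blast
  have "continuous_on UNIV h" "\<forall>x. h x \<in> {0..1}"
    using h(1) by (auto simp: continuous_map_in_subtopology)
  moreover have "\<forall>x\<in>V. h x = 1" using h(3) closure_subset[of V] by blast
  moreover have "\<forall>x. x \<notin> U \<longrightarrow> h x = 0" using h(2) by blast
  ultimately show ?thesis by auto
qed

lemma metrizable_shrink:
  fixes U :: "'x::topological_space set"
  assumes "metrizable_space (euclidean :: 'x topology)" "open U" "x \<in> U"
  shows "\<exists>V. open V \<and> x \<in> V \<and> closure V \<subseteq> U"
proof -
  have "regular_space (euclidean :: 'x topology)" using assms(1) by (rule metrizable_imp_regular_space)
  moreover have "closedin euclidean (- U)" "x \<in> topspace euclidean - (- U)" using assms by auto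
  ultimately obtain V W where "openin euclidean V" "openin euclidean W" and VW: "x \<in> V" "- U \<subseteq> W" "disjnt V W"
    unfolding regular_space_def by meson
  then have VW': "open V" "open W" by (simp_all add: open_openin[symmetric])
  have "closure V \<subseteq> - W" using VW VW' by (intro closure_minimal) (auto simp: disjnt_iff)
  with VW VW' show ?thesis by blast
qed

text \<open>The functions are products of a nonnegative rational q, a Urysohn function between two
  basic open sets, and the indicator of a cylinder, which is continuous because the letters are
  discrete. If c < f p, take q between c and f p: f exceeds q on a product neighbourhood of p, and
  some function of the family equals q at p and vanishes outside that neighbourhood.\<close>

lemma cylinder_functions_below:
  assumes metr: "metrizable_space (euclidean :: 'x::second_countable_topology topology)"
  obtains D :: "('x::second_countable_topology \<times> (nat \<Rightarrow> 'e::countable_discrete) \<Rightarrow> real) set"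
  where "countable D" "\<And>u. u \<in> D \<Longrightarrow> cylinder_function u"
    "\<And>f p c. continuous_on UNIV f \<Longrightarrow> (\<And>q. 0 \<le> f q) \<Longrightarrow> 0 \<le> c \<Longrightarrow> c < f p \<Longrightarrow>
       \<exists>u\<in>D. (\<forall>q. u q \<le> f q) \<and> c < u p"
proof -
  obtain B :: "'x set set" where B: "countable B" "topological_basis B"
    using ex_countable_basis by blast
  define S where "S = {(V, U). V \<in> B \<and> U \<in> B \<and> closure V \<subseteq> U}"
  have "S \<subseteq> B \<times> B" by (auto simp: S_def)
  then have S: "countable S" using B(1) by (meson countable_SIGMA countable_subset)
  have "\<forall>s\<in>S. \<exists>h::'x \<Rightarrow> real. continuous_on UNIV h \<and> (\<forall>x. 0 \<le> h x \<and> h x \<le> 1) \<and> (\<forall>x\<in>fst s. h x = 1) \<and> (\<forall>x. x \<notin> snd s \<longrightarrow> h x = 0)"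
    using Urysohn_between[OF metr] topological_basis_open[OF B(2)] by (auto simp: S_def)
  then obtain h :: "'x set \<times> 'x set \<Rightarrow> 'x \<Rightarrow> real" where h:
    "\<And>s. s \<in> S \<Longrightarrow> continuous_on UNIV (h s) \<and> (\<forall>x. 0 \<le> h s x \<and> h s x \<le> 1) \<and> (\<forall>x\<in>fst s. h s x = 1) \<and> (\<forall>x. x \<notin> snd s \<longrightarrow> h s x = 0)"
    by metis
  define cyl :: "'e list \<Rightarrow> (nat \<Rightarrow> 'e) \<Rightarrow> real" where
    "cyl xs \<omega> = (\<Prod>i<length xs. of_bool (\<omega> i = xs ! i))" for xs \<omega>
  have cyl_eq: "cyl xs \<omega> = of_bool (\<forall>i<length xs. \<omega> i = xs ! i)" for xs \<omega>
  proof (cases "\<forall>i<length xs. \<omega> i = xs ! i")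
    case False
    then obtain i where "i < length xs" "\<omega> i \<noteq> xs ! i" by blast
    then have "cyl xs \<omega> = 0" unfolding cyl_def by (intro prod_zero) auto
    with False show ?thesis by simp
  qed (simp add: cyl_def)
  have cyl_cont: "continuous_on UNIV (cyl xs)" for xs
    unfolding cyl_def
  proof (intro continuous_on_prod)
    fix i
    have "continuous_on UNIV ((\<lambda>a. of_bool (a = xs ! i) :: real) \<circ> (\<lambda>\<omega>. \<omega> i))"
      by (rule continuous_on_compose[OF continuous_on_product_coordinates]) (rule Topological_Spaces.continuous_on_discrete)
    then show "continuous_on UNIV (\<lambda>\<omega>. of_bool (\<omega> i = xs ! i) :: real)" by (simp add: o_def)
  qed
  define u where "u = (\<lambda>(s, xs, q) p. real_of_rat q * h s (fst p) * cyl xs (snd p))"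
  define D where "D = u ` (S \<times> UNIV \<times> {q. 0 \<le> q})"
  show thesis
  proof (rule that)
    show "countable D" unfolding D_def using S by (intro countable_image countable_SIGMA) auto
    show "cylinder_function v" if "v \<in> D" for v
    proof -
      from that obtain s xs q where v: "v = u (s, xs, q)" and s: "s \<in> S" and q: "0 \<le> q"
        by (auto simp: D_def)
      note hs = h[OF s]
      have "continuous_on UNIV v"
      proof -
        have "continuous_on UNIV (\<lambda>p::'x \<times> (nat \<Rightarrow> 'e). h s (fst p))"
          by (rule continuous_on_compose2[OF conjunct1[OF hs]]) (auto intro!: continuous_intros)
        moreover have "continuous_on UNIV (\<lambda>p::'x \<times> (nat \<Rightarrow> 'e). cyl xs (snd p))"
          by (rule continuous_on_compose2[OF cyl_cont continuous_on_snd[OF continuous_on_id]]) auto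
        ultimately show ?thesis unfolding v u_def prod.case by (intro continuous_on_mult continuous_on_const)
      qed
      moreover have "bounded (range v)"
      proof -
        have "\<bar>v p\<bar> \<le> real_of_rat q" for p
          using hs q mult_left_le[of "h s (fst p)" "real_of_rat q"] by (auto simp: v u_def cyl_eq abs_mult)
        then show ?thesis by (auto simp: bounded_iff)
      qed
      moreover have "\<forall>p. 0 \<le> v p" using hs q by (auto simp: v u_def cyl_eq)
      moreover have "v (x, \<omega>) = v (x, \<omega>')" if "\<forall>k<length xs. \<omega> k = \<omega>' k" for x \<omega> \<omega>'
        using that by (auto simp: v u_def cyl_def)
      ultimately show ?thesis unfolding cylinder_function_def by blast
    qed
    fix f :: "'x \<times> (nat \<Rightarrow> 'e) \<Rightarrow> real" and p c
    assume f: "continuous_on UNIV f" "\<And>q. 0 \<le> f q" and c: "0 \<le> c" "c < f p"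
    obtain q where q: "c < real_of_rat q" "real_of_rat q < f p" using of_rat_dense[OF c(2)] by blast
    obtain x \<omega> where p: "p = (x, \<omega>)" by force
    have "open {p. real_of_rat q < f p}" using f(1) by (rule open_Collect_less[OF continuous_on_const])
    moreover have "p \<in> {p. real_of_rat q < f p}" using q by simp
    ultimately obtain U0 O0 where UO: "open U0" "open O0" "p \<in> U0 \<times> O0" "U0 \<times> O0 \<subseteq> {p. real_of_rat q < f p}"
      by (rule open_prod_elim)
    obtain n where n: "\<And>\<omega>'. (\<forall>k<n. \<omega>' k = \<omega> k) \<Longrightarrow> \<omega>' \<in> O0"
      using open_contains_cylinder[OF UO(2), of \<omega>] UO(3) p by auto
    obtain U where U: "U \<in> B" "x \<in> U" "U \<subseteq> U0"
      using topological_basisE[OF B(2) UO(1), of x] UO(3) p by auto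
    \<comment> \<open>Regularity yields an open set whose closure stays in \<open>U\<close>; a basic
      set inside it puts the pair into the countable family \<open>S\<close>.\<close>
    obtain V0 where V0: "open V0" "x \<in> V0" "closure V0 \<subseteq> U"
      using metrizable_shrink[OF metr topological_basis_open[OF B(2) U(1)] U(2)] by blast
    obtain V where V: "V \<in> B" "x \<in> V" "V \<subseteq> V0"
      using topological_basisE[OF B(2) V0(1,2)] by auto
    have s: "(V, U) \<in> S" using U V V0 closure_mono[OF V(3)] by (auto simp: S_def)
    note hs = h[OF s]
    define xs where "xs = map \<omega> [0..<n]"
    have q0: "0 \<le> real_of_rat q" using q(1) c(1) by linarith
    have "u ((V, U), xs, q) z \<le> f z" for z
    proof (cases "fst z \<in> U \<and> (\<forall>i<n. snd z i = \<omega> i)")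
      case True
      then have "z \<in> U0 \<times> O0" using U(3) n[of "snd z"] by (auto simp: mem_Times_iff)
      then have "real_of_rat q < f z" using UO(4) by auto
      moreover have "u ((V, U), xs, q) z \<le> real_of_rat q"
        using hs q0 mult_left_le[of "h (V, U) (fst z)" "real_of_rat q"] by (auto simp: u_def cyl_eq)
      ultimately show ?thesis by simp
    next
      case False
      then have "u ((V, U), xs, q) z = 0" using hs by (auto simp: u_def cyl_eq xs_def)
      then show ?thesis using f(2) by simp
    qed
    moreover have "u ((V, U), xs, q) p = real_of_rat q"
      using hs V(2) by (simp add: u_def p cyl_eq xs_def)
    moreover have "u ((V, U), xs, q) \<in> D" using s q0 by (force simp: D_def)
    ultimately show "\<exists>u\<in>D. (\<forall>q. u q \<le> f q) \<and> c < u p" using q by (metis (no_types))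
  qed
qed

section \<open>Finite maxima and the reduction to countably many functions\<close>

definition max_list_fun :: "('p \<Rightarrow> real) list \<Rightarrow> 'p \<Rightarrow> real" where
  "max_list_fun us p = foldr (\<lambda>u. max (u p)) us 0"

lemma max_list_fun_simps [simp]:
  "max_list_fun [] p = 0" "max_list_fun (u # us) p = max (u p) (max_list_fun us p)"
  by (simp_all add: max_list_fun_def)

lemma max_list_fun_ge: "u \<in> set us \<Longrightarrow> u p \<le> max_list_fun us p"
  by (induction us) (auto simp: le_max_iff_disj)

lemma max_list_fun_le: "(\<And>u. u \<in> set us \<Longrightarrow> u p \<le> c) \<Longrightarrow> 0 \<le> c \<Longrightarrow> max_list_fun us p \<le> c"
  by (induction us) auto

lemma cylinder_function_max_list:
  "(\<And>u. u \<in> set us \<Longrightarrow> cylinder_function u) \<Longrightarrow> cylinder_function (max_list_fun us)"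
proof (induction us)
  case Nil
  then show ?case using cylinder_function_0 by (simp add: max_list_fun_def[abs_def])
next
  case (Cons u us)
  then show ?case using cylinder_function_max[of u "max_list_fun us"] by (simp add: max_list_fun_def[abs_def])
qed

text \<open>\<open>D\<close> depends neither on the sequence nor on the measure, so that one null
  set will serve all test functions. It has to contain finite maxima, because lower bounds for the
  averages of two functions do not bound those of their maximum by the integral of the
  maximum.\<close>

lemma countable_equidistribution_test:
  assumes metr: "metrizable_space (euclidean :: 'x::second_countable_topology topology)"
  obtains D :: "('x::second_countable_topology \<times> (nat \<Rightarrow> 'e::countable_discrete) \<Rightarrow> real) set"
  where "countable D" "\<And>u. u \<in> D \<Longrightarrow> cylinder_function u"
    "\<And>y \<nu>. prob_space \<nu> \<Longrightarrow> sets \<nu> = sets borel \<Longrightarrow>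
       (\<And>u b. u \<in> D \<Longrightarrow> b < (\<integral>p. u p \<partial>\<nu>) \<Longrightarrow> \<forall>\<^sub>F n in sequentially. b < (\<Sum>k<n. u (y k)) / real n) \<Longrightarrow>
       equidistributes y \<nu>"
proof -
  obtain D0 :: "('x \<times> (nat \<Rightarrow> 'e) \<Rightarrow> real) set" where D0: "countable D0" "\<And>u. u \<in> D0 \<Longrightarrow> cylinder_function u"
    "\<And>f p c. continuous_on UNIV f \<Longrightarrow> (\<And>q. 0 \<le> f q) \<Longrightarrow> 0 \<le> c \<Longrightarrow> c < f p \<Longrightarrow>
       \<exists>u\<in>D0. (\<forall>q. u q \<le> f q) \<and> c < u p"
    using cylinder_functions_below[OF metr] by metis
  define D where "D = max_list_fun ` lists (insert (\<lambda>_. 0) D0)"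
  show thesis
  proof (rule that)
    show "countable D" unfolding D_def using D0(1) by (intro countable_image countable_lists) auto
    show D_cyl: "cylinder_function u" if "u \<in> D" for u
      using that D0(2) cylinder_function_0 by (auto simp: D_def intro!: cylinder_function_max_list)
    fix y :: "nat \<Rightarrow> 'x \<times> (nat \<Rightarrow> 'e)" and \<nu> :: "('x \<times> (nat \<Rightarrow> 'e)) measure"
    assume \<nu>: "prob_space \<nu>" and sets[measurable_cong]: "sets \<nu> = sets borel"
      and liminf: "\<And>u b. u \<in> D \<Longrightarrow> b < (\<integral>p. u p \<partial>\<nu>) \<Longrightarrow> \<forall>\<^sub>F n in sequentially. b < (\<Sum>k<n. u (y k)) / real n"
    interpret prob_space \<nu> by fact
    have cont_meas: "f \<in> borel_measurable \<nu>" if "continuous_on UNIV f" for f :: "'x \<times> (nat \<Rightarrow> 'e) \<Rightarrow> real"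
      using borel_measurable_continuous_onI[OF that] by (simp add: measurable_cong_sets[OF sets refl])
    have key: "\<forall>\<^sub>F n in sequentially. b < (\<Sum>k<n. f (y k)) / real n"
      if f: "continuous_on UNIV f" "\<And>p. 0 \<le> f p" "\<And>p. f p \<le> B" and b: "b < (\<integral>p. f p \<partial>\<nu>)"
      for f :: "'x \<times> (nat \<Rightarrow> 'e) \<Rightarrow> real" and B b
    proof -
      \<comment> \<open>The zero function keeps \<open>E\<close> nonempty, as the enumeration by
        \<open>from_nat_into\<close> requires.\<close>
      define E where "E = {u \<in> insert (\<lambda>_. 0) D0. \<forall>q. u q \<le> f q}"
      have E: "countable E" unfolding E_def using D0(1) by (intro countable_subset[OF Collect_subset]) auto
      have E_ne: "E \<noteq> {}" using f(2) by (auto simp: E_def)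
      define F where "F n = max_list_fun (map (from_nat_into E) [0..<n])" for n
      have in_E: "from_nat_into E k \<in> E" for k using E_ne by (rule from_nat_into)
      have F_D: "F n \<in> D" for n
      proof -
        have "from_nat_into E k \<in> insert (\<lambda>_. 0) D0" for k using in_E[of k] by (simp add: E_def)
        then have "map (from_nat_into E) [0..<n] \<in> lists (insert (\<lambda>_. 0) D0)" by (simp add: lists_eq_set image_subset_iff)
        then show ?thesis unfolding F_def D_def by (rule imageI)
      qed
      have F_le: "F n p \<le> f p" for n p
        unfolding F_def
      proof (rule max_list_fun_le)
        fix u assume "u \<in> set (map (from_nat_into E) [0..<n])"
        then obtain k where "u = from_nat_into E k" by auto
        then have "u \<in> E" using in_E by simp
        then show "u p \<le> f p" by (simp add: E_def del: split_paired_All)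
      qed (rule f(2))
      have F_cyl: "cylinder_function (F n)" for n
        by (rule D_cyl[OF F_D])
      have F_nonneg: "0 \<le> F n p" for n p by (rule cylinder_function_nonneg[OF F_cyl])
      have F_lim: "(\<lambda>n. F n p) \<longlonglongrightarrow> f p" for p
      proof (rule order_tendstoI)
        fix c assume c: "c < f p"
        show "\<forall>\<^sub>F n in sequentially. c < F n p"
        proof (cases "0 \<le> c")
          case True
          obtain u where u: "u \<in> D0" "\<forall>q. u q \<le> f q" "c < u p"
            using D0(3)[OF f(1,2) True c] by blast
          then have "u \<in> E" by (simp add: E_def)
          then obtain k where k: "from_nat_into E k = u" using E from_nat_into_surj by metis
          show ?thesis
            using eventually_gt_at_top[of k]
          proof eventually_elim
            case (elim n)
            have "u \<in> set (map (from_nat_into E) [0..<n])" using elim k by force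
            then have "u p \<le> F n p" unfolding F_def by (rule max_list_fun_ge)
            with u(3) show ?case by linarith
          qed
        next
          case False
          then have "c < F n p" for n using F_nonneg[of n p] by linarith
          then show ?thesis by simp
        qed
      next
        fix c assume "f p < c"
        then have "F n p < c" for n using F_le[of n p] by linarith
        then show "\<forall>\<^sub>F n in sequentially. F n p < c" by simp
      qed
      have "(\<lambda>n. \<integral>p. F n p \<partial>\<nu>) \<longlonglongrightarrow> (\<integral>p. f p \<partial>\<nu>)"
      proof (rule integral_dominated_convergence[where w="\<lambda>_. B"])
        show "F n \<in> borel_measurable \<nu>" for n
          by (intro cont_meas cylinder_function_continuous F_cyl)
        show "AE p in \<nu>. norm (F n p) \<le> B" for n
        proof (rule AE_I2)
          show "norm (F n p) \<le> B" for p using F_nonneg[of n p] F_le[of n p] f(3)[of p] by simp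
        qed
      qed (use f F_lim in \<open>auto intro: cont_meas\<close>)
      then have "\<forall>\<^sub>F n in sequentially. b < (\<integral>p. F n p \<partial>\<nu>)" using b by (rule order_tendstoD)
      then obtain n where "b < (\<integral>p. F n p \<partial>\<nu>)" using eventually_happens'[OF sequentially_bot] by blast
      from liminf[OF F_D this] show ?thesis
      proof eventually_elim
        case (elim N)
        have "(\<Sum>k<N. F n (y k)) / real N \<le> (\<Sum>k<N. f (y k)) / real N"
          by (intro divide_right_mono sum_mono F_le) auto
        with elim show ?case by simp
      qed
    qed
    show "equidistributes y \<nu>"
      unfolding equidistributes_def
    proof (intro allI impI)
      fix f :: "'x \<times> (nat \<Rightarrow> 'e) \<Rightarrow> real"
      assume "continuous_on UNIV f \<and> bounded (range f)"
      then obtain B where f: "continuous_on UNIV f" and B: "\<And>p. \<bar>f p\<bar> \<le> B"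
        by (auto simp: bounded_iff)
      have int: "integrable \<nu> f"
        using B by (intro integrable_const_bound[of _ B]) (auto intro: cont_meas f)
      show "(\<lambda>n. (\<Sum>k<n. f (y k)) / real n) \<longlonglongrightarrow> (\<integral>p. f p \<partial>\<nu>)"
      proof (rule order_tendstoI)
        fix b assume b: "b < (\<integral>p. f p \<partial>\<nu>)"
        have "\<forall>\<^sub>F n in sequentially. b + B < (\<Sum>k<n. f (y k) + B) / real n"
        proof (rule key[of "\<lambda>p. f p + B" "2 * B"])
          show "b + B < (\<integral>p. f p + B \<partial>\<nu>)" using b int by (simp add: prob_space)
          show "0 \<le> f p + B" "f p + B \<le> 2 * B" for p using B[of p] by linarith+
        qed (intro continuous_intros f)
        then show "\<forall>\<^sub>F n in sequentially. b < (\<Sum>k<n. f (y k)) / real n"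
          using eventually_gt_at_top[of 0]
          by eventually_elim (simp add: sum.distrib field_simps)
      next
        fix b assume b: "(\<integral>p. f p \<partial>\<nu>) < b"
        have "\<forall>\<^sub>F n in sequentially. B - b < (\<Sum>k<n. B - f (y k)) / real n"
        proof (rule key[of "\<lambda>p. B - f p" "2 * B"])
          show "B - b < (\<integral>p. B - f p \<partial>\<nu>)" using b int by (simp add: prob_space)
          show "0 \<le> B - f p" "B - f p \<le> 2 * B" for p using B[of p] by linarith+
        qed (intro continuous_intros f)
        then show "\<forall>\<^sub>F n in sequentially. (\<Sum>k<n. f (y k)) / real n < b"
          using eventually_gt_at_top[of 0]
          by eventually_elim (simp add: sum_subtractf field_simps)
      qed
    qed
  qed
qed

section \<open>The walk along excursions\<close>

lemma sets_borel_path_space: "sets (borel :: (nat \<Rightarrow> 'e::countable_discrete) measure) = sets path_space"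
proof -
  have "sets (borel :: 'e measure) = UNIV"
    using borel_open[OF discrete_topology_class.open_discrete] by auto
  then have "sets (borel :: 'e measure) = sets (count_space UNIV)" by simp
  then have "sets (PiM UNIV (\<lambda>_::nat. borel :: 'e measure)) = sets path_space"
    by (intro sets_PiM_cong) auto
  then show ?thesis by (simp add: sets_PiM_equal_borel)
qed

lemma continuous_on_integral_bounded:
  fixes F :: "'x::first_countable_topology \<Rightarrow> 'w \<Rightarrow> real"
  assumes M: "finite_measure M" and meas: "\<And>x. F x \<in> borel_measurable M"
    and cont: "\<And>w. continuous_on UNIV (\<lambda>x. F x w)" and bound: "\<And>x w. \<bar>F x w\<bar> \<le> B"
  shows "continuous_on UNIV (\<lambda>x. \<integral>w. F x w \<partial>M)"
  unfolding continuous_on_def tendsto_at_iff_sequentially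
proof (intro ballI allI impI)
  fix x and X :: "nat \<Rightarrow> 'x" assume X: "X \<longlonglongrightarrow> x"
  interpret finite_measure M by fact
  show "((\<lambda>x. \<integral>w. F x w \<partial>M) \<circ> X) \<longlonglongrightarrow> (\<integral>w. F x w \<partial>M)"
    unfolding o_def
  proof (rule integral_dominated_convergence[where w="\<lambda>_. B"])
    show "AE w in M. (\<lambda>n. F (X n) w) \<longlonglongrightarrow> F x w"
    proof (rule AE_I2)
      fix w
      show "(\<lambda>n. F (X n) w) \<longlonglongrightarrow> F x w"
        using continuous_on_tendsto_compose[OF cont[of w] X] by simp
    qed
  qed (use meas bound in auto)
qed

text \<open>For large \<open>N\<close> let \<open>n\<close> be the last index with t n \<le> N, so
  that N < t (n + 1). The sum up to \<open>N\<close> is at least S n, which is about c n, while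
  \<open>N\<close> is asymptotically at most \<theta> (n + 1). Hence the average is asymptotically
  at least c / \<theta>.\<close>

lemma liminf_average_along_blocks:
  fixes a S :: "nat \<Rightarrow> real" and t :: "nat \<Rightarrow> nat"
  assumes a: "\<And>k. 0 \<le> a k" and t_ge: "\<And>n. n \<le> t n"
    and S_le: "\<And>n. S n \<le> (\<Sum>k<t n. a k)" and S_lim: "(\<lambda>n. S n / real n) \<longlonglongrightarrow> c"
    and t_le: "\<And>\<theta>'. \<theta> < \<theta>' \<Longrightarrow> \<forall>\<^sub>F n in sequentially. real (t n) \<le> \<theta>' * real n"
    and \<theta>: "0 < \<theta>" and b: "b < c / \<theta>"
  shows "\<forall>\<^sub>F N in sequentially. b < (\<Sum>k<N. a k) / real N"
proof (cases "b < 0")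
  case True
  have "b < (\<Sum>k<N. a k) / real N" for N
    by (rule less_le_trans[OF True]) (intro divide_nonneg_nonneg sum_nonneg a, simp)
  then show ?thesis by simp
next
  case False
  have bc: "b * \<theta> < c" using b \<theta> by (simp add: pos_less_divide_eq)
  define d where "d = c - b * \<theta>"
  have d: "0 < d" using bc by (simp add: d_def)
  \<comment> \<open>Chosen so that \<open>b * \<theta>' < c\<close>; the denominator with
    \<open>b + 1\<close> instead of \<open>b\<close> covers \<open>b = 0\<close>.\<close>
  define \<theta>' where "\<theta>' = \<theta> + d / (2 * (b + 1))"
  have \<theta>': "\<theta> < \<theta>'" using d False by (simp add: \<theta>'_def)
  have "b * (d / (2 * (b + 1))) = b / (b + 1) * (d / 2)" by simp
  also have "\<dots> \<le> 1 * (d / 2)" using d False by (intro mult_right_mono) auto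
  also have "\<dots> < d" using d by simp
  finally have b\<theta>': "b * \<theta>' < c" unfolding \<theta>'_def distrib_left d_def by linarith
  obtain c' where c': "b * \<theta>' < c'" "c' < c" using dense[OF b\<theta>'] by blast
  have "\<forall>\<^sub>F n in sequentially. c' * real n \<le> S n"
    using order_tendstoD(1)[OF S_lim c'(2)] eventually_gt_at_top[of 0]
    by eventually_elim (simp add: field_simps)
  \<comment> \<open>The threshold solves \<open>b * \<theta>' * (n + 1) = c' * n\<close>: beyond it,
    the step from \<open>n\<close> to \<open>Suc n\<close> in the bound for \<open>N\<close> does no
    harm.\<close>
  moreover have "\<forall>\<^sub>F n in sequentially. b * \<theta>' / (c' - b * \<theta>') < real n"
    using filterlim_real_sequentially eventually_gt_at_top filterlim_at_top_dense by blast
  ultimately have "\<forall>\<^sub>F n in sequentially. c' * real n \<le> S n \<and> real (t n) \<le> \<theta>' * real n \<and> b * \<theta>' / (c' - b * \<theta>') < real n"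
    using t_le[OF \<theta>'] by eventually_elim simp
  then obtain n1 where n1: "\<And>n. n1 \<le> n \<Longrightarrow> c' * real n \<le> S n \<and> real (t n) \<le> \<theta>' * real n \<and> b * \<theta>' / (c' - b * \<theta>') < real n"
    unfolding eventually_sequentially by blast
  show ?thesis
    using eventually_ge_at_top[of "max 1 (t n1)"]
  proof eventually_elim
    case (elim N)
    have fin: "finite {n. t n \<le> N}"
      by (rule finite_subset[of _ "{..N}"]) (auto intro: le_trans[OF t_ge])
    define n where "n = Max {n. t n \<le> N}"
    have mem: "n1 \<in> {n. t n \<le> N}" using elim by simp
    have n: "n1 \<le> n" "t n \<le> N"
      using Max_ge[OF fin mem] Max_in[OF fin] mem by (auto simp: n_def)
    have N: "N < t (Suc n)"
    proof (rule ccontr)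
      assume "\<not> N < t (Suc n)"
      then have "Suc n \<le> n" using Max_ge[OF fin, of "Suc n"] by (simp add: n_def)
      then show False by simp
    qed
    have "b * \<theta>' / (c' - b * \<theta>') < real n" using n1[OF n(1)] by blast
    then have "b * \<theta>' < real n * (c' - b * \<theta>')"
      by (subst (asm) pos_divide_less_eq) (use c' in auto)
    then have "b * (\<theta>' * real (Suc n)) < c' * real n" by (simp add: algebra_simps)
    moreover have "b * real N \<le> b * (\<theta>' * real (Suc n))"
      using n1[of "Suc n"] n(1) N False by (intro mult_left_mono) linarith+
    moreover have "c' * real n \<le> (\<Sum>k<N. a k)"
    proof -
      have "c' * real n \<le> (\<Sum>k<t n. a k)" using n1[OF n(1)] S_le[of n] by linarith
      also have "\<dots> \<le> (\<Sum>k<N. a k)" using n(2) by (intro sum_mono2) (auto simp: a)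
      finally show ?thesis .
    qed
    ultimately have "b * real N < (\<Sum>k<N. a k)" by linarith
    then show ?case using elim by (simp add: field_simps)
  qed
qed

lemma prefix_word_eq_rev: "prefix_word \<omega> n = rev (map \<omega> [0..<n])"
  by (simp add: prefix_word_def rev_map)

lemma word_prod_append: "word_prod g (u @ v) = word_prod g u * word_prod g v"
  by (simp add: word_prod_def)

lemma admissible_rev_take:
  assumes "w \<in> excursions e" "0 < path_weight K (take i w)" "0 < i"
  shows "admissible K (rev (take i w))" "starts_with (rev (take i w)) e"
proof -
  have "take i w \<noteq> []" using assms(1,3) by (auto simp: excursions_def)
  moreover have "take i w ! 0 = e" using assms(1,3) by (auto simp: excursions_def)
  ultimately show "starts_with (rev (take i w)) e" by (simp add: starts_with_def)
  have "0 < pmf (K (take i w ! (k - 1))) (take i w ! k)" if "1 \<le> k" "k < length (take i w)" for k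
    using trans_prob_pos_if_path_weight_pos[OF assms(2), of "k - 1"] that by simp
  with \<open>take i w \<noteq> []\<close> show "admissible K (rev (take i w))"
    by (auto simp: admissible_def trans_prob_def simp del: nth_take length_take)
qed

text \<open>The second word begins with \<open>e\<close>, so the concatenated path first returns
  exactly at time \<open>length (W 0)\<close>.\<close>

lemma concat_seq_avoids_iff:
  assumes W: "\<And>j. W j \<in> excursions e"
  shows "concat_seq W \<in> avoids e i \<longleftrightarrow> i < length (W 0)"
proof -
  have ne: "W j \<noteq> []" for j using W[of j] Nil_notin_excursions[of e] by metis
  obtain ys where ys: "W 0 = e # ys" "e \<notin> set ys" using W[of 0] by (auto simp: excursions_def)
  have inside: "concat_seq W k = W 0 ! k" if "k < length (W 0)" for k
    using concat_seq_nth[of W k 1] ne that by (simp add: concat_time_def)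
  have at_return: "concat_seq W (length (W 0)) = e"
    using concat_seq_shift[of W 1 0] ne W[of 1] by (auto simp: concat_time_def concat_seq_def excursions_def)
  show ?thesis
  proof
    assume *: "concat_seq W \<in> avoids e i"
    show "i < length (W 0)"
    proof (rule ccontr)
      assume "\<not> i < length (W 0)"
      then have "length (W 0) \<in> {1..i}" using ys by simp
      then show False using * at_return by (auto simp: avoids_def)
    qed
  next
    assume i: "i < length (W 0)"
    show "concat_seq W \<in> avoids e i"
      unfolding avoids_def
    proof (intro CollectI ballI)
      fix k assume k: "k \<in> {1..i}"
      then have "concat_seq W k = ys ! (k - 1)" "k - 1 < length ys"
        using inside[of k] i ys(1) by (auto simp: nth_Cons')
      then show "concat_seq W k \<noteq> e" using ys(2) nth_mem by metis
    qed
  qed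
qed

section \<open>Orbits split at the returns\<close>

locale excursion_walk =
  fixes act :: "'g::{group_mult, topological_space} \<Rightarrow> 'x::second_countable_topology \<Rightarrow> 'x"
    and g :: "'e::countable_discrete \<Rightarrow> 'g" and K :: "'e \<Rightarrow> 'e pmf" and e :: 'e
  assumes action: "continuous_action act"
    and recurrent: "AE \<omega> in markov K e. return_time e \<omega> < \<infinity>"
begin

sublocale sequence_space "excursion_law K e"
  by (rule sequence_space_excursion_law)

lemma act_mult: "act (a * b) x = act a (act b x)"
  using action by (simp add: continuous_action_def)

lemma continuous_act: "continuous_on UNIV (act a)"
proof -
  have "continuous_on UNIV (\<lambda>x. (\<lambda>(a, x). act a x) (a, x))"
    by (rule continuous_on_compose2[where t=UNIV and g="\<lambda>(a, x). act a x"])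
       (use action in \<open>auto simp: continuous_action_def intro!: continuous_intros\<close>)
  then show ?thesis by simp
qed

lemma measurable_act [measurable]: "act a \<in> borel \<rightarrow>\<^sub>M borel"
  by (rule borel_measurable_continuous_onI[OF continuous_act])

definition orbit :: "'x \<Rightarrow> (nat \<Rightarrow> 'e) \<Rightarrow> nat \<Rightarrow> 'x \<times> (nat \<Rightarrow> 'e)" where
  "orbit x \<omega> n = (act (word_prod g (prefix_word \<omega> n)) x, (shift_map ^^ n) \<omega>)"

definition endpoint :: "'x \<Rightarrow> (nat \<Rightarrow> 'e list) \<Rightarrow> nat \<Rightarrow> 'x" where
  "endpoint x W n = act (word_prod g (rev (concat (map W [0..<n])))) x"

text \<open>With the length of the excursion as a condition, the range of summation is fixed, which
  gives the bound \<open>L * B\<close>. All of \<open>W\<close> enters and not only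
  \<open>W 0\<close>, since \<open>f\<close> may read letters of later excursions.\<close>

definition excursion_sum ::
    "('x \<times> (nat \<Rightarrow> 'e) \<Rightarrow> real) \<Rightarrow> nat \<Rightarrow> 'x \<Rightarrow> (nat \<Rightarrow> 'e list) \<Rightarrow> real" where
  "excursion_sum f L x W = (\<Sum>i<L. if i < length (W 0)
     then f (act (word_prod g (rev (take i (W 0)))) x, (shift_map ^^ i) (concat_seq W)) else 0)"

lemma orbit_concat_seq:
  assumes W: "\<And>j. W j \<noteq> []" and i: "i \<le> length (W n)"
  shows "orbit x (concat_seq W) (concat_time W n + i) =
    (act (word_prod g (rev (take i (W n)))) (endpoint x W n), (shift_map ^^ i) (concat_seq (\<lambda>k. W (n + k))))"
proof -
  have "map (concat_seq W) [0..<concat_time W n + i] = take (concat_time W n + i) (concat (map W [0..<Suc n]))"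
    using i by (intro prefix_concat_seq W) (simp add: concat_time_def)
  also have "\<dots> = concat (map W [0..<n]) @ take i (W n)"
    by (simp add: length_concat_map_upt del: length_concat)
  finally have "prefix_word (concat_seq W) (concat_time W n + i) = rev (take i (W n)) @ rev (concat (map W [0..<n]))"
    by (simp add: prefix_word_eq_rev)
  moreover have "(shift_map ^^ (concat_time W n + i)) (concat_seq W) = (shift_map ^^ i) (concat_seq (\<lambda>k. W (n + k)))"
    using concat_seq_shift[of W n] W by (simp add: shift_map_funpow add.assoc)
  ultimately show ?thesis by (simp add: orbit_def endpoint_def word_prod_append act_mult)
qed

text \<open>Each excursion loses its steps from \<open>L\<close> on, all of them nonnegative
  terms.\<close>

lemma excursion_sums_le_orbit_sum:
  assumes W: "\<And>j. W j \<noteq> []" and f: "\<And>p. 0 \<le> f p"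
  shows "(\<Sum>j<n. excursion_sum f L (endpoint x W j) (\<lambda>k. W (j + k)))
    \<le> (\<Sum>k<concat_time W n. f (orbit x (concat_seq W) k))"
proof (induction n)
  case (Suc n)
  let ?a = "\<lambda>k. f (orbit x (concat_seq W) k)" and ?t = "concat_time W n" and ?l = "length (W n)"
  have "excursion_sum f L (endpoint x W n) (\<lambda>k. W (n + k)) = (\<Sum>i<L. if i < ?l then ?a (?t + i) else 0)"
    unfolding excursion_sum_def by (intro sum.cong) (auto simp: orbit_concat_seq[OF W])
  also have "\<dots> = (\<Sum>i\<in>{i\<in>{..<L}. i < ?l}. ?a (?t + i))"
    by (subst sum.inter_filter) auto
  also have "\<dots> \<le> (\<Sum>i<?l. ?a (?t + i))"
    by (intro sum_mono2) (auto simp: f)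
  finally have step: "excursion_sum f L (endpoint x W n) (\<lambda>k. W (n + k)) \<le> (\<Sum>i<?l. ?a (?t + i))" .
  have "(\<Sum>k<concat_time W (Suc n). ?a k) = (\<Sum>k<?t + ?l. ?a k)"
    by (simp add: concat_time_def)
  also have "\<dots> = (\<Sum>k<?t. ?a k) + (\<Sum>i<?l. ?a (?t + i))"
    by (induction ("length (W n)")) (auto simp: algebra_simps)
  finally show ?case using Suc step by simp
qed (simp add: concat_time_def)

lemma measurable_borel_path [measurable (raw)]:
  "u \<in> M \<rightarrow>\<^sub>M path_space \<Longrightarrow> u \<in> M \<rightarrow>\<^sub>M (borel :: (nat \<Rightarrow> 'e) measure)"
  using measurable_cong_sets[OF refl sets_borel_path_space] by blast

lemma measurable_continuous_pair:
  fixes f :: "'x \<times> (nat \<Rightarrow> 'e) \<Rightarrow> real"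
  assumes f: "continuous_on UNIV f" and [measurable]: "u \<in> M \<rightarrow>\<^sub>M borel" "v \<in> M \<rightarrow>\<^sub>M path_space"
  shows "(\<lambda>p. f (u p, v p)) \<in> borel_measurable M"
proof -
  have "(\<lambda>p. (u p, v p)) \<in> M \<rightarrow>\<^sub>M borel \<Otimes>\<^sub>M borel"
    by (intro measurable_Pair measurable_borel_path assms)
  then have "(\<lambda>p. (u p, v p)) \<in> M \<rightarrow>\<^sub>M borel" by (simp add: borel_prod)
  then show ?thesis using borel_measurable_continuous_onI[OF f] by (rule measurable_compose)
qed

lemma measurable_orbit_function:
  fixes f :: "'x \<times> (nat \<Rightarrow> 'e) \<Rightarrow> real"
  assumes f: "continuous_on UNIV f"
  shows "(\<lambda>\<omega>. f (orbit x \<omega> n)) \<in> borel_measurable path_space"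
  unfolding orbit_def
proof (rule measurable_continuous_pair[OF f])
  show "(\<lambda>\<omega>. act (word_prod g (prefix_word \<omega> n)) x) \<in> path_space \<rightarrow>\<^sub>M borel"
    unfolding prefix_word_eq_rev
    by (rule measurable_compose[OF measurable_prefix, of "\<lambda>ws. act (word_prod g (rev ws)) x"]) simp
qed measurable

lemma measurable_endpoint [measurable]: "(\<lambda>W. endpoint x W n) \<in> path_space \<rightarrow>\<^sub>M borel"
  unfolding endpoint_def
  by (rule measurable_compose[OF measurable_prefix, of "\<lambda>ws. act (word_prod g (rev (concat ws))) x"]) simp

text \<open>The first word takes countably many values; for each of them the group element is fixed
  and acts continuously.\<close>

lemma measurable_excursion_summand:
  fixes f :: "'x \<times> (nat \<Rightarrow> 'e) \<Rightarrow> real"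
  assumes f: "continuous_on UNIV f"
    and [measurable]: "u \<in> M \<rightarrow>\<^sub>M borel" "v \<in> M \<rightarrow>\<^sub>M path_space"
  shows "(\<lambda>p. if i < length (v p 0) then
     f (act (word_prod g (rev (take i (v p 0)))) (u p), (shift_map ^^ i) (concat_seq (v p))) else 0) \<in> borel_measurable M"
proof (rule measurable_compose_countable[where g="\<lambda>p. v p 0" and
    f="\<lambda>w p. if i < length w then f (act (word_prod g (rev (take i w))) (u p), (shift_map ^^ i) (concat_seq (v p))) else 0"])
  fix w
  have "(\<lambda>p. f (act (word_prod g (rev (take i w))) (u p), (shift_map ^^ i) (concat_seq (v p)))) \<in> borel_measurable M"
    by (rule measurable_continuous_pair[OF f]) measurable
  then show "(\<lambda>p. if i < length w then f (act (word_prod g (rev (take i w))) (u p), (shift_map ^^ i) (concat_seq (v p))) else 0) \<in> borel_measurable M"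
    by simp
qed measurable

lemma measurable_excursion_sum:
  fixes f :: "'x \<times> (nat \<Rightarrow> 'e) \<Rightarrow> real"
  assumes "continuous_on UNIV f" "u \<in> M \<rightarrow>\<^sub>M borel" "v \<in> M \<rightarrow>\<^sub>M path_space"
  shows "(\<lambda>p. excursion_sum f L (u p) (v p)) \<in> borel_measurable M"
  unfolding excursion_sum_def by (intro borel_measurable_sum measurable_excursion_summand assms)

lemma abs_excursion_sum_le:
  assumes B: "\<And>p. \<bar>f p\<bar> \<le> B"
  shows "\<bar>excursion_sum f L x W\<bar> \<le> real L * B"
proof -
  have "0 \<le> B" using B[of undefined] by simp
  have "\<bar>excursion_sum f L x W\<bar> \<le> (\<Sum>i<L. B)"
    unfolding excursion_sum_def
    by (rule order_trans[OF sum_abs sum_mono]) (use B \<open>0 \<le> B\<close> in auto)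
  then show ?thesis by simp
qed

lemma continuous_excursion_sum:
  assumes f: "continuous_on UNIV f"
  shows "continuous_on UNIV (\<lambda>x. excursion_sum f L x W)"
proof -
  have "continuous_on UNIV (\<lambda>x. f (act a x, \<omega>))" for a \<omega>
    by (rule continuous_on_compose2[OF f]) (auto intro!: continuous_intros continuous_act)
  then have "continuous_on UNIV (\<lambda>x. if P then f (act a x, \<omega>) else 0)" for P a \<omega>
    by (cases P) auto
  then show ?thesis unfolding excursion_sum_def by (intro continuous_on_sum)
qed

definition mean_excursion_sum :: "('x \<times> (nat \<Rightarrow> 'e) \<Rightarrow> real) \<Rightarrow> nat \<Rightarrow> 'x \<Rightarrow> real" where
  "mean_excursion_sum f L x = (\<integral>W. excursion_sum f L x W \<partial>S)"

lemma continuous_mean_excursion_sum: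
  assumes f: "continuous_on UNIV f" and B: "\<And>p. \<bar>f p\<bar> \<le> B"
  shows "continuous_on UNIV (mean_excursion_sum f L)"
  unfolding mean_excursion_sum_def[abs_def]
proof (rule continuous_on_integral_bounded[where B="real L * B"])
  show "finite_measure S" by unfold_locales
  show "excursion_sum f L x \<in> borel_measurable S" for x
    by (rule measurable_excursion_sum[OF f]) measurable
qed (intro continuous_excursion_sum f abs_excursion_sum_le B)+

lemma abs_mean_excursion_sum_le:
  assumes f: "continuous_on UNIV f" and B: "\<And>p. \<bar>f p\<bar> \<le> B"
  shows "\<bar>mean_excursion_sum f L x\<bar> \<le> real L * B"
proof -
  have [measurable]: "excursion_sum f L x \<in> borel_measurable S"
    by (rule measurable_excursion_sum[OF f]) measurable
  have "\<bar>mean_excursion_sum f L x\<bar> \<le> (\<integral>W. \<bar>excursion_sum f L x W\<bar> \<partial>S)"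
    unfolding mean_excursion_sum_def by (rule integral_abs_bound)
  also have "\<dots> \<le> (\<integral>W. real L * B \<partial>S)"
    using abs_excursion_sum_le[of f B L x, OF B]
    by (intro integral_mono P.integrable_const_bound[of "\<lambda>W. \<bar>excursion_sum f L x W\<bar>" "real L * B"]) auto
  finally show ?thesis using P.prob_space by simp
qed

text \<open>The difference at j has mean 0 given the first j excursions: the endpoint depends on
  these alone, and the words from j on form an independent copy of the whole sequence. The
  difference at i is determined by the first i + R words, so the two are uncorrelated once i + R
  \<le> j.\<close>

lemma excursion_sum_law_of_large_numbers:
  assumes f: "cylinder_function f"
  shows "AE W in S. (\<lambda>n. (\<Sum>j<n. excursion_sum f L (endpoint x W j) (\<lambda>k. W (j + k))
    - mean_excursion_sum f L (endpoint x W j)) / real n) \<longlonglongrightarrow> 0"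
proof -
  have cont: "continuous_on UNIV f" using f by (simp add: cylinder_function_def)
  obtain B where B: "\<And>p. \<bar>f p\<bar> \<le> B"
    using f by (auto simp: cylinder_function_def bounded_iff)
  obtain r where r: "\<And>x \<omega> \<omega>'. (\<forall>k<r. \<omega> k = \<omega>' k) \<Longrightarrow> f (x, \<omega>) = f (x, \<omega>')"
    using f unfolding cylinder_function_def by blast
  define D where "D j W = excursion_sum f L (endpoint x W j) (\<lambda>k. W (j + k))
    - mean_excursion_sum f L (endpoint x W j)" for j W
  define C where "C = real L * B + real L * B"
  have D_bound: "\<bar>D j W\<bar> \<le> C" for j W
    using abs_excursion_sum_le[of f B L "endpoint x W j" "\<lambda>k. W (j + k)", OF B]
      abs_mean_excursion_sum_le[OF cont, of B L "endpoint x W j", OF B]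
    unfolding D_def C_def by linarith
  have [measurable]: "mean_excursion_sum f L \<in> borel_measurable borel"
    by (rule borel_measurable_continuous_onI[OF continuous_mean_excursion_sum[OF cont B]])
  have [measurable]: "(\<lambda>W k. W (j + k)) \<in> path_space \<rightarrow>\<^sub>M path_space" for j :: nat
    by (rule measurable_path_spaceI) measurable
  have D_meas[measurable]: "D j \<in> borel_measurable S" for j
    unfolding D_def[abs_def]
    by (intro borel_measurable_diff measurable_excursion_sum cont) measurable
  \<comment> \<open>A step i < L reads the letters i to i + r - 1, and a letter depends on no word
    of larger index than its own. The summand 1 includes \<open>W 0\<close> even if
    \<open>L + r = 0\<close>.\<close>
  define R where "R = L + r + 1"
  have local_sum: "excursion_sum f L y W = excursion_sum f L y W'" if eq: "\<forall>k<R. W k = W' k" for y W W'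
  proof -
    have "f (z, (shift_map ^^ i) (concat_seq W)) = f (z, (shift_map ^^ i) (concat_seq W'))" if i: "i < L" for z i
    proof (rule r, intro allI impI)
      fix k assume "k < r"
      then have "\<forall>j\<in>set [0..<Suc (i + k)]. W j = W' j" using i eq by (auto simp: R_def)
      then have "map W [0..<Suc (i + k)] = map W' [0..<Suc (i + k)]" by (simp only: map_eq_conv)
      then show "(shift_map ^^ i) (concat_seq W) k = (shift_map ^^ i) (concat_seq W') k"
        by (simp only: shift_map_funpow concat_seq_def)
    qed
    moreover have "W 0 = W' 0" using eq by (simp add: R_def)
    ultimately show ?thesis unfolding excursion_sum_def by (intro sum.cong) auto
  qed
  have endpoint_local: "endpoint x W i = endpoint x W' i" if "\<forall>k<i. W k = W' k" for W W' i
  proof -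
    have "map W [0..<i] = map W' [0..<i]" using that by simp
    then show ?thesis by (simp only: endpoint_def)
  qed
  have "AE W in S. (\<lambda>n. (\<Sum>j<n. D j W) / real n) \<longlonglongrightarrow> 0"
  proof (rule P.finite_range_law_of_large_numbers[where B=C and R=R])
    fix i j assume ij: "i + R \<le> j"
    show "(\<integral>W. D i W * D j W \<partial>S) = 0"
    proof (rule integral_eq_0_if_future_integral_eq_0[where j=j and B="C * C"])
      show "\<bar>D i W * D j W\<bar> \<le> C * C" for W
        using D_bound[of i W] D_bound[of j W] by (auto simp: abs_mult intro!: mult_mono)
      fix U
      have Di: "D i (comb_seq j U V) = D i U" for V
      proof -
        have "endpoint x (comb_seq j U V) i = endpoint x U i"
          using ij by (intro endpoint_local) (auto simp: comb_seq_less)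
        moreover have "excursion_sum f L y (\<lambda>k. comb_seq j U V (i + k)) = excursion_sum f L y (\<lambda>k. U (i + k))" for y
          using ij by (intro local_sum) (auto simp: comb_seq_less)
        ultimately show ?thesis by (simp add: D_def)
      qed
      have Dj: "D j (comb_seq j U V) = excursion_sum f L (endpoint x U j) V - mean_excursion_sum f L (endpoint x U j)" for V
      proof -
        have "endpoint x (comb_seq j U V) j = endpoint x U j"
          by (intro endpoint_local) (auto simp: comb_seq_less)
        moreover have "(\<lambda>k. comb_seq j U V (j + k)) = V"
          using comb_seq_add[of j U V] by (simp add: add.commute)
        ultimately show ?thesis by (simp add: D_def)
      qed
      have int: "integrable S (excursion_sum f L (endpoint x U j))"
        using abs_excursion_sum_le[of f B, OF B]
        by (intro P.integrable_const_bound[of _ "real L * B"] measurable_excursion_sum cont) auto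
      show "(\<integral>V. D i (comb_seq j U V) * D j (comb_seq j U V) \<partial>S) = 0"
        unfolding Di Dj using int P.prob_space by (simp add: mean_excursion_sum_def)
    qed measurable
  qed (auto intro: D_bound)
  then show ?thesis by (simp add: D_def)
qed

end

section \<open>Independent excursions and the renewal measure\<close>

lemma (in sequence_space) distr_PiM_map:
  assumes \<phi>[measurable]: "\<phi> \<in> M \<rightarrow>\<^sub>M N"
  shows "distr S (PiM UNIV (\<lambda>_. N)) (\<lambda>W k. \<phi> (W k)) = PiM UNIV (\<lambda>_. distr M N \<phi>)"
proof -
  interpret N: product_prob_space "\<lambda>_. distr M N \<phi>" "UNIV :: nat set"
    by (intro product_prob_spaceI M.prob_space_distr \<phi>)
  have sets_N: "sets (PiM UNIV (\<lambda>_::nat. distr M N \<phi>)) = sets (PiM UNIV (\<lambda>_. N))"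
    by (intro sets_PiM_cong) auto
  have map[measurable]: "(\<lambda>W k. \<phi> (W k)) \<in> S \<rightarrow>\<^sub>M PiM UNIV (\<lambda>_. N)"
    using measurable_space[OF \<phi>]
    by (intro measurable_PiM_single') (auto simp: space_PiM PiE_iff)
  show ?thesis
  proof (rule N.PiM_eq)
    show "sets (distr S (PiM UNIV (\<lambda>_. N)) (\<lambda>W k. \<phi> (W k))) = sets (PiM UNIV (\<lambda>_::nat. distr M N \<phi>))"
      by (simp add: sets_N)
    fix J :: "nat set" and F assume J: "finite J" "J \<subseteq> UNIV" "\<And>j. j \<in> J \<Longrightarrow> F j \<in> sets (distr M N \<phi>)"
    let ?X = "prod_emb UNIV (\<lambda>_. distr M N \<phi>) J (Pi\<^sub>E J F)"
    have "?X \<in> sets (PiM UNIV (\<lambda>_. N))"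
      using sets_PiM_I[OF J(1,2), of F "\<lambda>_. distr M N \<phi>"] J(3) sets_N by auto
    then have "emeasure (distr S (PiM UNIV (\<lambda>_. N)) (\<lambda>W k. \<phi> (W k))) ?X = emeasure S ((\<lambda>W k. \<phi> (W k)) -` ?X \<inter> space S)"
      by (intro emeasure_distr) measurable
    also have "(\<lambda>W k. \<phi> (W k)) -` ?X \<inter> space S = emb UNIV J (\<Pi>\<^sub>E j\<in>J. \<phi> -` F j \<inter> space M)"
      using measurable_space[OF \<phi>] by (auto simp: prod_emb_def space_PiM PiE_iff)
    also have "emeasure S \<dots> = (\<Prod>j\<in>J. emeasure M (\<phi> -` F j \<inter> space M))"
      using J measurable_sets[OF \<phi>] by (intro emeasure_PiM_emb) auto
    also have "\<dots> = (\<Prod>j\<in>J. emeasure (distr M N \<phi>) (F j))"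
      using J(3) by (intro prod.cong refl emeasure_distr[symmetric] \<phi>) auto
    finally show "emeasure (distr S (PiM UNIV (\<lambda>_. N)) (\<lambda>W k. \<phi> (W k))) ?X = (\<Prod>j\<in>J. emeasure (distr M N \<phi>) (F j))" .
  qed
qed

lemma measurable_excursion_lawI: "\<phi> \<in> UNIV \<rightarrow> space N \<Longrightarrow> \<phi> \<in> excursion_law K e \<rightarrow>\<^sub>M N"
  by (simp add: measurable_cong_sets[OF sets_excursion_law refl])

lemma renewal_measure_eq_distr:
  "renewal_measure K g e = distr (excursion_law K e) borel (\<lambda>w. word_prod g (rev w))"
  unfolding renewal_measure_def excursion_law_def
  by (subst distr_distr) (auto simp: o_def excursion_def prefix_word_eq_rev)

text \<open>Here \<open>prefix_word\<close> is applied to the increments of the walk and puts the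
  latest factor on the left. Reversing the concatenation arranges the words in the same
  order.\<close>

lemma prod_list_prefix_word_excursions:
  "prod_list (prefix_word (\<lambda>k. word_prod g (rev (W k))) n) = word_prod g (rev (concat (map W [0..<n])))"
proof (induction n)
  case (Suc n)
  then show ?case by (simp add: prefix_word_def word_prod_append)
qed (simp add: prefix_word_def word_prod_def)

lemma prob_space_markov_init: "prob_space (markov_init K \<pi>)"
  unfolding markov_init_def by (rule prob_space_markov_bind)

lemma prob_space_pair_markov_init: "prob_space m \<Longrightarrow> prob_space (m \<Otimes>\<^sub>M markov_init K \<pi>)"
  by (intro prob_space_pair prob_space_markov_init)

lemma sets_pair_markov_init:
  fixes K :: "'e::countable_discrete \<Rightarrow> 'e pmf" and m :: "'x::second_countable_topology measure"
  assumes "sets m = sets borel"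
  shows "sets (m \<Otimes>\<^sub>M markov_init K \<pi>) = sets borel"
proof -
  have "sets (m \<Otimes>\<^sub>M markov_init K \<pi>) = sets ((borel :: 'x measure) \<Otimes>\<^sub>M (borel :: (nat \<Rightarrow> 'e) measure))"
    by (rule sets_pair_measure_cong[OF assms]) (simp add: markov_init_def sets_markov_bind sets_borel_path_space)
  then show ?thesis by (simp only: borel_prod)
qed

context excursion_walk
begin

lemma nn_integral_concat_seq:
  assumes [measurable]: "\<psi> \<in> borel_measurable path_space"
  shows "(\<integral>\<^sup>+W. \<psi> (concat_seq W) \<partial>S) = (\<integral>\<^sup>+\<omega>. \<psi> \<omega> \<partial>markov K e)"
  unfolding distr_concat_seq[OF recurrent, symmetric] by (rule nn_integral_distr[symmetric]) measurable

lemma taboo_integral_1_eq: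
  "taboo_integral K e (\<lambda>_. 1) i e = (\<integral>\<^sup>+w. indicator {..<length w} i \<partial>excursion_law K e)"
proof -
  have "taboo_integral K e (\<lambda>_. 1) i e = (\<integral>\<^sup>+W. indicator (avoids e i) (concat_seq W) \<partial>S)"
    unfolding taboo_integral_def by (subst nn_integral_concat_seq) auto
  also have "\<dots> = (\<integral>\<^sup>+W. indicator {..<length (W 0)} i \<partial>S)"
  proof (rule nn_integral_cong_AE)
    show "AE W in S. indicator (avoids e i) (concat_seq W) = (indicator {..<length (W 0)} i :: ennreal)"
      using AE_excursion_space[OF recurrent]
      by eventually_elim (simp add: indicator_def concat_seq_avoids_iff)
  qed
  also have "\<dots> = (\<integral>\<^sup>+w. indicator {..<length w} i \<partial>distr S (excursion_law K e) (\<lambda>W. W 0))"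
    by (subst nn_integral_distr) (auto intro: measurable_excursion_lawI)
  also have "distr S (excursion_law K e) (\<lambda>W. W 0) = excursion_law K e"
    by (rule PiM_component) simp
  finally show ?thesis .
qed

text \<open>Kac's formula with \<open>h = 1\<close>, for which the sum of the taboo integrals is the
  expected length of an excursion.\<close>

lemma mean_excursion_length:
  assumes irr: "irreducible_chain K" and rec: "positive_recurrent K" and stat: "stationary K \<pi>"
  shows "0 < pmf \<pi> e" "integrable (excursion_law K e) (\<lambda>w. real (length w))"
    "(\<integral>w. real (length w) \<partial>excursion_law K e) = 1 / pmf \<pi> e"
proof -
  have len: "(\<Sum>i. indicator {..<n} i) = ennreal (real n)" for n :: nat
  proof -
    have "(\<Sum>i. indicator {..<n} i :: ennreal) = (\<Sum>i\<in>{..<n}. indicator {..<n} i)"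
      by (rule suminf_finite) auto
    then show ?thesis by (simp add: ennreal_of_nat_eq_real_of_nat)
  qed
  have "(\<Sum>i. taboo_integral K e (\<lambda>_. 1) i e) = (\<integral>\<^sup>+w. (\<Sum>i. indicator {..<length w} i) \<partial>excursion_law K e)"
    unfolding taboo_integral_1_eq by (rule nn_integral_suminf[symmetric]) (rule measurable_excursion_lawI, simp)
  also have "\<dots> = (\<integral>\<^sup>+w. ennreal (real (length w)) \<partial>excursion_law K e)" by (simp add: len)
  finally have sum: "(\<Sum>i. taboo_integral K e (\<lambda>_. 1) i e) = (\<integral>\<^sup>+w. ennreal (real (length w)) \<partial>excursion_law K e)" .
  interpret init: prob_space "markov_init K \<pi>" by (rule prob_space_markov_init)
  have "(\<integral>\<^sup>+\<omega>. 1 \<partial>markov_init K \<pi>) = ennreal (pmf \<pi> e) * (\<Sum>i. taboo_integral K e (\<lambda>_. 1) i e)"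
    by (rule markov_init_eq_taboo_sum[where C=1]) (auto simp: irr rec stat)
  then have eq: "ennreal (pmf \<pi> e) * (\<integral>\<^sup>+w. ennreal (real (length w)) \<partial>excursion_law K e) = 1"
    by (simp add: sum init.emeasure_space_1)
  \<comment> \<open>In \<open>ennreal\<close> zero times infinity is zero, so \<open>eq\<close>
    excludes \<open>pmf \<pi> e = 0\<close>.\<close>
  show p: "0 < pmf \<pi> e" using eq pmf_nonneg[of \<pi> e] by (cases "pmf \<pi> e = 0") (auto simp: less_le)
  have "(\<integral>\<^sup>+w. ennreal (real (length w)) \<partial>excursion_law K e) = ennreal (1 / pmf \<pi> e)"
  proof -
    have "ennreal (1 / pmf \<pi> e) * (ennreal (pmf \<pi> e) * (\<integral>\<^sup>+w. ennreal (real (length w)) \<partial>excursion_law K e))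
        = (\<integral>\<^sup>+w. ennreal (real (length w)) \<partial>excursion_law K e)"
      unfolding mult.assoc[symmetric] using p by (simp add: ennreal_mult[symmetric])
    with eq show ?thesis by simp
  qed
  moreover have "(\<lambda>w. real (length w)) \<in> borel_measurable (excursion_law K e)"
    by (rule measurable_excursion_lawI) simp
  ultimately show "integrable (excursion_law K e) (\<lambda>w. real (length w))"
      "(\<integral>w. real (length w) \<partial>excursion_law K e) = 1 / pmf \<pi> e"
    using p by (auto intro!: integrableI_nn_integral_finite[where x="1 / pmf \<pi> e"] integral_eq_nn_integral[THEN trans])
qed

section \<open>Invariance of m and lower bounds along orbits\<close>

context
  fixes m :: "'x measure"
  assumes m: "prob_space m" and sets_m [measurable_cong]: "sets m = sets borel"
    and invariant: "\<And>w. admissible K w \<Longrightarrow> starts_with w e \<Longrightarrow> distr m borel (act (word_prod g w)) = m"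
begin

interpretation m: prob_space m by (rule m)

interpretation mS: pair_sigma_finite m S ..

lemma measurable_fibre_integral:
  fixes f :: "'x \<times> (nat \<Rightarrow> 'e) \<Rightarrow> real"
  assumes f: "continuous_on UNIV f"
  shows "(\<lambda>\<omega>. \<integral>\<^sup>+x. ennreal (f (x, \<omega>)) \<partial>m) \<in> borel_measurable path_space"
proof (rule m.borel_measurable_nn_integral)
  have "(\<lambda>p. f (snd p, fst p)) \<in> borel_measurable (path_space \<Otimes>\<^sub>M m)"
    by (rule measurable_continuous_pair[OF f]) measurable
  then show "(\<lambda>(\<omega>, x). ennreal (f (x, \<omega>))) \<in> borel_measurable (path_space \<Otimes>\<^sub>M m)"
    by (simp add: split_beta')
qed

text \<open>Fubini integrates over the starting point first. Given the excursion, the word of its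
  first i letters is admissible and starts with \<open>e\<close>, so it preserves \<open>m\<close>:
  the group element disappears, and what remains is the fibre integral of \<open>f\<close> at the
  i-th shift. The law of the concatenated path turns this into a taboo integral of the
  chain.\<close>

lemma integral_mean_excursion_sum:
  assumes f: "cylinder_function f"
  shows "ennreal (\<integral>x. mean_excursion_sum f L x \<partial>m) =
    (\<Sum>i<L. taboo_integral K e (\<lambda>\<omega>. \<integral>\<^sup>+x. ennreal (f (x, \<omega>)) \<partial>m) i e)"
proof -
  note cont = cylinder_function_continuous[OF f] and nonneg = cylinder_function_nonneg[OF f]
  obtain B where B: "\<And>p. \<bar>f p\<bar> \<le> B"
    using f by (auto simp: cylinder_function_def bounded_iff)
  define h where "h \<omega> = (\<integral>\<^sup>+x. ennreal (f (x, \<omega>)) \<partial>m)" for \<omega>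
  have h[measurable]: "h \<in> borel_measurable path_space"
    unfolding h_def[abs_def] by (rule measurable_fibre_integral[OF cont])
  define t where "t i x W = (if i < length (W 0)
     then f (act (word_prod g (rev (take i (W 0)))) x, (shift_map ^^ i) (concat_seq W)) else 0)" for i x W
  have t_nonneg: "0 \<le> t i x W" for i x W using nonneg by (simp add: t_def)
  have es: "excursion_sum f L x W = (\<Sum>i<L. t i x W)" for x W by (simp add: excursion_sum_def t_def)
  have t_meas: "(\<lambda>p. t i (u p) (v p)) \<in> borel_measurable M'"
    if "u \<in> M' \<rightarrow>\<^sub>M borel" "v \<in> M' \<rightarrow>\<^sub>M path_space" for i u v and M' :: "'z measure"
    unfolding t_def by (rule measurable_excursion_summand[OF cont that])
  have es_meas: "excursion_sum f L x \<in> borel_measurable S" for x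
    by (rule measurable_excursion_sum[OF cont]) measurable
  have es_int: "integrable S (excursion_sum f L x)" for x
    using abs_excursion_sum_le[of f B, OF B] es_meas
    by (intro P.integrable_const_bound[of _ "real L * B"]) auto
  have mean_nonneg: "0 \<le> mean_excursion_sum f L x" for x
    unfolding mean_excursion_sum_def es by (intro integral_nonneg_AE AE_I2 sum_nonneg t_nonneg)
  have mean_meas: "mean_excursion_sum f L \<in> borel_measurable m"
    using borel_measurable_continuous_onI[OF continuous_mean_excursion_sum[OF cont B]]
    by (simp add: measurable_cong_sets[OF sets_m refl])
  have mean_int: "integrable m (mean_excursion_sum f L)"
    using abs_mean_excursion_sum_le[OF cont, of B L, OF B] mean_meas
    by (intro m.integrable_const_bound[of _ "real L * B"]) auto
  have es_pair: "(\<lambda>(x, W). ennreal (excursion_sum f L x W)) \<in> borel_measurable (m \<Otimes>\<^sub>M S)"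
  proof -
    have "(\<lambda>p. excursion_sum f L (fst p) (snd p)) \<in> borel_measurable (m \<Otimes>\<^sub>M S)"
      by (rule measurable_excursion_sum[OF cont]) measurable
    then show ?thesis by (simp add: split_beta')
  qed
  have "ennreal (\<integral>x. mean_excursion_sum f L x \<partial>m) = (\<integral>\<^sup>+x. ennreal (mean_excursion_sum f L x) \<partial>m)"
    by (rule nn_integral_eq_integral[symmetric, OF mean_int]) (auto simp: mean_nonneg)
  also have "\<dots> = (\<integral>\<^sup>+x. (\<integral>\<^sup>+W. ennreal (excursion_sum f L x W) \<partial>S) \<partial>m)"
    unfolding mean_excursion_sum_def
    by (intro nn_integral_cong nn_integral_eq_integral[symmetric] es_int AE_I2)
       (simp add: es sum_nonneg t_nonneg)
  also have "\<dots> = (\<integral>\<^sup>+W. (\<integral>\<^sup>+x. ennreal (excursion_sum f L x W) \<partial>m) \<partial>S)"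
    by (rule mS.Fubini'[symmetric, OF es_pair])
  also have "\<dots> = (\<integral>\<^sup>+W. (\<Sum>i<L. \<integral>\<^sup>+x. ennreal (t i x W) \<partial>m) \<partial>S)"
  proof (rule nn_integral_cong)
    fix W
    have "(\<lambda>x. t i x W) \<in> borel_measurable m" for i by (rule t_meas) measurable
    then show "(\<integral>\<^sup>+x. ennreal (excursion_sum f L x W) \<partial>m) = (\<Sum>i<L. \<integral>\<^sup>+x. ennreal (t i x W) \<partial>m)"
      unfolding es by (subst nn_integral_sum[symmetric]) (auto simp: sum_ennreal t_nonneg)
  qed
  also have "\<dots> = (\<integral>\<^sup>+W. (\<Sum>i<L. indicator (avoids e i) (concat_seq W) * h ((shift_map ^^ i) (concat_seq W))) \<partial>S)"
  proof (rule nn_integral_cong_AE)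
    show "AE W in S. (\<Sum>i<L. \<integral>\<^sup>+x. ennreal (t i x W) \<partial>m) =
      (\<Sum>i<L. indicator (avoids e i) (concat_seq W) * h ((shift_map ^^ i) (concat_seq W)))"
      using AE_excursion_space[OF recurrent]
    proof eventually_elim
      case (elim W)
      have "(\<integral>\<^sup>+x. ennreal (t i x W) \<partial>m) = indicator (avoids e i) (concat_seq W) * h ((shift_map ^^ i) (concat_seq W))" for i
      proof (cases "i < length (W 0)")
        case True
        let ?w = "rev (take i (W 0))" and ?\<omega> = "(shift_map ^^ i) (concat_seq W)"
        have meas: "(\<lambda>x. ennreal (f (x, ?\<omega>))) \<in> borel_measurable borel"
          using measurable_continuous_pair[OF cont, of "\<lambda>x. x" borel "\<lambda>_. ?\<omega>"] by simp
        have "(\<integral>\<^sup>+x. ennreal (f (act (word_prod g ?w) x, ?\<omega>)) \<partial>m) = h ?\<omega>"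
        \<comment> \<open>The empty word is not admissible; it acts as the identity.\<close>
        proof (cases "i = 0")
          case True
          then show ?thesis using action by (simp add: h_def word_prod_def continuous_action_def)
        next
          case False
          then have inv: "distr m borel (act (word_prod g ?w)) = m"
            using elim by (intro invariant admissible_rev_take) auto
          have "h ?\<omega> = (\<integral>\<^sup>+x. ennreal (f (x, ?\<omega>)) \<partial>distr m borel (act (word_prod g ?w)))"
            by (simp only: h_def inv)
          also have "\<dots> = (\<integral>\<^sup>+x. ennreal (f (act (word_prod g ?w) x, ?\<omega>)) \<partial>m)"
            using meas by (intro nn_integral_distr) auto
          finally show ?thesis ..
        qed
        with True elim show ?thesis by (simp add: t_def concat_seq_avoids_iff)
      next
        case False
        with elim show ?thesis by (simp add: t_def concat_seq_avoids_iff)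
      qed
      then show ?case by simp
    qed
  qed
  also have "\<dots> = (\<Sum>i<L. \<integral>\<^sup>+W. indicator (avoids e i) (concat_seq W) * h ((shift_map ^^ i) (concat_seq W)) \<partial>S)"
    by (rule nn_integral_sum) measurable
  also have "\<dots> = (\<Sum>i<L. taboo_integral K e h i e)"
    unfolding taboo_integral_def
    by (intro sum.cong refl nn_integral_concat_seq[of "\<lambda>\<omega>. indicator (avoids e _) \<omega> * h ((shift_map ^^ _) \<omega>)"]) measurable
  finally show ?thesis by (simp add: h_def[abs_def])
qed

text \<open>Kac's formula for the fibre integral of \<open>f\<close>: the truncated means are the
  partial sums of the taboo series, and \<open>pmf \<pi> e\<close> is the inverse of the expected
  return time.\<close>

lemma tendsto_integral_mean_excursion_sum:
  assumes irr: "irreducible_chain K" and rec: "positive_recurrent K" and stat: "stationary K \<pi>"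
    and f: "cylinder_function f"
  shows "(\<lambda>L. pmf \<pi> e * (\<integral>x. mean_excursion_sum f L x \<partial>m)) \<longlonglongrightarrow> (\<integral>p. f p \<partial>(m \<Otimes>\<^sub>M markov_init K \<pi>))"
proof -
  note cont = cylinder_function_continuous[OF f] and nonneg = cylinder_function_nonneg[OF f]
  obtain B where B: "\<And>p. \<bar>f p\<bar> \<le> B"
    using f by (auto simp: cylinder_function_def bounded_iff)
  define h where "h \<omega> = (\<integral>\<^sup>+x. ennreal (f (x, \<omega>)) \<partial>m)" for \<omega>
  have h[measurable]: "h \<in> borel_measurable path_space"
    unfolding h_def[abs_def] by (rule measurable_fibre_integral[OF cont])
  have h_le: "h \<omega> \<le> ennreal B" for \<omega>
  proof -
    have "h \<omega> \<le> (\<integral>\<^sup>+x. ennreal B \<partial>m)"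
      unfolding h_def
    proof (intro nn_integral_mono ennreal_leI)
      show "f (x, \<omega>) \<le> B" for x using B[of "(x, \<omega>)"] by simp
    qed
    then show ?thesis by (simp add: m.emeasure_space_1)
  qed
  interpret init: prob_space "markov_init K \<pi>" by (rule prob_space_markov_init)
  interpret mi: prob_space "m \<Otimes>\<^sub>M markov_init K \<pi>" by (rule prob_space_pair_markov_init[OF m])
  interpret mi: pair_sigma_finite m "markov_init K \<pi>" ..
  have f_meas: "f \<in> borel_measurable (m \<Otimes>\<^sub>M markov_init K \<pi>)"
    using borel_measurable_continuous_onI[OF cont] by (simp add: measurable_cong_sets[OF sets_pair_markov_init[OF sets_m] refl])
  have f_int: "integrable (m \<Otimes>\<^sub>M markov_init K \<pi>) f"
    using B f_meas by (intro mi.integrable_const_bound[of _ B]) auto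
  have "ennreal (\<integral>p. f p \<partial>(m \<Otimes>\<^sub>M markov_init K \<pi>)) = (\<integral>\<^sup>+p. ennreal (f p) \<partial>(m \<Otimes>\<^sub>M markov_init K \<pi>))"
    by (rule nn_integral_eq_integral[symmetric, OF f_int]) (auto simp: nonneg)
  also have "\<dots> = (\<integral>\<^sup>+\<omega>. h \<omega> \<partial>markov_init K \<pi>)"
    unfolding h_def using f_meas by (intro mi.nn_integral_snd[symmetric]) auto
  also have "\<dots> = ennreal (pmf \<pi> e) * (\<Sum>i. taboo_integral K e h i e)"
    by (rule markov_init_eq_taboo_sum[OF h h_le irr rec stat])
  finally have limit: "ennreal (\<integral>p. f p \<partial>(m \<Otimes>\<^sub>M markov_init K \<pi>)) = ennreal (pmf \<pi> e) * (\<Sum>i. taboo_integral K e h i e)" .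
  have mean_nonneg: "0 \<le> (\<integral>x. mean_excursion_sum f L x \<partial>m)" for L
    unfolding mean_excursion_sum_def excursion_sum_def
    by (intro integral_nonneg_AE AE_I2 sum_nonneg) (simp add: nonneg)
  have "(\<lambda>L. ennreal (pmf \<pi> e) * (\<Sum>i<L. taboo_integral K e h i e)) \<longlonglongrightarrow> ennreal (pmf \<pi> e) * (\<Sum>i. taboo_integral K e h i e)"
    by (intro ennreal_tendsto_cmult summable_LIMSEQ) auto
  moreover have "ennreal (pmf \<pi> e) * (\<Sum>i<L. taboo_integral K e h i e) = ennreal (pmf \<pi> e * (\<integral>x. mean_excursion_sum f L x \<partial>m))" for L
    using integral_mean_excursion_sum[OF f, of L] mean_nonneg[of L]
    by (simp add: h_def[abs_def] ennreal_mult)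
  ultimately have "(\<lambda>L. ennreal (pmf \<pi> e * (\<integral>x. mean_excursion_sum f L x \<partial>m))) \<longlonglongrightarrow> ennreal (\<integral>p. f p \<partial>(m \<Otimes>\<^sub>M markov_init K \<pi>))"
    by (simp add: limit)
  then show ?thesis
    using mean_nonneg nonneg by (subst (asm) tendsto_ennreal_iff) (auto intro!: integral_nonneg_AE)
qed

lemma AE_liminf_orbit_average:
  assumes irr: "irreducible_chain K" and rec: "positive_recurrent K" and stat: "stationary K \<pi>"
    and f: "cylinder_function f"
    and equi: "AE W in S. equidistributes (endpoint x W) m"
    and b: "b < (\<integral>p. f p \<partial>(m \<Otimes>\<^sub>M markov_init K \<pi>))"
  shows "AE \<omega> in markov K e. \<forall>\<^sub>F n in sequentially. b < (\<Sum>k<n. f (orbit x \<omega> k)) / real n"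
proof -
  note cont = cylinder_function_continuous[OF f] and nonneg = cylinder_function_nonneg[OF f]
  note len = mean_excursion_length[OF irr rec stat]
  obtain B where B: "\<And>p. \<bar>f p\<bar> \<le> B"
    using f by (auto simp: cylinder_function_def bounded_iff)
  \<comment> \<open>The truncation level is chosen from \<open>f\<close> and \<open>b\<close>,
    before any path.\<close>
  have "\<forall>\<^sub>F L in sequentially. b < pmf \<pi> e * (\<integral>x. mean_excursion_sum f L x \<partial>m)"
    by (rule order_tendstoD(1)[OF tendsto_integral_mean_excursion_sum[OF irr rec stat f] b])
  then obtain L where L: "b < pmf \<pi> e * (\<integral>x. mean_excursion_sum f L x \<partial>m)"
    using eventually_happens'[OF sequentially_bot] by blast
  define c where "c = (\<integral>x. mean_excursion_sum f L x \<partial>m)"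
  \<comment> \<open>Countably many slopes decreasing to the expected length, so that one null set
    serves every larger slope.\<close>
  have times: "AE W in S. \<forall>l. \<forall>\<^sub>F n in sequentially. (\<Sum>j<n. real (length (W j))) \<le> (1 / pmf \<pi> e + 1 / real (Suc l)) * real n"
    unfolding AE_all_countable
    by (intro allI average_eventually_le len(2)) (auto simp: len(3))
  have "AE W in S. \<forall>\<^sub>F n in sequentially. b < (\<Sum>k<n. f (orbit x (concat_seq W) k)) / real n"
    using AE_excursion_space[OF recurrent] times equi excursion_sum_law_of_large_numbers[OF f, of L x]
  proof eventually_elim
    case (elim W)
    have ne: "W j \<noteq> []" for j using elim(1) Nil_notin_excursions[of e] by metis
    show ?case
    proof (rule liminf_average_along_blocks[where a="\<lambda>k. f (orbit x (concat_seq W) k)" and t="concat_time W" and c=c and \<theta>="1 / pmf \<pi> e"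
        and S="\<lambda>n. \<Sum>j<n. excursion_sum f L (endpoint x W j) (\<lambda>k. W (j + k))"])
      show "(\<Sum>j<n. excursion_sum f L (endpoint x W j) (\<lambda>k. W (j + k)))
        \<le> (\<Sum>k<concat_time W n. f (orbit x (concat_seq W) k))" for n
        by (intro excursion_sums_le_orbit_sum ne nonneg)
      have "bounded (range (mean_excursion_sum f L))"
        using abs_mean_excursion_sum_le[OF cont, of B L, OF B] by (auto simp: bounded_iff)
      then have "(\<lambda>n. (\<Sum>j<n. mean_excursion_sum f L (endpoint x W j)) / real n) \<longlonglongrightarrow> c"
        using elim(3) continuous_mean_excursion_sum[OF cont B] unfolding equidistributes_def c_def by blast
      from tendsto_add[OF elim(4) this]
      show "(\<lambda>n. (\<Sum>j<n. excursion_sum f L (endpoint x W j) (\<lambda>k. W (j + k))) / real n) \<longlonglongrightarrow> c"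
        by (simp add: sum_subtractf diff_divide_distrib)
      fix \<theta>' assume \<theta>': "1 / pmf \<pi> e < \<theta>'"
      then obtain l where "inverse (real (Suc l)) < \<theta>' - 1 / pmf \<pi> e"
        using reals_Archimedean[of "\<theta>' - 1 / pmf \<pi> e"] by auto
      then have l: "1 / pmf \<pi> e + 1 / real (Suc l) \<le> \<theta>'" by (simp add: inverse_eq_divide)
      show "\<forall>\<^sub>F n in sequentially. real (concat_time W n) \<le> \<theta>' * real n"
        using elim(2)[rule_format, of l]
      proof eventually_elim
        case (elim n)
        then show ?case
          using mult_right_mono[OF l, of "real n"] by (simp add: concat_time_def)
      qed
    qed (use ne len(1) L in \<open>auto simp: nonneg c_def mult.commute intro: concat_time_ge\<close>)
  qed
  \<comment> \<open>Measurability of the event lets the almost sure statement pass from excursion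
    sequences to the image measure.\<close>
  moreover have "Measurable.pred path_space (\<lambda>\<omega>. \<forall>\<^sub>F n in sequentially. b < (\<Sum>k<n. f (orbit x \<omega> k)) / real n)"
  proof -
    have [measurable]: "(\<lambda>\<omega>. f (orbit x \<omega> k)) \<in> borel_measurable path_space" for k
      by (rule measurable_orbit_function[OF cont])
    show ?thesis unfolding eventually_sequentially by measurable
  qed
  ultimately have "AE \<omega> in distr S path_space concat_seq. \<forall>\<^sub>F n in sequentially. b < (\<Sum>k<n. f (orbit x \<omega> k)) / real n"
    by (subst AE_distr_iff) (auto simp: pred_def)
  then show ?thesis unfolding distr_concat_seq[OF recurrent] .
qed

end

text \<open>The increments \<open>word_prod g (rev (W k))\<close> are independent with law
  \<open>renewal_measure K g e\<close>, so the endpoints form the random walk of the assumption. An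
  almost sure statement about an image measure pulls back along the map, whatever the event.\<close>

lemma AE_equidistributes_endpoint:
  assumes "AE b in (\<Pi>\<^sub>M k\<in>(UNIV::nat set). renewal_measure K g e).
           equidistributes (\<lambda>n. act (prod_list (prefix_word b n)) x) m"
  shows "AE W in S. equidistributes (endpoint x W) m"
proof -
  have \<phi>: "(\<lambda>w. word_prod g (rev w)) \<in> excursion_law K e \<rightarrow>\<^sub>M borel"
    by (rule measurable_excursion_lawI) simp
  have "(\<lambda>W k. word_prod g (rev (W k))) \<in> S \<rightarrow>\<^sub>M PiM UNIV (\<lambda>_. borel)"
  proof (rule measurable_PiM_single')
    show "(\<lambda>W. word_prod g (rev (W k))) \<in> S \<rightarrow>\<^sub>M borel" for k
      by (rule measurable_compose[of "\<lambda>W. W k" S "excursion_law K e", OF measurable_component_singleton \<phi>]) simp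
  qed auto
  moreover have "AE b in distr S (PiM UNIV (\<lambda>_. borel)) (\<lambda>W k. word_prod g (rev (W k))).
      equidistributes (\<lambda>n. act (prod_list (prefix_word b n)) x) m"
    using assms unfolding renewal_measure_eq_distr distr_PiM_map[OF \<phi>] .
  ultimately have "AE W in S. equidistributes (\<lambda>n. act (prod_list (prefix_word (\<lambda>k. word_prod g (rev (W k))) n)) x) m"
    by (rule AE_distrD)
  then show ?thesis by (simp add: prod_list_prefix_word_excursions endpoint_def[abs_def])
qed

end

theorem proposition3p8:
  fixes A :: "('g::{group_mult, t2_space, second_countable_topology},
               'v::real_normed_vector) chart set"
    and act :: "'g \<Rightarrow> 'x::second_countable_topology \<Rightarrow> 'x"
    and g :: "'e::countable_discrete \<Rightarrow> 'g"
    and K :: "'e \<Rightarrow> 'e pmf" and \<pi> :: "'e pmf"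
    and x\<^sub>0 :: 'x and e :: 'e and m :: "'x measure"
  assumes "lie_group A"
    and "locally_compact_space (euclidean :: 'x topology)"
    and "metrizable_space (euclidean :: 'x topology)"
    and "continuous_action act"
    and "irreducible_chain K" and "positive_recurrent K"
    and "stationary K \<pi>"
    and "prob_space m" and "sets m = sets borel"
    and "\<And>w. admissible K w \<Longrightarrow> starts_with w e \<Longrightarrow> distr m borel (act (word_prod g w)) = m"
    and "AE b in (\<Pi>\<^sub>M k\<in>(UNIV::nat set). renewal_measure K g e).
           equidistributes (\<lambda>n. act (prod_list (prefix_word b n)) x\<^sub>0) m"
  shows "AE \<omega> in markov K e.
           equidistributes (\<lambda>n. (act (word_prod g (prefix_word \<omega> n)) x\<^sub>0, (shift_map ^^ n) \<omega>))
             (m \<Otimes>\<^sub>M markov_init K \<pi>)"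
proof -
  interpret excursion_walk act g K e
    using assms(4) AE_return_time_finite_self[OF assms(6)] by unfold_locales
  let ?\<nu> = "m \<Otimes>\<^sub>M markov_init K \<pi>"
  obtain D :: "('x \<times> (nat \<Rightarrow> 'e) \<Rightarrow> real) set" where D: "countable D" "\<And>u. u \<in> D \<Longrightarrow> cylinder_function u"
    and test: "\<And>y \<nu>. prob_space \<nu> \<Longrightarrow> sets \<nu> = sets borel \<Longrightarrow>
       (\<And>u b. u \<in> D \<Longrightarrow> b < (\<integral>p. u p \<partial>\<nu>) \<Longrightarrow> \<forall>\<^sub>F n in sequentially. b < (\<Sum>k<n. u (y k)) / real n) \<Longrightarrow>
       equidistributes y \<nu>"
  proof (rule countable_equidistribution_test[where 'e='e, OF assms(3)], goal_cases)
    case (1 D)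
    show thesis by (rule 1(1)) (fact 1(2), fact 1(3), fact 1(4))
  qed
  \<comment> \<open>With \<open>D\<close> countable and rational thresholds a single null set
    remains; density of the rationals recovers every real \<open>b\<close>.\<close>
  have "AE \<omega> in markov K e. \<forall>u\<in>D. \<forall>q. real_of_rat q < (\<integral>p. u p \<partial>?\<nu>) \<longrightarrow>
      (\<forall>\<^sub>F n in sequentially. real_of_rat q < (\<Sum>k<n. u (orbit x\<^sub>0 \<omega> k)) / real n)"
  proof (rule AE_ball_countable[THEN iffD2, OF D(1)], intro ballI AE_all_countable[THEN iffD2] allI)
    fix u and q :: rat assume "u \<in> D"
    show "AE \<omega> in markov K e. real_of_rat q < (\<integral>p. u p \<partial>?\<nu>) \<longrightarrow>
      (\<forall>\<^sub>F n in sequentially. real_of_rat q < (\<Sum>k<n. u (orbit x\<^sub>0 \<omega> k)) / real n)"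
    proof (cases "real_of_rat q < (\<integral>p. u p \<partial>?\<nu>)")
      case True
      have "AE \<omega> in markov K e. \<forall>\<^sub>F n in sequentially. real_of_rat q < (\<Sum>k<n. u (orbit x\<^sub>0 \<omega> k)) / real n"
        by (rule AE_liminf_orbit_average[OF assms(8,9) _ assms(5-7) D(2)[OF \<open>u \<in> D\<close>] AE_equidistributes_endpoint[OF assms(11)] True])
           (rule assms(10))
      then show ?thesis by eventually_elim simp
    qed simp
  qed
  then show ?thesis
  proof eventually_elim
    case (elim \<omega>)
    have "equidistributes (orbit x\<^sub>0 \<omega>) ?\<nu>"
    proof (rule test[OF prob_space_pair_markov_init[OF assms(8)] sets_pair_markov_init[OF assms(9)]])
      fix u and b :: real assume u: "u \<in> D" "b < (\<integral>p. u p \<partial>?\<nu>)"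
      then obtain q where q: "b < real_of_rat q" "real_of_rat q < (\<integral>p. u p \<partial>?\<nu>)"
        using of_rat_dense by blast
      with elim u have "\<forall>\<^sub>F n in sequentially. real_of_rat q < (\<Sum>k<n. u (orbit x\<^sub>0 \<omega> k)) / real n" by blast
      then show "\<forall>\<^sub>F n in sequentially. b < (\<Sum>k<n. u (orbit x\<^sub>0 \<omega> k)) / real n"
        by eventually_elim (use q in linarith)
    qed
    then show ?case by (simp add: orbit_def[abs_def])
  qed
qed

end
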